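(* Let $d\ge2$, let $\Gamma=(V,\mathcal E)$ be a $\mathbb Z^d$-periodic graph with fundamental graph $\Gamma_f$ having $\nu$ vertices, and let $H=\Delta+Q$ be the Schrödinger operator on $\ell^2(V)$ with a real $\mathbb Z^d$-periodic potential. Then: (i) If $|\Delta_{jk}(\cdot)|$ is not constant on $\mathbb T^d$ for some $j,k\in\{1,\ldots,\nu\}$, then the first spectral band $\sigma_1(H)=[\lambda_1^-,\lambda_1^+]$ is non-degenerate, i.e. $\lambda_1^-<\lambda_1^+$. (ii) The Lebesgue measure $|\sigma(H)|$ of the spectrum of $H$ satisfies $$|\sigma(H)|\le\sum_{n=1}^\nu|\sigma_n(H)|\le2\beta,\qquad(\ast)$$ where $\beta$ is the number of bridges of the fundamental graph. Moreover, if in the spectrum $\sigma(H)$ there exist $s$ spectral gaps $\gamma_1(H),\ldots,\gamma_s(H)$, then $$\sum_{n=1}^s|\gamma_n(H)|\ \ge\ \lambda_\nu^+-\lambda_1^--2\beta\ \ge\ C_0-2\beta,\qquad(\ast\ast)$$ $$C_0=\max\{\lambda_\nu^{0+}-q_\bullet,\ q_\bullet-2\varkappa_+\},\qquad q_\bullet=\max_nq_n-\min_nq_n .$$ The estimates $(\ast)$ and the first estimate in $(\ast\ast)$ become identities for some classes of graphs, namely when $\Gamma$ is a precise loop graph for which all bridges of the loop fundamental graph $\Gamma_f$ have the form $(v_k,v_k)$ for one vertex $v_k$.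
   Context: A $\mathbb Z^d$-periodic graph $\Gamma=(V,\mathcal E)$ ($d\ge2$) is a connected graph embedded in $\mathbb R^d$, possibly with loops and multiple edges, with vertex set $V$ and set $\mathcal E$ of unoriented edges, such that: any bounded domain of $\mathbb R^d$ contains finitely many vertices; every vertex has finite degree (number of incident edges, a loop counted twice); and there is a basis $a_1,\ldots,a_d$ of $\mathbb R^d$ (the periods) with $\Gamma+a_s=\Gamma$ for $s=1,\ldots,d$. Coordinates are taken with some origin and axes along $a_1,\ldots,a_d$, so that $\Gamma+m=\Gamma$ for all $m\in\mathbb Z^d$. Each unoriented edge gives two oriented edges $(u,v)$ and $(v,u)$ (an unoriented loop gives two oriented loops); $\mathcal A$ is the set of oriented edges. The fundamental graph is $\Gamma_f=\Gamma/\mathbb Z^d$; it is finite, its vertices are identified with $V\cap[0,1)^d=\{v_1,\ldots,v_\nu\}$, and $\mathcal A_f=\mathcal A/\mathbb Z^d$ is its set of oriented edges. Every $v\in V$ is uniquely $v=[v]+\tilde v$ with $[v]\in\mathbb Z^d$, $\tilde v\in V\cap[0,1)^d$. The index of $\mathbf e=(u,v)\in\mathcal A$ is $\tau(\mathbf e)=[v]-[u]\in\mathbb Z^d$; it is $\mathbb Z^d$-translation invariant and defines the index of the corresponding edge of $\mathcal A_f$. Edges of $\mathcal A_f$ with nonzero index are called bridges; $\mathcal B_f\subset\mathcal A_f$ is the set of bridges, and $\beta=\#\mathcal B_f$ (oriented edges are counted). $(\Delta f)(v)=\sum_{(v,u)_e\in\mathcal E}(f(v)-f(u))$ on $\ell^2(V)$,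 where $(v,u)_e$ denotes an unoriented edge; $Q$ is multiplication by a real function with $Q(v+m)=Q(v)$, $m\in\mathbb Z^d$; $q_j=Q(v_j)$; $H=\Delta+Q$; $\varkappa_+=\sup_{v\in V}\deg v$. The Floquet matrices, for $\vartheta\in\mathbb T^d=\mathbb R^d/(2\pi\mathbb Z)^d$, are $H(\vartheta)=\Delta(\vartheta)+\mathrm{diag}(q_1,\ldots,q_\nu)$, $\Delta_{jk}(\vartheta)=\varkappa_j\delta_{jk}-\sum_{\mathbf e=(v_j,v_k)\in\mathcal A_f}e^{i\langle\tau(\mathbf e),\vartheta\rangle}$, $\varkappa_j=\deg v_j$. $H$ is unitarily equivalent to the direct integral of the $H(\vartheta)$. Let $\lambda_1(\vartheta)\le\ldots\le\lambda_\nu(\vartheta)$ be the eigenvalues of $H(\vartheta)$ with multiplicity; the spectral bands are $\sigma_n(H)=[\lambda_n^-,\lambda_n^+]=\lambda_n(\mathbb T^d)$, and $\sigma(H)=\bigcup_{n=1}^\nu\sigma_n(H)$. A band is non-degenerate if $\lambda_n^-<\lambda_n^+$. An open interval between two neighboring non-degenerate spectral bands is called a spectral gap. For $Q=0$ the same objects carry a superscript $0$: $\sigma_n(\Delta)=[\lambda_n^{0-},\lambda_n^{0+}]$. A loop graph is a periodic graph such that all bridges of some fundamental graph $\Gamma_f$ are loops ($\Gamma_f$ is then called a loop fundamental graph). It is precise if for some $\vartheta_0\in\mathbb T^d$ one has $\cos\langle\tau(\mathbf e),\vartheta_0\rangle=-1$ for all bridges $\mathbf e$ of $\Gamma_f$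.
   Formalization: The gap estimate and its identity case are false if a degenerate band is isolated at an end of the spectrum; they are stated for gaps between all neighboring bands, and for gaps between non-degenerate bands when such bands attain both the lowest and the highest point of the spectrum. *)

theory Defs
  imports
    "Jordan_Normal_Form.Char_Poly"
    "Graph_Theory.Bidirected_Digraph"
    "Graph_Theory.Digraph_Component"
    "HOL-Analysis.Analysis"
begin

no_notation Matrix.vec_index (infixl "$" 100)

section \<open>Periodic graphs\<close>

text \<open>
  A graph with vertices in $R^d$ is given by its \<^emph>\<open>oriented\<close> edges: \<open>ograph\<close> is a multidigraph
  and \<open>arev\<close> its edge reversal. \<^locale>\<open>bidirected_digraph\<close> demands that \<open>arev\<close> be an involution
  without fixed arcs, so the unoriented edges are the pairs \<open>{e, arev e}\<close>, and an unoriented loop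
  consists of two oriented loops. The field \<open>shift\<close> is the action of $Z^d$ on the oriented edges by
  translation. (How edges are drawn as curves is irrelevant; a translation-invariant drawing
  induces this action.) The fundamental cell is spanned by the periods \<open>period s\<close> from the point
  \<open>origin\<close>; different choices of periods and origin may give different fundamental graphs.
\<close>

record ('d, 'e) lattice_graph =
  ograph :: "(real ^ 'd, 'e) pre_digraph"
  arev :: "'e \<Rightarrow> 'e"
  shift :: "int ^ 'd \<Rightarrow> 'e \<Rightarrow> 'e"
  period :: "'d \<Rightarrow> real ^ 'd"
  origin :: "real ^ 'd"

abbreviation vertices :: "('d::finite, 'e) lattice_graph \<Rightarrow> (real ^ 'd) set" where
  "vertices \<Gamma> \<equiv> verts (ograph \<Gamma>)"

abbreviation oedges :: "('d::finite, 'e) lattice_graph \<Rightarrow> 'e set" where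
  "oedges \<Gamma> \<equiv> arcs (ograph \<Gamma>)"

definition lattice_vec :: "('d::finite, 'e) lattice_graph \<Rightarrow> int ^ 'd \<Rightarrow> real ^ 'd" where
  "lattice_vec \<Gamma> m = (\<Sum>s\<in>UNIV. real_of_int (m $ s) *\<^sub>R period \<Gamma> s)"

text \<open>
  A loop counts twice in \<^const>\<open>out_degree\<close>, being represented by two oriented loops.
\<close>

abbreviation deg :: "('d::finite, 'e) lattice_graph \<Rightarrow> real ^ 'd \<Rightarrow> nat" where
  "deg \<Gamma> u \<equiv> out_degree (ograph \<Gamma>) u"

locale periodic_graph =
  fixes \<Gamma> :: "('d::finite, 'e) lattice_graph"
  assumes bidirected: "bidirected_digraph (ograph \<Gamma>) (arev \<Gamma>)"
    and connected: "Digraph_Component.connected (ograph \<Gamma>)"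
    and locally_finite: "\<And>B. bounded B \<Longrightarrow> finite (vertices \<Gamma> \<inter> B)"
    and finite_degree: "\<And>u. u \<in> vertices \<Gamma> \<Longrightarrow> finite (out_arcs (ograph \<Gamma>) u)"
    and period_inj: "inj (period \<Gamma>)"
    and period_independent: "independent (range (period \<Gamma>))"
    and period_span: "span (range (period \<Gamma>)) = UNIV"
    and vertex_periodic: "\<And>m. (\<lambda>u. u + lattice_vec \<Gamma> m) ` vertices \<Gamma> = vertices \<Gamma>"
    and shift_arcs: "\<And>m e. e \<in> oedges \<Gamma> \<Longrightarrow> shift \<Gamma> m e \<in> oedges \<Gamma>"
    and shift_zero: "\<And>e. e \<in> oedges \<Gamma> \<Longrightarrow> shift \<Gamma> 0 e = e"
    and shift_add: "\<And>m n e. e \<in> oedges \<Gamma> \<Longrightarrow> shift \<Gamma> (m + n) e = shift \<Gamma> m (shift \<Gamma> n e)"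
    and shift_arev: "\<And>m e. e \<in> oedges \<Gamma> \<Longrightarrow> shift \<Gamma> m (arev \<Gamma> e) = arev \<Gamma> (shift \<Gamma> m e)"
    and shift_tail: "\<And>m e. e \<in> oedges \<Gamma> \<Longrightarrow>
          tail (ograph \<Gamma>) (shift \<Gamma> m e) = tail (ograph \<Gamma>) e + lattice_vec \<Gamma> m"
    and shift_head: "\<And>m e. e \<in> oedges \<Gamma> \<Longrightarrow>
          head (ograph \<Gamma>) (shift \<Gamma> m e) = head (ograph \<Gamma>) e + lattice_vec \<Gamma> m"

definition periodic_potential :: "('d::finite, 'e) lattice_graph \<Rightarrow> (real ^ 'd \<Rightarrow> real) \<Rightarrow> bool" where
  "periodic_potential \<Gamma> Q \<longleftrightarrow> (\<forall>u\<in>vertices \<Gamma>. \<forall>m. Q (u + lattice_vec \<Gamma> m) = Q u)"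

section \<open>The fundamental graph\<close>

text \<open>The cell \<open>[0,1)^d\<close> in the coordinates given by the origin and the periods.\<close>

definition cell :: "('d::finite, 'e) lattice_graph \<Rightarrow> (real ^ 'd) set" where
  "cell \<Gamma> = {origin \<Gamma> + (\<Sum>s\<in>UNIV. x s *\<^sub>R period \<Gamma> s) | x :: 'd \<Rightarrow> real. \<forall>s. 0 \<le> x s \<and> x s < 1}"

definition int_part :: "('d::finite, 'e) lattice_graph \<Rightarrow> real ^ 'd \<Rightarrow> int ^ 'd" where
  "int_part \<Gamma> u = (THE m. u - lattice_vec \<Gamma> m \<in> cell \<Gamma>)"

definition frac_part :: "('d::finite, 'e) lattice_graph \<Rightarrow> real ^ 'd \<Rightarrow> real ^ 'd" where
  "frac_part \<Gamma> u = u - lattice_vec \<Gamma> (int_part \<Gamma> u)"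

definition edge_index :: "('d::finite, 'e) lattice_graph \<Rightarrow> 'e \<Rightarrow> int ^ 'd" where
  "edge_index \<Gamma> e = int_part \<Gamma> (head (ograph \<Gamma>) e) - int_part \<Gamma> (tail (ograph \<Gamma>) e)"

definition edge_orbit :: "('d::finite, 'e) lattice_graph \<Rightarrow> 'e \<Rightarrow> 'e set" where
  "edge_orbit \<Gamma> e = range (\<lambda>m. shift \<Gamma> m e)"

text \<open>
  An oriented edge of the fundamental graph is an orbit of oriented edges; its end points and its
  index are the common values on the orbit.
\<close>

definition fund_graph :: "('d::finite, 'e) lattice_graph \<Rightarrow> (real ^ 'd, 'e set) pre_digraph" where
  "fund_graph \<Gamma> = \<lparr> verts = vertices \<Gamma> \<inter> cell \<Gamma>,
                    arcs = edge_orbit \<Gamma> ` oedges \<Gamma>,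
                    tail = (\<lambda>X. the_elem ((\<lambda>e. frac_part \<Gamma> (tail (ograph \<Gamma>) e)) ` X)),
                    head = (\<lambda>X. the_elem ((\<lambda>e. frac_part \<Gamma> (head (ograph \<Gamma>) e)) ` X)) \<rparr>"

definition fund_index :: "('d::finite, 'e) lattice_graph \<Rightarrow> 'e set \<Rightarrow> int ^ 'd" where
  "fund_index \<Gamma> X = the_elem (edge_index \<Gamma> ` X)"

definition num_verts :: "('d::finite, 'e) lattice_graph \<Rightarrow> nat" where
  "num_verts \<Gamma> = card (verts (fund_graph \<Gamma>))"

definition bridges :: "('d::finite, 'e) lattice_graph \<Rightarrow> 'e set set" where
  "bridges \<Gamma> = {X \<in> arcs (fund_graph \<Gamma>). fund_index \<Gamma> X \<noteq> 0}"

definition phase :: "int ^ 'd \<Rightarrow> real ^ 'd \<Rightarrow> real" where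
  "phase m \<theta> = (\<Sum>s\<in>UNIV. real_of_int (m $ s) * \<theta> $ s)"

text \<open>
  Loop graphs and precise loop graphs are defined through the existence of a suitable fundamental
  graph. The two predicates below refer to the fundamental graph determined by the periods and
  the origin stored in \<open>\<Gamma>\<close>.
\<close>

definition loop_fund_graph :: "('d::finite, 'e) lattice_graph \<Rightarrow> bool" where
  "loop_fund_graph \<Gamma> \<longleftrightarrow> (\<forall>X\<in>bridges \<Gamma>. tail (fund_graph \<Gamma>) X = head (fund_graph \<Gamma>) X)"

definition precise_loop_fund_graph :: "('d::finite, 'e) lattice_graph \<Rightarrow> bool" where
  "precise_loop_fund_graph \<Gamma> \<longleftrightarrow> loop_fund_graph \<Gamma> \<and>
     (\<exists>\<theta>\<^sub>0. \<forall>X\<in>bridges \<Gamma>. cos (phase (fund_index \<Gamma> X) \<theta>\<^sub>0) = -1)"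

section \<open>The operator and its spectrum\<close>

text \<open>Elements of $l^2(S)$ are functions on the ambient type that vanish off \<open>S\<close>.\<close>

definition l2 :: "'a set \<Rightarrow> ('a \<Rightarrow> complex) set" where
  "l2 S = {f. (\<forall>u. u \<notin> S \<longrightarrow> f u = 0) \<and> (\<lambda>u. (cmod (f u))\<^sup>2) summable_on S}"

definition l2_norm :: "'a set \<Rightarrow> ('a \<Rightarrow> complex) \<Rightarrow> real" where
  "l2_norm S f = sqrt (\<Sum>\<^sub>\<infinity>u\<in>S. (cmod (f u))\<^sup>2)"

text \<open>The complement of the set of \<open>z\<close> for which \<open>T - z\<close> has a bounded inverse on $l^2(S)$.\<close>

definition l2_spectrum :: "'a set \<Rightarrow> (('a \<Rightarrow> complex) \<Rightarrow> 'a \<Rightarrow> complex) \<Rightarrow> complex set" where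
  "l2_spectrum S T = {z. \<not> (bij_betw (\<lambda>f u. T f u - z * f u) (l2 S) (l2 S) \<and>
      (\<exists>C. \<forall>f\<in>l2 S. l2_norm S f \<le> C * l2_norm S (\<lambda>u. T f u - z * f u)))}"

text \<open>
  A non-loop unoriented edge at \<open>u\<close> contributes exactly one oriented edge with tail \<open>u\<close>; loops
  contribute zero.
\<close>

definition laplacian ::
  "('d::finite, 'e) lattice_graph \<Rightarrow> (real ^ 'd \<Rightarrow> complex) \<Rightarrow> real ^ 'd \<Rightarrow> complex" where
  "laplacian \<Gamma> f u = (\<Sum>e\<in>out_arcs (ograph \<Gamma>) u. f u - f (head (ograph \<Gamma>) e))"

definition schroedinger ::
  "('d::finite, 'e) lattice_graph \<Rightarrow> (real ^ 'd \<Rightarrow> real) \<Rightarrow> (real ^ 'd \<Rightarrow> complex) \<Rightarrow> real ^ 'd \<Rightarrow> complex"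
  where "schroedinger \<Gamma> Q f u = laplacian \<Gamma> f u + complex_of_real (Q u) * f u"

text \<open>The operator is self-adjoint, so nothing is lost by keeping the real points only.\<close>

definition spec :: "('d::finite, 'e) lattice_graph \<Rightarrow> (real ^ 'd \<Rightarrow> real) \<Rightarrow> real set" where
  "spec \<Gamma> Q = {x. complex_of_real x \<in> l2_spectrum (vertices \<Gamma>) (schroedinger \<Gamma> Q)}"

section \<open>Floquet matrices, spectral bands and gaps\<close>

text \<open>
  Here \<open>v 1, ..., v \<nu>\<close> enumerates the vertices of the fundamental graph, and a function on the
  torus $R^d/(2 \pi Z)^d$ is treated as a periodic function of $\theta \in R^d$.
\<close>

definition floquet_laplacian ::
  "('d::finite, 'e) lattice_graph \<Rightarrow> (nat \<Rightarrow> real ^ 'd) \<Rightarrow> nat \<Rightarrow> nat \<Rightarrow> real ^ 'd \<Rightarrow> complex" where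
  "floquet_laplacian \<Gamma> v j k \<theta> = (if j = k then of_nat (deg \<Gamma> (v j)) else 0) -
     (\<Sum>X | X \<in> arcs (fund_graph \<Gamma>) \<and> tail (fund_graph \<Gamma>) X = v j \<and> head (fund_graph \<Gamma>) X = v k.
        exp (\<i> * complex_of_real (phase (fund_index \<Gamma> X) \<theta>)))"

text \<open>Matrix indices start at 0, the enumeration \<open>v\<close> at 1.\<close>

definition floquet_matrix ::
  "('d::finite, 'e) lattice_graph \<Rightarrow> (nat \<Rightarrow> real ^ 'd) \<Rightarrow> (real ^ 'd \<Rightarrow> real) \<Rightarrow> real ^ 'd
    \<Rightarrow> complex mat" where
  "floquet_matrix \<Gamma> v Q \<theta> = Matrix.mat (num_verts \<Gamma>) (num_verts \<Gamma>)
     (\<lambda>(j, k). floquet_laplacian \<Gamma> v (Suc j) (Suc k) \<theta> +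
        (if j = k then complex_of_real (Q (v (Suc j))) else 0))"

text \<open>
  The \<open>n\<close>-th smallest eigenvalue (\<open>n = 1, 2, ...\<close>) of a Hermitian matrix, counted with multiplicity;
  the roots of the characteristic polynomial are real in this case.
\<close>

definition nth_eigenvalue :: "complex mat \<Rightarrow> nat \<Rightarrow> real" where
  "nth_eigenvalue M n = sorted_list_of_multiset (image_mset Re (proots (char_poly M))) ! (n - 1)"

definition band ::
  "('d::finite, 'e) lattice_graph \<Rightarrow> (nat \<Rightarrow> real ^ 'd) \<Rightarrow> (real ^ 'd \<Rightarrow> real) \<Rightarrow> nat \<Rightarrow> real set" where
  "band \<Gamma> v Q n = range (\<lambda>\<theta>. nth_eigenvalue (floquet_matrix \<Gamma> v Q \<theta>) n)"

definition band_min ::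
  "('d::finite, 'e) lattice_graph \<Rightarrow> (nat \<Rightarrow> real ^ 'd) \<Rightarrow> (real ^ 'd \<Rightarrow> real) \<Rightarrow> nat \<Rightarrow> real" where
  "band_min \<Gamma> v Q n = Inf (band \<Gamma> v Q n)"

definition band_max ::
  "('d::finite, 'e) lattice_graph \<Rightarrow> (nat \<Rightarrow> real ^ 'd) \<Rightarrow> (real ^ 'd \<Rightarrow> real) \<Rightarrow> nat \<Rightarrow> real" where
  "band_max \<Gamma> v Q n = Sup (band \<Gamma> v Q n)"

definition nondegenerate ::
  "('d::finite, 'e) lattice_graph \<Rightarrow> (nat \<Rightarrow> real ^ 'd) \<Rightarrow> (real ^ 'd \<Rightarrow> real) \<Rightarrow> nat set" where
  "nondegenerate \<Gamma> v Q = {n \<in> {1..num_verts \<Gamma>}. band_min \<Gamma> v Q n < band_max \<Gamma> v Q n}"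

text \<open>The open intervals between neighbouring members of the family of bands with indices in \<open>N\<close>.\<close>

definition gaps_between ::
  "('d::finite, 'e) lattice_graph \<Rightarrow> (nat \<Rightarrow> real ^ 'd) \<Rightarrow> (real ^ 'd \<Rightarrow> real) \<Rightarrow> nat set
    \<Rightarrow> real set set" where
  "gaps_between \<Gamma> v Q N = {{band_max \<Gamma> v Q m <..< band_min \<Gamma> v Q n} | m n.
     m \<in> N \<and> n \<in> N \<and> band_max \<Gamma> v Q m < band_min \<Gamma> v Q n \<and>
     (\<forall>l\<in>N. band \<Gamma> v Q l \<inter> {band_max \<Gamma> v Q m <..< band_min \<Gamma> v Q n} = {})}"

text \<open>
  Gaps in the strict sense separate neighbouring \<^emph>\<open>non-degenerate\<close> bands. With this notion the sum of
  the gap lengths ignores the interval between an isolated degenerate band at the very top (or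
  bottom) of the spectrum and the rest of the spectrum, and then it need not be at least
  \<open>\<lambda>\<^sub>\<nu>\<^sup>+ - \<lambda>\<^sub>1\<^sup>- - 2 \<beta>\<close>. An example is the square lattice with a triangle \<open>u, a, b\<close> attached at each
  lattice vertex \<open>u\<close> and \<open>Q u = 0\<close>, \<open>Q a = Q b = 100\<close>: the function \<open>1\<close> at \<open>a\<close>, \<open>-1\<close> at \<open>b\<close> gives the
  degenerate band \<open>{103}\<close> above the other two, whose total length is \<open>8 = 2 \<beta>\<close>.
  The estimate on gaps is about all intervals between neighbouring bands
  (\<open>all_gaps\<close>), or about strict gaps (\<open>strict_gaps\<close>) if non-degenerate bands reach both ends of the
  spectrum. A degenerate band inside a strict gap does not affect the sum of the lengths.
\<close>

definition all_gaps ::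
  "('d::finite, 'e) lattice_graph \<Rightarrow> (nat \<Rightarrow> real ^ 'd) \<Rightarrow> (real ^ 'd \<Rightarrow> real) \<Rightarrow> real set set" where
  "all_gaps \<Gamma> v Q = gaps_between \<Gamma> v Q {1..num_verts \<Gamma>}"

definition strict_gaps ::
  "('d::finite, 'e) lattice_graph \<Rightarrow> (nat \<Rightarrow> real ^ 'd) \<Rightarrow> (real ^ 'd \<Rightarrow> real) \<Rightarrow> real set set" where
  "strict_gaps \<Gamma> v Q = gaps_between \<Gamma> v Q (nondegenerate \<Gamma> v Q)"

definition nondegenerate_ends ::
  "('d::finite, 'e) lattice_graph \<Rightarrow> (nat \<Rightarrow> real ^ 'd) \<Rightarrow> (real ^ 'd \<Rightarrow> real) \<Rightarrow> bool" where
  "nondegenerate_ends \<Gamma> v Q \<longleftrightarrow>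
     (\<exists>n\<in>nondegenerate \<Gamma> v Q. band_min \<Gamma> v Q n = band_min \<Gamma> v Q 1) \<and>
     (\<exists>n\<in>nondegenerate \<Gamma> v Q. band_max \<Gamma> v Q n = band_max \<Gamma> v Q (num_verts \<Gamma>))"

definition potential_range ::
  "('d::finite, 'e) lattice_graph \<Rightarrow> (nat \<Rightarrow> real ^ 'd) \<Rightarrow> (real ^ 'd \<Rightarrow> real) \<Rightarrow> real" where
  "potential_range \<Gamma> v Q =
     Max ((\<lambda>n. Q (v n)) ` {1..num_verts \<Gamma>}) - Min ((\<lambda>n. Q (v n)) ` {1..num_verts \<Gamma>})"

definition max_deg :: "('d::finite, 'e) lattice_graph \<Rightarrow> real" where
  "max_deg \<Gamma> = (SUP u\<in>vertices \<Gamma>. real (deg \<Gamma> u))"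

definition C0 ::
  "('d::finite, 'e) lattice_graph \<Rightarrow> (nat \<Rightarrow> real ^ 'd) \<Rightarrow> (real ^ 'd \<Rightarrow> real) \<Rightarrow> real" where
  "C0 \<Gamma> v Q = max (band_max \<Gamma> v (\<lambda>_. 0) (num_verts \<Gamma>) - potential_range \<Gamma> v Q)
                  (potential_range \<Gamma> v Q - 2 * max_deg \<Gamma>)"

end

theory Submission imports Defs begin

text \<open>
  Eigenvalues of Hermitian matrices are compared through their quadratic forms. The bridges contribute
  to the form of \<open>H(\<theta>)\<close> a term bounded by the diagonal form of the bridge degrees, so all bands
  lie between the eigenvalues of two constant matrices whose traces differ by \<open>2 \<beta>\<close>. If all bridges
  are loops at one vertex, \<open>H(\<theta>)\<close> moves monotonically along a rank one form, hence the bands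
  interlace and the bounds are attained. If the first band is a point, the modulus of a ground state of
  \<open>H(\<theta>)\<close> is a ground state of \<open>H(0)\<close>, which leaves no room for cancellation in \<open>\<Delta>\<^sub>j\<^sub>k(\<theta>)\<close>.

  The spectrum is the union of the bands: outside of the bands, Parseval's identity bounds \<open>H - x\<close>
  from below on finitely supported functions, and a bounded symmetric operator that is bounded
  below is invertible; inside, truncated Bloch waves form a Weyl sequence.
\<close>

section \<open>Spectral theorem for Hermitian matrices\<close>

text \<open>The bands are defined by sorted roots of characteristic polynomials and the spectrum by
  invertibility on \<open>l2\<close>; neither is directly open to estimates. The roots are therefore
  matched with an orthonormal eigenbasis, and each comparison of eigenvalues is one inequality
  between quadratic forms, on all vectors or on a subspace of codimension one. The bridge form is
  bounded by |ab| \<le> (|a|^2 + |b|^2) / 2 together with the reversal of edges, which makes sources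
  and targets contribute equally; this is why each oriented bridge costs exactly 2. Bands may
  overlap, so gap lengths add up to the width of the spectrum minus the measure of the union of the
  bands, and the equality case needs non-overlap besides the exact sum of lengths. No direct
  integral is formed for the spectrum: finitely supported functions have trigonometric polynomials
  as Bloch components, so means along one orbit replace integration over the torus, and Richardson
  iteration keeps all approximate solutions finitely supported.\<close>

definition hip :: "nat \<Rightarrow> (nat \<Rightarrow> complex) \<Rightarrow> (nat \<Rightarrow> complex) \<Rightarrow> complex" where
  "hip n x y = (\<Sum>j<n. cnj (x j) * y j)"

definition nsq :: "nat \<Rightarrow> (nat \<Rightarrow> complex) \<Rightarrow> real" where
  "nsq n x = (\<Sum>j<n. (cmod (x j))\<^sup>2)"

definition mv :: "nat \<Rightarrow> (nat \<Rightarrow> nat \<Rightarrow> complex) \<Rightarrow> (nat \<Rightarrow> complex) \<Rightarrow> nat \<Rightarrow> complex" where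
  "mv n A x j = (\<Sum>k<n. A j k * x k)"

definition hermitian :: "nat \<Rightarrow> (nat \<Rightarrow> nat \<Rightarrow> complex) \<Rightarrow> bool" where
  "hermitian n A \<longleftrightarrow> (\<forall>j<n. \<forall>k<n. A j k = cnj (A k j))"

definition qform :: "nat \<Rightarrow> (nat \<Rightarrow> nat \<Rightarrow> complex) \<Rightarrow> (nat \<Rightarrow> complex) \<Rightarrow> real" where
  "qform n A x = Re (hip n x (mv n A x))"

text \<open>Vectors are total functions on \<open>nat\<close> of which only the values below
  \<open>n\<close> matter; the congruence rules allow any other representative, for instance one
  that vanishes from \<open>n\<close> on.\<close>

lemma hip_cong: "(\<And>j. j < n \<Longrightarrow> x j = x' j) \<Longrightarrow> (\<And>j. j < n \<Longrightarrow> y j = y' j) \<Longrightarrow> hip n x y = hip n x' y'"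
  by (simp add: hip_def)

lemma nsq_cong: "(\<And>j. j < n \<Longrightarrow> x j = x' j) \<Longrightarrow> nsq n x = nsq n x'"
  by (simp add: nsq_def)

lemma mv_cong: "(\<And>j. j < n \<Longrightarrow> x j = x' j) \<Longrightarrow> mv n A x j = mv n A x' j"
  by (simp add: mv_def)

lemma qform_cong: "(\<And>j. j < n \<Longrightarrow> x j = x' j) \<Longrightarrow> qform n A x = qform n A x'"
  unfolding qform_def by (rule arg_cong[where f = Re], rule hip_cong) (auto simp: mv_def)

lemma hip_add_right: "hip n x (\<lambda>j. y j + z j) = hip n x y + hip n x z"
  by (simp add: hip_def algebra_simps sum.distrib)

lemma hip_diff_right: "hip n x (\<lambda>j. y j - z j) = hip n x y - hip n x z"
  by (simp add: hip_def algebra_simps sum_subtractf)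

lemma hip_scale_right: "hip n x (\<lambda>j. c * y j) = c * hip n x y"
  by (simp add: hip_def algebra_simps sum_distrib_left)

lemma hip_sum_right: "hip n x (\<lambda>j. \<Sum>i\<in>I. f i j) = (\<Sum>i\<in>I. hip n x (f i))"
  by (simp add: hip_def sum_distrib_left sum.swap[of _ "{..<n}"])

lemma cnj_hip: "cnj (hip n x y) = hip n y x"
  by (simp add: hip_def cnj_sum mult.commute)

lemma hip_self: "hip n x x = of_real (nsq n x)"
  unfolding hip_def nsq_def of_real_sum
  by (rule sum.cong[OF refl]) (simp only: mult.commute[of "cnj _"] complex_norm_square)

lemma nsq_nonneg: "0 \<le> nsq n x"
  by (simp add: nsq_def sum_nonneg)

lemma nsq_eq_0_iff: "nsq n x = 0 \<longleftrightarrow> (\<forall>j<n. x j = 0)"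
  by (auto simp: nsq_def sum_nonneg_eq_0_iff)

lemma nsq_scale: "nsq n (\<lambda>j. c * x j) = (cmod c)\<^sup>2 * nsq n x"
  by (simp add: nsq_def norm_mult power_mult_distrib sum_distrib_left)

lemma qform_scale: "qform n A (\<lambda>j. c * x j) = (cmod c)\<^sup>2 * qform n A x"
proof -
  have "hip n (\<lambda>j. c * x j) (mv n A (\<lambda>j. c * x j)) = (c * cnj c) * hip n x (mv n A x)"
    by (simp add: hip_def mv_def sum_distrib_left algebra_simps)
  also have "c * cnj c = complex_of_real ((cmod c)\<^sup>2)"
    by (metis complex_norm_square of_real_power)
  finally show ?thesis unfolding qform_def by (simp del: of_real_power)
qed

lemma hip_mv_sym:
  assumes "hermitian n A"
  shows "hip n x (mv n A y) = hip n (mv n A x) y"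
proof -
  have "hip n x (mv n A y) = (\<Sum>j<n. \<Sum>k<n. cnj (x j) * A j k * y k)"
    by (simp add: hip_def mv_def sum_distrib_left mult.assoc)
  also have "\<dots> = (\<Sum>k<n. \<Sum>j<n. cnj (x j) * A j k * y k)" by (rule sum.swap)
  also have "\<dots> = (\<Sum>k<n. \<Sum>j<n. cnj (A k j) * cnj (x j) * y k)"
  proof (intro sum.cong refl)
    fix j k assume "k \<in> {..<n}" "j \<in> {..<n}"
    then have "A j k = cnj (A k j)" using assms unfolding hermitian_def by blast
    then show "cnj (x j) * A j k * y k = cnj (A k j) * cnj (x j) * y k"
      by (simp only: mult.commute)
  qed
  also have "\<dots> = hip n (mv n A x) y"
    by (simp add: hip_def mv_def sum_distrib_right)
  finally show ?thesis .
qed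

text \<open>Padding with zero rows gives a square matrix whose row \<open>m\<close> vanishes because
  \<open>m < N\<close>, so its determinant is zero. Every dimension count below rests on
  this.\<close>

lemma homogeneous_system:
  fixes a :: "nat \<Rightarrow> nat \<Rightarrow> complex"
  assumes "m < N"
  obtains c where "\<exists>i<N. c i \<noteq> 0" "\<And>r. r < m \<Longrightarrow> (\<Sum>i<N. a r i * c i) = 0"
proof -
  define M where "M = Matrix.mat N N (\<lambda>(r, i). if r < m then a r i else 0)"
  have M: "M \<in> carrier_mat N N" by (simp add: M_def)
  have "M = mat\<^sub>r N N (\<lambda>r. if r = m then 0\<^sub>v N else Matrix.row M r)"
    using assms by (intro eq_matI) (auto simp: M_def)
  moreover have "Determinant.det (mat\<^sub>r N N (\<lambda>r. if r = m then 0\<^sub>v N else Matrix.row M r)) = 0"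
    using Determinant.det_row_0[OF assms, of "Matrix.row M"] M by auto
  ultimately have "Determinant.det M = 0" by simp
  then obtain v where v: "v \<in> carrier_vec N" "v \<noteq> 0\<^sub>v N" "M *\<^sub>v v = 0\<^sub>v N"
    using det_0_iff_vec_prod_zero_field[OF M] by auto
  have "\<exists>i<N. vec_index v i \<noteq> 0"
    using v(1,2) by (metis carrier_vecD eq_vecI index_zero_vec(1) index_zero_vec(2))
  moreover have "(\<Sum>i<N. a r i * vec_index v i) = 0" if "r < m" for r
  proof -
    have "vec_index (M *\<^sub>v v) r = (\<Sum>i<N. a r i * vec_index v i)"
      using that assms v(1) by (simp add: M_def scalar_prod_def atLeast0LessThan)
    with v(3) that assms show ?thesis by simp
  qed
  ultimately show ?thesis by (rule that)
qed

text \<open>The coordinates from \<open>n\<close> on are pinned to 0, so that the set lies in a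
  product of compact factors and Tychonoff's theorem applies in the infinite product of
  coordinates.\<close>

lemma compact_unit_sphere_constrained:
  "compact {x :: nat \<Rightarrow> complex. (\<forall>j\<ge>n. x j = 0) \<and> nsq n x = 1 \<and> (\<forall>i<k. hip n (u i) x = 0)}"
  (is "compact ?K")
proof -
  let ?P = "PiE UNIV (\<lambda>j. if j < n then cball 0 1 else {0}) :: (nat \<Rightarrow> complex) set"
  have "compactin (product_topology (\<lambda>_. euclidean) UNIV) ?P"
    by (subst compactin_PiE) (auto simp: compactin_euclidean_iff)
  then have P: "compact ?P"
    by (simp add: euclidean_product_topology compactin_euclidean_iff)
  have coord: "continuous_on UNIV (\<lambda>x :: nat \<Rightarrow> complex. x j)" for j
    by (rule continuous_on_product_coordinates)
  have 1: "closed {x :: nat \<Rightarrow> complex. nsq n x = 1}"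
    unfolding nsq_def by (intro closed_Collect_eq continuous_intros coord)
  have 2: "closed {x :: nat \<Rightarrow> complex. \<forall>i<k. hip n (u i) x = 0}"
    unfolding hip_def by (intro closed_Collect_all closed_Collect_imp open_Collect_const closed_Collect_eq continuous_intros coord)
  have "?K = ?P \<inter> ({x. nsq n x = 1} \<inter> {x. \<forall>i<k. hip n (u i) x = 0})"
  proof -
    have "cmod (x j) \<le> 1" if "nsq n x = 1" "j < n" for x j
    proof -
      have "(cmod (x j))\<^sup>2 \<le> nsq n x"
        unfolding nsq_def using that by (intro member_le_sum) auto
      then show ?thesis using that by (simp add: power_le_one_iff abs_square_le_1[symmetric])
    qed
    then show ?thesis by (auto simp: PiE_iff split: if_splits)
  qed
  with compact_Int_closed[OF P closed_Int[OF 1 2]] show ?thesis by simp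
qed

text \<open>First order condition at a minimum: for small negative \<open>t\<close> the linear term
  would outweigh the quadratic one.\<close>

lemma quadratic_nonneg_imp_linear_zero:
  fixes a b :: real
  assumes "\<And>t. 0 \<le> 2 * t * a + t\<^sup>2 * b" and "0 \<le> a"
  shows "a = 0"
proof (rule ccontr)
  assume "a \<noteq> 0"
  with \<open>0 \<le> a\<close> have a: "a > 0" by simp
  \<comment> \<open>Chosen so that \<open>s * b\<close> is at most \<open>a\<close>, against
    \<open>2 * a \<le> s * b\<close> obtained from \<open>t = - s\<close>.\<close>
  define s where "s = a / (1 + \<bar>b\<bar>)"
  have s: "s > 0" using a by (simp add: s_def)
  have "0 \<le> s * (s * b - 2 * a)"
    using assms(1)[of "- s"] by (simp add: power2_eq_square algebra_simps)
  then have "2 * a \<le> s * b" using s by (simp add: zero_le_mult_iff)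
  also have "s * b \<le> s * (1 + \<bar>b\<bar>)" using s by (intro mult_left_mono) auto
  also have "\<dots> = a" by (simp add: s_def)
  finally show False using a by simp
qed

text \<open>The eigenvector is a minimiser of the Rayleigh quotient on the orthogonal complement of the
  eigenvectors found before.\<close>

lemma constrained_minimiser:
  assumes "hermitian n A" "k < n"
    and eig: "\<And>i j. i < k \<Longrightarrow> j < n \<Longrightarrow> mv n A (u i) j = of_real (\<mu> i) * u i j"
  obtains f m where "nsq n f = 1" "\<forall>i<k. hip n (u i) f = 0"
    "\<forall>g. (\<forall>i<k. hip n (u i) g = 0) \<longrightarrow> m * nsq n g \<le> qform n A g"
    "\<forall>j<n. mv n A f j = of_real m * f j"
proof -
  let ?K = "{x :: nat \<Rightarrow> complex. (\<forall>j\<ge>n. x j = 0) \<and> nsq n x = 1 \<and> (\<forall>i<k. hip n (u i) x = 0)}"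
  have normalise: "\<exists>h\<in>?K. qform n A g = nsq n g * qform n A h"
    if g: "\<And>i. i < k \<Longrightarrow> hip n (u i) g = 0" and "nsq n g \<noteq> 0" for g
  proof -
    define c where "c = complex_of_real (1 / sqrt (nsq n g))"
    have pos: "nsq n g > 0" using that(2) nsq_nonneg[of n g] by simp
    have c2: "(cmod c)\<^sup>2 = 1 / nsq n g"
      using pos by (simp add: c_def norm_divide power_divide)
    let ?h = "\<lambda>j. if j < n then c * g j else 0"
    have "nsq n ?h = nsq n (\<lambda>j. c * g j)" by (rule nsq_cong) simp
    then have "nsq n ?h = 1" using pos c2 by (simp add: nsq_scale)
    moreover have "hip n (u i) ?h = 0" if "i < k" for i
    proof -
      have "hip n (u i) ?h = hip n (u i) (\<lambda>j. c * g j)" by (rule hip_cong) auto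
      then show ?thesis using g[OF that] by (simp add: hip_scale_right)
    qed
    moreover have "qform n A ?h = qform n A (\<lambda>j. c * g j)" by (rule qform_cong) simp
    then have "qform n A g = nsq n g * qform n A ?h"
      using pos c2 by (simp add: qform_scale)
    ultimately show ?thesis by (intro bexI[of _ ?h]) auto
  qed
  \<comment> \<open>Only \<open>k < n\<close> linear conditions are imposed on \<open>n\<close>
    coordinates.\<close>
  have "?K \<noteq> {}"
  proof -
    obtain c where c: "\<exists>i<n. c i \<noteq> 0" "\<And>r. r < k \<Longrightarrow> (\<Sum>i<n. cnj (u r i) * c i) = 0"
      using homogeneous_system[OF \<open>k < n\<close>, of "\<lambda>r i. cnj (u r i)"] by blast
    then have "nsq n c \<noteq> 0" by (auto simp: nsq_eq_0_iff)
    then show ?thesis using normalise[of c] c(2) by (auto simp: hip_def)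
  qed
  moreover have "continuous_on ?K (qform n A)"
  proof -
    have "continuous_on UNIV (qform n A)"
      unfolding qform_def hip_def mv_def
      by (intro continuous_intros continuous_on_product_coordinates)
    then show ?thesis by (rule continuous_on_subset) simp
  qed
  ultimately have "\<exists>f\<in>?K. \<forall>g\<in>?K. qform n A f \<le> qform n A g"
    by (rule continuous_attains_inf[OF compact_unit_sphere_constrained])
  then obtain f where f: "f \<in> ?K" and min: "\<And>g. g \<in> ?K \<Longrightarrow> qform n A f \<le> qform n A g"
    by blast
  define m where "m = qform n A f"
  have low: "m * nsq n g \<le> qform n A g" if g: "\<And>i. i < k \<Longrightarrow> hip n (u i) g = 0" for g
  proof (cases "nsq n g = 0")
    case True
    then have "qform n A g = qform n A (\<lambda>_. 0)"
      by (intro qform_cong) (simp add: nsq_eq_0_iff)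
    with True show ?thesis by (simp add: qform_def hip_def)
  next
    case False
    then obtain h where h: "h \<in> ?K" "qform n A g = nsq n g * qform n A h"
      using normalise[OF g] by blast
    have "nsq n g * m \<le> nsq n g * qform n A h"
      using min[OF h(1)] nsq_nonneg[of n g] by (intro mult_left_mono) (simp_all add: m_def)
    with h(2) show ?thesis by (simp add: mult.commute)
  qed
  \<comment> \<open>The residual of the eigenvalue equation. It is orthogonal to the earlier
    eigenvectors by symmetry of \<open>A\<close>, so \<open>f + t r\<close> remains admissible for
    the minimum.\<close>
  define r where "r = (\<lambda>j. mv n A f j - of_real m * f j)"
  have r_perp: "hip n (u i) r = 0" if "i < k" for i
  proof -
    have "hip n (u i) (mv n A f) = hip n (mv n A (u i)) f"
      by (rule hip_mv_sym[OF assms(1)])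
    also have "\<dots> = hip n (\<lambda>j. of_real (\<mu> i) * u i j) f"
      using eig[OF that] by (intro hip_cong) auto
    also have "\<dots> = of_real (\<mu> i) * hip n (u i) f"
      by (simp add: hip_def sum_distrib_left mult.assoc)
    finally show ?thesis using f that by (simp add: r_def hip_diff_right hip_scale_right)
  qed
  \<comment> \<open>Along \<open>f + t r\<close> the defect \<open>qform - m * nsq\<close> is
    nonnegative, is 0 at \<open>t = 0\<close> and has linear coefficient
    \<open>2 * nsq n r\<close>.\<close>
  have "nsq n r = 0"
  proof (rule quadratic_nonneg_imp_linear_zero[OF _ nsq_nonneg])
    fix t :: real
    let ?g = "\<lambda>j. f j + of_real t * r j"
    have "hip n (u i) ?g = 0" if "i < k" for i
      using r_perp[OF that] f that by (simp add: hip_add_right hip_scale_right)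
    then have "m * nsq n ?g \<le> qform n A ?g" by (rule low)
    moreover have "nsq n ?g = nsq n f + 2 * t * Re (hip n r f) + t\<^sup>2 * nsq n r"
    proof -
      have "of_real (nsq n ?g) = hip n f f + t * hip n r f + t * hip n f r + t\<^sup>2 * hip n r r"
        unfolding hip_self[symmetric]
        by (simp add: hip_def algebra_simps sum.distrib sum_distrib_left power2_eq_square)
      then have "nsq n ?g = Re (hip n f f + t * hip n r f + t * hip n f r + t\<^sup>2 * hip n r r)"
        by (metis Re_complex_of_real)
      moreover have "Re (hip n f r) = Re (hip n r f)"
        by (metis cnj_hip cnj.simps(1))
      ultimately show ?thesis by (simp add: hip_self flip: of_real_power)
    qed
    moreover have "qform n A ?g = qform n A f + 2 * t * Re (hip n r (mv n A f)) + t\<^sup>2 * qform n A r"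
    proof -
      have mvg: "mv n A ?g j = mv n A f j + t * mv n A r j" for j
        by (simp add: mv_def algebra_simps sum.distrib sum_distrib_left)
      have "hip n ?g (mv n A ?g) = hip n f (mv n A f) + t * hip n r (mv n A f)
          + t * hip n f (mv n A r) + t\<^sup>2 * hip n r (mv n A r)"
        unfolding mvg by (simp add: hip_def algebra_simps sum.distrib sum_distrib_left power2_eq_square)
      moreover have "Re (hip n f (mv n A r)) = Re (hip n r (mv n A f))"
        by (metis hip_mv_sym[OF assms(1)] cnj_hip cnj.simps(1))
      ultimately show ?thesis unfolding qform_def by (simp flip: of_real_power)
    qed
    moreover have "nsq n r = Re (hip n r (mv n A f)) - m * Re (hip n r f)"
    proof -
      have "of_real (nsq n r) = hip n r (mv n A f) - m * hip n r f"
        unfolding hip_self[symmetric] by (subst (2) r_def) (simp add: hip_diff_right hip_scale_right)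
      then have "nsq n r = Re (hip n r (mv n A f) - m * hip n r f)"
        by (metis Re_complex_of_real)
      then show ?thesis by simp
    qed
    ultimately have "m * (1 + 2 * t * Re (hip n r f) + t\<^sup>2 * nsq n r)
        \<le> m + 2 * t * (nsq n r + m * Re (hip n r f)) + t\<^sup>2 * qform n A r"
      using f by (simp add: m_def)
    then show "0 \<le> 2 * t * nsq n r + t\<^sup>2 * (qform n A r - m * nsq n r)"
      by (simp add: algebra_simps)
  qed
  then have "\<And>j. j < n \<Longrightarrow> mv n A f j = of_real m * f j"
    by (simp add: nsq_eq_0_iff r_def)
  with f low show ?thesis by (intro that[of f m]) auto
qed

definition eigensystem ::
  "nat \<Rightarrow> (nat \<Rightarrow> nat \<Rightarrow> complex) \<Rightarrow> (nat \<Rightarrow> nat \<Rightarrow> complex) \<Rightarrow> (nat \<Rightarrow> real) \<Rightarrow> bool" where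
  "eigensystem n A u \<mu> \<longleftrightarrow>
    (\<forall>i<n. \<forall>k<n. hip n (u i) (u k) = (if i = k then 1 else 0)) \<and>
    (\<forall>i<n. \<forall>j<n. mv n A (u i) j = of_real (\<mu> i) * u i j) \<and>
    (\<forall>j<n. \<forall>i\<le>j. \<mu> i \<le> \<mu> j)"

theorem spectral_theorem:
  assumes A: "hermitian n A"
  obtains u \<mu> where "eigensystem n A u \<mu>"
proof -
  \<comment> \<open>The last clause, that each eigenvalue found so far bounds the form on the
    orthogonal complement, makes the next minimum at least as large and thus yields the
    ordering.\<close>
  define P where "P = (\<lambda>k u (\<mu> :: nat \<Rightarrow> real).
    (\<forall>i<k. \<forall>l<k. hip n (u i) (u l) = (if i = l then 1 else 0)) \<and>
    (\<forall>i<k. \<forall>j<n. mv n A (u i) j = of_real (\<mu> i) * u i j) \<and>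
    (\<forall>j<k. \<forall>i\<le>j. \<mu> i \<le> \<mu> j) \<and>
    (\<forall>l<k. \<forall>g. (\<forall>i<k. hip n (u i) g = 0) \<longrightarrow> \<mu> l * nsq n g \<le> qform n A g))"
  have "k \<le> n \<Longrightarrow> \<exists>u \<mu>. P k u \<mu>" for k
  proof (induction k)
    case 0
    show ?case by (auto simp: P_def)
  next
    case (Suc k)
    then obtain u \<mu> where P: "P k u \<mu>" by auto
    then have eig: "\<And>i j. i < k \<Longrightarrow> j < n \<Longrightarrow> mv n A (u i) j = of_real (\<mu> i) * u i j"
      by (auto simp: P_def)
    have "k < n" using Suc.prems by simp
    obtain f m where f: "nsq n f = 1" "\<forall>i<k. hip n (u i) f = 0"
      "\<forall>g. (\<forall>i<k. hip n (u i) g = 0) \<longrightarrow> m * nsq n g \<le> qform n A g"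
      "\<forall>j<n. mv n A f j = of_real m * f j"
      by (rule constrained_minimiser[OF A \<open>k < n\<close> eig])
    have "qform n A f = Re (hip n f (\<lambda>j. of_real m * f j))"
      unfolding qform_def using f(4) by (intro arg_cong[where f = Re] hip_cong) auto
    then have qf: "qform n A f = m" by (simp add: hip_scale_right hip_self f(1))
    have le: "\<mu> l \<le> m" if "l < k" for l
    proof -
      have "\<mu> l * nsq n f \<le> qform n A f"
        using P that f(2) unfolding P_def by blast
      then show ?thesis by (simp add: qf f(1))
    qed
    have "hip n f (u i) = 0" if "i < k" for i
      using f(2) that cnj_hip[of n "u i" f] by simp
    with f(1,2) have orth: "\<forall>i<Suc k. \<forall>l<Suc k.
        hip n ((u(k := f)) i) ((u(k := f)) l) = (if i = l then 1 else 0)"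
      using P by (auto simp: P_def less_Suc_eq hip_self)
    have ei: "\<forall>i<Suc k. \<forall>j<n. mv n A ((u(k := f)) i) j =
        complex_of_real ((\<mu>(k := m)) i) * (u(k := f)) i j"
      using P f(4) by (auto simp: P_def less_Suc_eq)
    have mono: "\<forall>j<Suc k. \<forall>i\<le>j. (\<mu>(k := m)) i \<le> (\<mu>(k := m)) j"
      using P le by (auto simp: P_def less_Suc_eq)
    have low: "(\<mu>(k := m)) l * nsq n g \<le> qform n A g"
      if "l < Suc k" and g: "\<forall>i<Suc k. hip n ((u(k := f)) i) g = 0" for l g
    proof -
      have "(\<mu>(k := m)) l \<le> m" using that(1) le by (auto simp: less_Suc_eq)
      then have "(\<mu>(k := m)) l * nsq n g \<le> m * nsq n g"
        by (intro mult_right_mono nsq_nonneg)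
      also have "\<dots> \<le> qform n A g"
        by (rule f(3)[rule_format]) (use g in \<open>metis fun_upd_other less_SucI less_irrefl\<close>)
      finally show ?thesis .
    qed
    have "P (Suc k) (u(k := f)) (\<mu>(k := m))"
      unfolding P_def using orth ei mono low by (intro conjI allI impI) blast+
    then show ?case by blast
  qed
  from this[of n] obtain u \<mu> where "P n u \<mu>" by auto
  then show ?thesis by (intro that[of u \<mu>]) (auto simp: P_def eigensystem_def)
qed

section \<open>Comparison of eigenvalues\<close>

context
  fixes n A u \<mu>
  assumes sys: "eigensystem n A u \<mu>"
begin

lemma eigensystem_orthonormal: "i < n \<Longrightarrow> k < n \<Longrightarrow> hip n (u i) (u k) = (if i = k then 1 else 0)"
  using sys unfolding eigensystem_def by blast

lemma eigensystem_eigen: "i < n \<Longrightarrow> j < n \<Longrightarrow> mv n A (u i) j = of_real (\<mu> i) * u i j"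
  using sys unfolding eigensystem_def by blast

lemma eigensystem_mono: "i \<le> j \<Longrightarrow> j < n \<Longrightarrow> \<mu> i \<le> \<mu> j"
  using sys unfolding eigensystem_def by blast

lemma eigensystem_adjoint_unitary:
  "Matrix.mat n n (\<lambda>(i, j). cnj (u i j)) * Matrix.mat n n (\<lambda>(j, i). u i j) = 1\<^sub>m n"
  by (rule eq_matI)
    (auto simp: scalar_prod_def atLeast0LessThan eigensystem_orthonormal simp flip: hip_def)

text \<open>Orthonormality of \<open>n\<close> vectors in dimension \<open>n\<close> turns into
  completeness, because a left inverse of a square matrix is a right inverse.\<close>

lemma eigensystem_unitary_adjoint:
  "Matrix.mat n n (\<lambda>(j, i). u i j) * Matrix.mat n n (\<lambda>(i, j). cnj (u i j)) = 1\<^sub>m n"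
  by (rule mat_mult_left_right_inverse[OF _ _ eigensystem_adjoint_unitary]) auto

lemma eigensystem_complete:
  assumes "j < n" "k < n"
  shows "(\<Sum>i<n. u i j * cnj (u i k)) = (if j = k then 1 else 0)"
proof -
  have "(Matrix.mat n n (\<lambda>(j, i). u i j) * Matrix.mat n n (\<lambda>(i, j). cnj (u i j))) $$ (j, k)
      = (\<Sum>i<n. u i j * cnj (u i k))"
    using assms by (simp add: scalar_prod_def atLeast0LessThan)
  then show ?thesis using assms by (simp add: eigensystem_unitary_adjoint)
qed

lemma eigensystem_expansion:
  assumes "j < n"
  shows "x j = (\<Sum>i<n. hip n (u i) x * u i j)"
proof -
  have "(\<Sum>i<n. hip n (u i) x * u i j) = (\<Sum>i<n. \<Sum>k<n. (u i j * cnj (u i k)) * x k)"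
    by (simp add: hip_def sum_distrib_right sum_distrib_left algebra_simps)
  also have "\<dots> = (\<Sum>k<n. \<Sum>i<n. (u i j * cnj (u i k)) * x k)" by (rule sum.swap)
  also have "\<dots> = (\<Sum>k<n. (\<Sum>i<n. u i j * cnj (u i k)) * x k)"
    by (simp add: sum_distrib_right)
  also have "\<dots> = (\<Sum>k<n. if j = k then x k else 0)"
    using assms by (intro sum.cong) (auto simp: eigensystem_complete)
  also have "\<dots> = x j" using assms by simp
  finally show ?thesis ..
qed

lemma hip_expansion: "hip n x y = (\<Sum>i<n. cnj (hip n (u i) x) * hip n (u i) y)"
proof -
  have "hip n x y = hip n x (\<lambda>j. \<Sum>i<n. hip n (u i) y * u i j)"
    by (intro hip_cong refl eigensystem_expansion)
  also have "\<dots> = (\<Sum>i<n. hip n (u i) y * hip n x (u i))"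
    by (simp add: hip_sum_right hip_scale_right)
  finally show ?thesis by (simp add: cnj_hip mult.commute)
qed

lemma nsq_expansion: "nsq n x = (\<Sum>i<n. (cmod (hip n (u i) x))\<^sup>2)"
proof -
  have "of_real (nsq n x) = complex_of_real (\<Sum>i<n. (cmod (hip n (u i) x))\<^sup>2)"
    unfolding hip_self[symmetric] of_real_sum complex_norm_square
    by (subst hip_expansion) (simp add: mult.commute)
  then show ?thesis by (simp only: of_real_eq_iff)
qed

lemma hip_eigenvector_mv:
  assumes "hermitian n A" "i < n"
  shows "hip n (u i) (mv n A x) = of_real (\<mu> i) * hip n (u i) x"
proof -
  have "hip n (u i) (mv n A x) = hip n (mv n A (u i)) x" by (rule hip_mv_sym[OF assms(1)])
  also have "\<dots> = hip n (\<lambda>j. of_real (\<mu> i) * u i j) x"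
    using assms(2) by (intro hip_cong) (auto simp: eigensystem_eigen)
  finally show ?thesis by (simp add: hip_def sum_distrib_left mult.assoc)
qed

lemma qform_expansion:
  assumes "hermitian n A"
  shows "qform n A x = (\<Sum>i<n. \<mu> i * (cmod (hip n (u i) x))\<^sup>2)"
proof -
  have "hip n x (mv n A x) = (\<Sum>i<n. cnj (hip n (u i) x) * (of_real (\<mu> i) * hip n (u i) x))"
    by (subst hip_expansion, intro sum.cong refl) (simp add: hip_eigenvector_mv[OF assms])
  also have "\<dots> = complex_of_real (\<Sum>i<n. \<mu> i * (cmod (hip n (u i) x))\<^sup>2)"
    unfolding of_real_sum of_real_mult complex_norm_square by (simp add: algebra_simps)
  finally show ?thesis by (simp only: qform_def Re_complex_of_real)
qed

lemma nsq_residual: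
  assumes "hermitian n A"
  shows "nsq n (\<lambda>j. mv n A x j - complex_of_real z * x j) =
    (\<Sum>i<n. (\<mu> i - z)\<^sup>2 * (cmod (hip n (u i) x))\<^sup>2)"
proof -
  have "hip n (u i) (\<lambda>j. mv n A x j - complex_of_real z * x j) =
      complex_of_real (\<mu> i - z) * hip n (u i) x" if "i < n" for i
    by (simp add: hip_diff_right hip_scale_right hip_eigenvector_mv[OF assms that] algebra_simps)
  then show ?thesis
    by (subst nsq_expansion, intro sum.cong refl)
      (simp add: norm_mult power_mult_distrib del: of_real_diff)
qed

text \<open>The components of \<open>x\<close> in the eigenbasis are multiplied by
  \<open>\<mu> i - z\<close>. This is the resolvent bound in one fibre, later used for all
  \<open>\<theta>\<close> with the same \<open>\<delta>\<close>.\<close>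

lemma nsq_residual_ge:
  assumes "hermitian n A" "0 \<le> \<delta>" "\<And>i. i < n \<Longrightarrow> \<delta> \<le> \<bar>\<mu> i - z\<bar>"
  shows "\<delta>\<^sup>2 * nsq n x \<le> nsq n (\<lambda>j. mv n A x j - complex_of_real z * x j)"
proof -
  have "\<delta>\<^sup>2 \<le> (\<mu> i - z)\<^sup>2" if "i < n" for i
    using assms(2) assms(3)[OF that] power_mono[of \<delta> "\<bar>\<mu> i - z\<bar>" 2] by simp
  then show ?thesis
    unfolding nsq_residual[OF assms(1)] nsq_expansion sum_distrib_left
    by (intro sum_mono mult_right_mono) auto
qed

lemma qform_ge_min:
  assumes "hermitian n A" shows "\<mu> 0 * nsq n x \<le> qform n A x"
  unfolding qform_expansion[OF assms] nsq_expansion sum_distrib_left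
  by (intro sum_mono mult_right_mono eigensystem_mono) auto

lemma qform_le_max:
  assumes "hermitian n A" shows "qform n A x \<le> \<mu> (n - 1) * nsq n x"
  unfolding qform_expansion[OF assms] nsq_expansion sum_distrib_left
  by (intro sum_mono mult_right_mono eigensystem_mono) auto

text \<open>The excesses \<open>\<mu> i - \<mu> 0\<close>, weighted by the squared components of
  \<open>x\<close>, are nonnegative and sum to 0, so \<open>x\<close> has components only in the
  lowest eigenspace.\<close>

lemma ground_state_eigenvector:
  assumes "hermitian n A" "qform n A x = \<mu> 0 * nsq n x" "j < n"
  shows "mv n A x j = complex_of_real (\<mu> 0) * x j"
proof -
  have mono: "\<mu> 0 \<le> \<mu> i" if "i < n" for i using that by (intro eigensystem_mono) auto
  have "(\<Sum>i<n. (\<mu> i - \<mu> 0) * (cmod (hip n (u i) x))\<^sup>2) = 0"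
    using assms(2) unfolding qform_expansion[OF assms(1)] nsq_expansion
    by (simp add: algebra_simps sum_subtractf sum_distrib_left)
  then have "(\<mu> i - \<mu> 0) * (cmod (hip n (u i) x))\<^sup>2 = 0" if "i < n" for i
    using that mono by (subst (asm) sum_nonneg_eq_0_iff) auto
  then have "(\<mu> i - \<mu> 0)\<^sup>2 * (cmod (hip n (u i) x))\<^sup>2 = 0" if "i < n" for i
    using that by auto
  then have "nsq n (\<lambda>j. mv n A x j - complex_of_real (\<mu> 0) * x j) = 0"
    unfolding nsq_residual[OF assms(1)] by (intro sum.neutral) auto
  with assms(3) show ?thesis by (simp add: nsq_eq_0_iff)
qed

text \<open>Completeness collapses the sum of \<open>hip n (u i) (mv n A (u i))\<close> to the
  diagonal of \<open>A\<close>. This is the link from sums of eigenvalues to counts of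
  edges.\<close>

lemma trace_eq_sum_eigenvalues: "(\<Sum>i<n. \<mu> i) = (\<Sum>j<n. Re (A j j))"
proof -
  have "(\<Sum>i<n. complex_of_real (\<mu> i)) = (\<Sum>i<n. hip n (u i) (mv n A (u i)))"
  proof (intro sum.cong refl)
    fix i assume "i \<in> {..<n}"
    then have "hip n (u i) (mv n A (u i)) = hip n (u i) (\<lambda>j. of_real (\<mu> i) * u i j)"
      by (intro hip_cong refl) (simp add: eigensystem_eigen)
    with \<open>i \<in> {..<n}\<close> show "complex_of_real (\<mu> i) = hip n (u i) (mv n A (u i))"
      by (simp add: hip_scale_right eigensystem_orthonormal)
  qed
  also have "\<dots> = (\<Sum>i<n. \<Sum>j<n. \<Sum>k<n. A j k * (u i k * cnj (u i j)))"
    by (simp add: hip_def mv_def sum_distrib_left algebra_simps)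
  also have "\<dots> = (\<Sum>j<n. \<Sum>i<n. \<Sum>k<n. A j k * (u i k * cnj (u i j)))"
    by (rule sum.swap)
  also have "\<dots> = (\<Sum>j<n. \<Sum>k<n. \<Sum>i<n. A j k * (u i k * cnj (u i j)))"
    by (intro sum.cong refl sum.swap)
  also have "\<dots> = (\<Sum>j<n. \<Sum>k<n. A j k * (\<Sum>i<n. u i k * cnj (u i j)))"
    by (simp add: sum_distrib_left)
  also have "\<dots> = (\<Sum>j<n. \<Sum>k<n. if k = j then A j k else 0)"
    by (intro sum.cong refl) (auto simp: eigensystem_complete)
  also have "\<dots> = (\<Sum>j<n. A j j)" by simp
  finally have "Re (\<Sum>i<n. complex_of_real (\<mu> i)) = Re (\<Sum>j<n. A j j)" by simp
  then show ?thesis by simp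
qed

lemma hip_combination:
  assumes "N \<le> n" "i < n"
  shows "hip n (u i) (\<lambda>j. \<Sum>l<N. c l * u l j) = (if i < N then c i else 0)"
proof -
  have "hip n (u i) (\<lambda>j. \<Sum>l<N. c l * u l j) = (\<Sum>l<N. c l * hip n (u i) (u l))"
    by (simp add: hip_sum_right hip_scale_right)
  also have "\<dots> = (\<Sum>l<N. if i = l then c l else 0)"
    using assms by (intro sum.cong refl) (auto simp: eigensystem_orthonormal)
  finally show ?thesis by simp
qed

end

text \<open>A dimension count: the span of the first \<open>i + p + 1\<close> eigenvectors of \<open>B\<close> meets the orthogonal
  complement of the first \<open>i\<close> eigenvectors of \<open>A\<close> and of the \<open>p\<close> constraints.\<close>

theorem eigenvalue_comparison:
  assumes A: "hermitian n A" "eigensystem n A u \<mu>" and B: "hermitian n B" "eigensystem n B w \<kappa>"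
    and le: "\<And>x. (\<And>r. r < p \<Longrightarrow> hip n (q r) x = 0) \<Longrightarrow> qform n A x \<le> qform n B x"
    and "i + p < n"
  shows "\<mu> i \<le> \<kappa> (i + p)"
proof -
  let ?N = "Suc (i + p)"
  let ?b = "\<lambda>r. if r < i then u r else q (r - i)"
  obtain c where c: "\<exists>l<?N. c l \<noteq> 0"
    "\<And>r. r < i + p \<Longrightarrow> (\<Sum>l<?N. hip n (?b r) (w l) * c l) = 0"
    by (rule homogeneous_system[of "i + p" ?N "\<lambda>r l. hip n (?b r) (w l)"]) auto
  define x where "x = (\<lambda>j. \<Sum>l<?N. c l * w l j)"
  have perp: "hip n (?b r) x = 0" if "r < i + p" for r
    using c(2)[OF that] by (simp only: x_def hip_sum_right hip_scale_right mult.commute)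
  have ux: "hip n (u r) x = 0" if "r < i" for r
    using perp[of r] that by simp
  have lx: "hip n (q r) x = 0" if "r < p" for r
    using perp[of "i + r"] that by simp
  have wx: "hip n (w l) x = (if l < ?N then c l else 0)" if "l < n" for l
    unfolding x_def using assms(6) that by (intro hip_combination[OF B(2)]) auto
  have "nsq n x > 0"
  proof -
    obtain l where "l < ?N" "c l \<noteq> 0" using c(1) by blast
    with assms(6) have l: "l < n" "hip n (w l) x \<noteq> 0" using wx by auto
    have "0 < (cmod (hip n (w l) x))\<^sup>2" using l by simp
    also have "\<dots> \<le> nsq n x"
      unfolding nsq_expansion[OF B(2)] using l by (intro member_le_sum) auto
    finally show ?thesis .
  qed
  have "\<mu> i * nsq n x \<le> qform n A x"
    unfolding qform_expansion[OF A(2,1)] nsq_expansion[OF A(2)] sum_distrib_left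
  proof (rule sum_mono)
    fix r assume "r \<in> {..<n}"
    then show "\<mu> i * (cmod (hip n (u r) x))\<^sup>2 \<le> \<mu> r * (cmod (hip n (u r) x))\<^sup>2"
      using ux[of r] eigensystem_mono[OF A(2), of i r] by (cases "r < i") (auto intro: mult_right_mono)
  qed
  also have "\<dots> \<le> qform n B x" using lx by (rule le)
  also have "\<dots> \<le> \<kappa> (i + p) * nsq n x"
    unfolding qform_expansion[OF B(2,1)] nsq_expansion[OF B(2)] sum_distrib_left
  proof (rule sum_mono)
    fix r assume "r \<in> {..<n}"
    then show "\<kappa> r * (cmod (hip n (w r) x))\<^sup>2 \<le> \<kappa> (i + p) * (cmod (hip n (w r) x))\<^sup>2"
      using wx[of r] eigensystem_mono[OF B(2), of r "i + p"] assms(6)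
      by (cases "r < ?N") (auto intro!: mult_right_mono)
  qed
  finally show ?thesis using \<open>nsq n x > 0\<close> by simp
qed

text \<open>The eigenvectors conjugate \<open>M\<close> to a diagonal matrix, whose characteristic
  polynomial is visibly split. Since \<open>\<mu>\<close> is increasing, it is already the sorted
  list inside \<open>nth_eigenvalue\<close>; the \<open>Suc\<close> reflects that eigenvalues are
  counted from 1.\<close>

lemma nth_eigenvalue_eigensystem:
  fixes M :: "complex mat"
  assumes M: "M \<in> carrier_mat n n" and sys: "eigensystem n (\<lambda>j k. M $$ (j, k)) u \<mu>"
  shows "char_poly M = (\<Prod>i\<leftarrow>[0..<n]. [:- complex_of_real (\<mu> i), 1:])"
    and "i < n \<Longrightarrow> nth_eigenvalue M (Suc i) = \<mu> i"
proof -
  define U where "U = Matrix.mat n n (\<lambda>(j, i). u i j)"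
  define V where "V = Matrix.mat n n (\<lambda>(i, j). cnj (u i j))"
  define D where "D = Matrix.mat n n (\<lambda>(i, j). if i = j then complex_of_real (\<mu> i) else 0)"
  have carr: "U \<in> carrier_mat n n" "V \<in> carrier_mat n n" "D \<in> carrier_mat n n"
    by (auto simp: U_def V_def D_def)
  have UV: "U * V = 1\<^sub>m n" and VU: "V * U = 1\<^sub>m n"
    using eigensystem_unitary_adjoint[OF sys] eigensystem_adjoint_unitary[OF sys]
    by (simp_all add: U_def V_def)
  have MU: "M * U = U * D"
  proof (rule eq_matI)
    fix j i assume ji: "j < dim_row (U * D)" "i < dim_col (U * D)"
    then have ji': "j < n" "i < n" using carr by auto
    have "(M * U) $$ (j, i) = mv n (\<lambda>j k. M $$ (j, k)) (u i) j"
      using ji' M carr by (simp add: scalar_prod_def mv_def atLeast0LessThan U_def)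
    also have "\<dots> = of_real (\<mu> i) * u i j" by (rule eigensystem_eigen[OF sys ji'(2,1)])
    also have "\<dots> = (\<Sum>k<n. if k = i then u k j * complex_of_real (\<mu> k) else 0)"
      using ji' by simp
    also have "\<dots> = (\<Sum>k<n. u k j * (if k = i then complex_of_real (\<mu> k) else 0))"
      by (intro sum.cong refl) simp
    also have "\<dots> = (U * D) $$ (j, i)"
      using ji' carr by (simp add: scalar_prod_def atLeast0LessThan U_def D_def)
    finally show "(M * U) $$ (j, i) = (U * D) $$ (j, i)" .
  qed (use M carr in auto)
  have "M = M * (U * V)" using M UV by simp
  also have "\<dots> = U * D * V" using M carr by (simp add: MU flip: assoc_mult_mat[of M n n U n V n])
  finally have "similar_mat M D"
    using M carr UV VU by (intro similar_matI[of M D U V n]) auto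
  then have "char_poly M = char_poly D" by (rule char_poly_similar)
  also have "\<dots> = (\<Prod>a\<leftarrow>diag_mat D. [:- a, 1:])"
    by (rule char_poly_upper_triangular[OF carr(3)]) (auto simp: D_def)
  also have "diag_mat D = map (\<lambda>i. complex_of_real (\<mu> i)) [0..<n]"
    by (auto simp: diag_mat_def D_def)
  finally show cp: "char_poly M = (\<Prod>i\<leftarrow>[0..<n]. [:- complex_of_real (\<mu> i), 1:])"
    by (simp add: o_def)
  have "proots (\<Prod>i\<leftarrow>xs. [:- complex_of_real (\<mu> i), 1:]) = mset (map (\<lambda>i. complex_of_real (\<mu> i)) xs)"
    for xs
  proof (induction xs)
    case (Cons x xs)
    have "(\<Prod>i\<leftarrow>xs. [:- complex_of_real (\<mu> i), 1:]) \<noteq> 0" by (auto simp: prod_list_zero_iff)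
    with Cons show ?case by (simp add: proots_mult del: mult_pCons_left)
  qed simp
  then have "image_mset Re (proots (char_poly M)) = mset (map \<mu> [0..<n])"
    by (simp add: cp multiset.map_comp o_def)
  moreover have "sorted (map \<mu> [0..<n])"
    by (auto simp: sorted_iff_nth_mono intro: eigensystem_mono[OF sys])
  ultimately have "sorted_list_of_multiset (image_mset Re (proots (char_poly M))) = map \<mu> [0..<n]"
    by (simp only: sorted_list_of_multiset_mset sorted_sort_id)
  then show "i < n \<Longrightarrow> nth_eigenvalue M (Suc i) = \<mu> i"
    by (simp add: nth_eigenvalue_def)
qed

section \<open>Gaps between intervals\<close>

lemma fmeasurable_lborel_Icc: "{a..b :: real} \<in> fmeasurable lborel"
  by (intro fmeasurableI) (auto simp: emeasure_lborel_Icc_eq)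

lemma fmeasurable_lborel_Ioo: "{a<..<b :: real} \<in> fmeasurable lborel"
  by (rule fmeasurableI2[OF fmeasurable_lborel_Icc[of a b]]) auto

text \<open>The shape of \<open>gaps_between\<close> with closed intervals for the bands, which
  frees the measure argument from graphs; \<open>gaps_between_eq\<close> identifies the two.\<close>

definition interval_gaps :: "nat set \<Rightarrow> (nat \<Rightarrow> real) \<Rightarrow> (nat \<Rightarrow> real) \<Rightarrow> real set set" where
  "interval_gaps N a b = {{b m<..<a n} | m n. m \<in> N \<and> n \<in> N \<and> b m < a n \<and>
     (\<forall>l\<in>N. {a l..b l} \<inter> {b m<..<a n} = {})}"

lemma finite_interval_gaps:
  assumes "finite N" shows "finite (interval_gaps N a b)"
proof -
  have "interval_gaps N a b \<subseteq> (\<lambda>(m, n). {b m<..<a n}) ` (N \<times> N)"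
    by (auto simp: interval_gaps_def)
  then show ?thesis using assms by (meson finite_SigmaI finite_imageI finite_subset)
qed

lemma interval_gaps_cases:
  assumes "g \<in> interval_gaps N a b"
  obtains m n where "m \<in> N" "n \<in> N" "b m < a n" "g = {b m<..<a n}"
    "\<forall>l\<in>N. {a l..b l} \<inter> {b m<..<a n} = {}"
  using assms unfolding interval_gaps_def by blast

text \<open>The end points of a gap belong to intervals of the family and hence lie in no gap. Two
  overlapping open intervals, neither containing an end point of the other, are equal.\<close>

lemma interval_gaps_disjoint:
  assumes "\<And>n. n \<in> N \<Longrightarrow> a n \<le> b n" "g \<in> interval_gaps N a b" "h \<in> interval_gaps N a b" "g \<noteq> h"
  shows "disjnt g h"
proof (rule ccontr)
  assume "\<not> disjnt g h"
  then obtain x where x: "x \<in> g" "x \<in> h" by (auto simp: disjnt_iff)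
  obtain m n where g: "m \<in> N" "n \<in> N" "g = {b m<..<a n}" "\<And>l. l \<in> N \<Longrightarrow> {a l..b l} \<inter> g = {}"
    using interval_gaps_cases[OF assms(2)] by metis
  obtain m' n' where h: "m' \<in> N" "n' \<in> N" "h = {b m'<..<a n'}" "\<And>l. l \<in> N \<Longrightarrow> {a l..b l} \<inter> h = {}"
    using interval_gaps_cases[OF assms(3)] by metis
  have "b m \<notin> h" using h(4)[OF g(1)] assms(1)[OF g(1)] by auto
  moreover have "b m' \<notin> g" using g(4)[OF h(1)] assms(1)[OF h(1)] by auto
  moreover have "a n \<notin> h" using h(4)[OF g(2)] assms(1)[OF g(2)] by auto
  moreover have "a n' \<notin> g" using g(4)[OF h(2)] assms(1)[OF h(2)] by auto
  ultimately have "b m = b m'" "a n = a n'" using x g(3) h(3) by auto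
  with g(3) h(3) assms(4) show False by simp
qed

text \<open>An uncovered point lies between the largest right end below it and the smallest left end
  above it, and no interval of the family can meet the space between these two.\<close>

lemma intervals_Un_gaps:
  assumes fin: "finite N" and ab: "\<And>n. n \<in> N \<Longrightarrow> a n \<le> b n"
    and p: "p \<in> N" "\<And>n. n \<in> N \<Longrightarrow> a p \<le> a n" and q: "q \<in> N" "\<And>n. n \<in> N \<Longrightarrow> b n \<le> b q"
  shows "{a p..b q} = (\<Union>n\<in>N. {a n..b n}) \<union> \<Union>(interval_gaps N a b)"
proof (intro equalityI subsetI)
  fix x assume x: "x \<in> {a p..b q}"
  show "x \<in> (\<Union>n\<in>N. {a n..b n}) \<union> \<Union>(interval_gaps N a b)"
  proof (cases "x \<in> (\<Union>n\<in>N. {a n..b n})")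
    case False
    then have out: "b n < x \<or> x < a n" if "n \<in> N" for n using that by force
    define L where "L = {n \<in> N. b n < x}"
    define R where "R = {n \<in> N. x < a n}"
    have L: "finite L" "p \<in> L" using fin out[OF p(1)] x p(1) by (auto simp: L_def)
    have R: "finite R" "q \<in> R" using fin out[OF q(1)] x q(1) by (auto simp: R_def)
    obtain m where m: "m \<in> L" "\<And>l. l \<in> L \<Longrightarrow> b l \<le> b m"
      using L obtains_MAX[of L b] by (metis empty_iff Max_ge finite_imageI image_eqI)
    obtain n where n: "n \<in> R" "\<And>l. l \<in> R \<Longrightarrow> a n \<le> a l"
      using R obtains_MIN[of R a] by (metis empty_iff Min_le finite_imageI image_eqI)
    have "{a l..b l} \<inter> {b m<..<a n} = {}" if "l \<in> N" for l
      using out[OF that] m(2)[of l] n(2)[of l] that by (auto simp: L_def R_def)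
    moreover have "b m < x" "x < a n" "m \<in> N" "n \<in> N" using m(1) n(1) by (auto simp: L_def R_def)
    ultimately have "{b m<..<a n} \<in> interval_gaps N a b"
      unfolding interval_gaps_def by force
    then show ?thesis using \<open>b m < x\<close> \<open>x < a n\<close> by (intro UnI2 UnionI) auto
  qed simp
next
  fix x assume "x \<in> (\<Union>n\<in>N. {a n..b n}) \<union> \<Union>(interval_gaps N a b)"
  then show "x \<in> {a p..b q}"
  proof
    assume "x \<in> (\<Union>n\<in>N. {a n..b n})"
    then obtain n where "n \<in> N" "x \<in> {a n..b n}" by blast
    then show ?thesis using p(2)[of n] q(2)[of n] by auto
  next
    assume "x \<in> \<Union>(interval_gaps N a b)"
    then obtain g where g: "g \<in> interval_gaps N a b" "x \<in> g" by blast
    obtain m n where mn: "m \<in> N" "n \<in> N" "g = {b m<..<a n}" using interval_gaps_cases[OF g(1)] by metis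
    show ?thesis using mn g(2) p(2)[OF mn(1)] ab[OF mn(1)] ab[OF mn(2)] q(2)[OF mn(2)] by auto
  qed
qed

text \<open>The gaps are disjoint from each other and from the intervals, and together they fill the
  hull. The intervals may overlap, hence the measure of their union instead of a sum of
  lengths.\<close>

lemma sum_gap_lengths:
  assumes fin: "finite N" and ab: "\<And>n. n \<in> N \<Longrightarrow> a n \<le> b n"
    and p: "p \<in> N" "\<And>n. n \<in> N \<Longrightarrow> a p \<le> a n" and q: "q \<in> N" "\<And>n. n \<in> N \<Longrightarrow> b n \<le> b q"
  shows "(\<Sum>g\<in>interval_gaps N a b. measure lborel g) =
    b q - a p - measure lborel (\<Union>n\<in>N. {a n..b n})"
proof -
  let ?B = "\<Union>n\<in>N. {a n..b n}" and ?G = "interval_gaps N a b"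
  have gm: "g \<in> fmeasurable lborel" if "g \<in> ?G" for g
    using interval_gaps_cases[OF that] by (metis fmeasurable_lborel_Ioo)
  have Bm: "?B \<in> fmeasurable lborel"
    using fin by (intro fmeasurable.finite_UN) (auto intro: fmeasurable_lborel_Icc)
  have Gm: "\<Union>?G \<in> fmeasurable lborel"
    using finite_interval_gaps[OF fin] gm by (intro fmeasurable.finite_Union) auto
  have "?B \<inter> \<Union>?G = {}"
  proof -
    have "?B \<inter> g = {}" if g: "g \<in> ?G" for g
    proof -
      obtain m n where mn: "g = {b m<..<a n}" "\<forall>l\<in>N. {a l..b l} \<inter> {b m<..<a n} = {}"
        by (rule interval_gaps_cases[OF g])
      show ?thesis unfolding mn(1) using mn(2) by blast
    qed
    then show ?thesis by blast
  qed
  moreover have "a p \<le> b q" using ab[OF p(1)] q(2)[OF p(1)] by simp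
  then have "b q - a p = measure lborel (?B \<union> \<Union>?G)"
    by (subst intervals_Un_gaps[OF assms, symmetric]) auto
  ultimately have "b q - a p = measure lborel ?B + measure lborel (\<Union>?G)"
    using Bm Gm by (simp add: measure_Un3)
  moreover have "measure lborel (\<Union>?G) = (\<Sum>g\<in>?G. measure lborel g)"
    using gm interval_gaps_disjoint[OF ab]
    by (intro measure_Union'[OF finite_interval_gaps[OF fin]]) (auto simp: pairwise_def)
  ultimately show ?thesis by simp
qed

lemma measure_UN_Icc_le:
  fixes a b :: "nat \<Rightarrow> real"
  assumes "finite N" "\<And>n. n \<in> N \<Longrightarrow> a n \<le> b n"
  shows "measure lborel (\<Union>n\<in>N. {a n..b n}) \<le> (\<Sum>n\<in>N. b n - a n)"
proof -
  have "measure lborel (\<Union>n\<in>N. {a n..b n}) \<le> (\<Sum>n\<in>N. measure lborel {a n..b n})"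
    using assms(1) by (intro measure_UNION_le) auto
  also have "\<dots> = (\<Sum>n\<in>N. b n - a n)" using assms(2) by (intro sum.cong) auto
  finally show ?thesis .
qed

text \<open>Neighbouring intervals may share an end point; disjointness is available only for the
  open interiors, which give the lower bound.\<close>

lemma measure_UN_Icc_nonoverlapping:
  fixes a b :: "nat \<Rightarrow> real"
  assumes "finite N" "\<And>n. n \<in> N \<Longrightarrow> a n \<le> b n"
    and "\<And>m n. m \<in> N \<Longrightarrow> n \<in> N \<Longrightarrow> m < n \<Longrightarrow> b m \<le> a n"
  shows "measure lborel (\<Union>n\<in>N. {a n..b n}) = (\<Sum>n\<in>N. b n - a n)"
proof (rule antisym[OF measure_UN_Icc_le[OF assms(1,2)]])
  have Bm: "(\<Union>n\<in>N. {a n..b n}) \<in> fmeasurable lborel"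
    using assms(1) by (intro fmeasurable.finite_UN) (auto intro: fmeasurable_lborel_Icc)
  have "(\<Sum>n\<in>N. b n - a n) = (\<Sum>n\<in>N. measure lborel {a n<..<b n})"
    using assms(2) by (intro sum.cong) auto
  also have "\<dots> = measure lborel (\<Union>n\<in>N. {a n<..<b n})"
  proof (rule measure_UNION'[symmetric])
    show "pairwise (\<lambda>m n. disjnt {a m<..<b m} {a n<..<b n}) N"
    proof (rule pairwiseI)
      fix m n assume "m \<in> N" "n \<in> N" "m \<noteq> n"
      then have "b m \<le> a n \<or> b n \<le> a m" using assms(3) by (metis linorder_neqE_nat)
      then show "disjnt {a m<..<b m} {a n<..<b n}" by (auto simp: disjnt_iff)
    qed
  qed (use assms(1) in \<open>auto intro: fmeasurable_lborel_Ioo\<close>)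
  also have "\<dots> \<le> measure lborel (\<Union>n\<in>N. {a n..b n})"
    using Bm assms(1) by (intro measure_mono_fmeasurable) force+
  finally show "(\<Sum>n\<in>N. b n - a n) \<le> measure lborel (\<Union>n\<in>N. {a n..b n})" .
qed

section \<open>Bounded Hermitian kernels on square summable functions\<close>

abbreviation "fin_norm f \<equiv> L2_set (\<lambda>u. cmod (f u))"

lemma L2_set_le_l2_norm:
  assumes "f \<in> l2 S" "finite F" "F \<subseteq> S"
  shows "fin_norm f F \<le> l2_norm S f"
  unfolding L2_set_def l2_norm_def using assms
  by (intro real_sqrt_le_mono finite_sum_le_infsum) (auto simp: l2_def)

text \<open>Reduces membership in \<open>l2\<close> and norm bounds to finite subsets; differences,
  images under the operator and pointwise limits are all handled in this way.\<close>

lemma l2_boundI: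
  assumes "\<And>u. u \<notin> S \<Longrightarrow> f u = 0" "0 \<le> c"
    and "\<And>F. finite F \<Longrightarrow> F \<subseteq> S \<Longrightarrow> fin_norm f F \<le> c"
  shows "f \<in> l2 S" "l2_norm S f \<le> c"
proof -
  have fin: "(\<Sum>u\<in>F. (cmod (f u))\<^sup>2) \<le> c\<^sup>2" if "finite F" "F \<subseteq> S" for F
    using assms(3)[OF that] assms(2) unfolding L2_set_def
    by (metis real_sqrt_le_iff real_sqrt_abs abs_of_nonneg)
  have sum: "(\<lambda>u. (cmod (f u))\<^sup>2) summable_on S"
    by (rule nonneg_bdd_above_summable_on) (auto intro!: bdd_aboveI fin)
  then show "f \<in> l2 S" using assms(1) by (simp add: l2_def)
  have "(\<Sum>\<^sub>\<infinity>u\<in>S. (cmod (f u))\<^sup>2) \<le> c\<^sup>2"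
    by (rule infsum_le_finite_sums[OF sum]) (rule fin)
  then show "l2_norm S f \<le> c"
    unfolding l2_norm_def using assms(2) real_le_lsqrt by (simp add: real_le_lsqrt infsum_nonneg)
qed

lemma l2_norm_nonneg: "0 \<le> l2_norm S f"
  by (simp add: l2_norm_def infsum_nonneg)

lemma l2_off: "f \<in> l2 S \<Longrightarrow> u \<notin> S \<Longrightarrow> f u = 0"
  by (simp add: l2_def)

lemma cmod_le_l2_norm:
  assumes "f \<in> l2 S" shows "cmod (f u) \<le> l2_norm S f"
proof (cases "u \<in> S")
  case True
  with L2_set_le_l2_norm[OF assms, of "{u}"] show ?thesis by simp
qed (use assms l2_norm_nonneg in \<open>auto simp: l2_off\<close>)

lemma l2_diff:
  assumes "f \<in> l2 S" "g \<in> l2 S"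
  shows "(\<lambda>u. f u - g u) \<in> l2 S" "l2_norm S (\<lambda>u. f u - g u) \<le> l2_norm S f + l2_norm S g"
proof -
  have *: "L2_set (\<lambda>u. cmod (f u - g u)) F \<le> l2_norm S f + l2_norm S g"
    if "finite F" "F \<subseteq> S" for F
  proof -
    have "L2_set (\<lambda>u. cmod (f u - g u)) F \<le> L2_set (\<lambda>u. cmod (f u) + cmod (g u)) F"
      by (intro L2_set_mono norm_triangle_ineq4) auto
    also have "\<dots> \<le> fin_norm f F + fin_norm g F"
      by (rule L2_set_triangle_ineq)
    also have "\<dots> \<le> l2_norm S f + l2_norm S g"
      using assms that by (intro add_mono L2_set_le_l2_norm)
    finally show ?thesis .
  qed
  show "(\<lambda>u. f u - g u) \<in> l2 S" "l2_norm S (\<lambda>u. f u - g u) \<le> l2_norm S f + l2_norm S g"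
    by (rule l2_boundI[OF _ _ *]; use assms in \<open>auto simp: l2_off l2_norm_nonneg\<close>)+
qed

definition supported_on :: "'a set \<Rightarrow> ('a \<Rightarrow> complex) \<Rightarrow> bool" where
  "supported_on F f \<longleftrightarrow> (\<forall>u. u \<notin> F \<longrightarrow> f u = 0)"

lemma l2_norm_finite_support:
  assumes "finite F" "F \<subseteq> S" "supported_on F f"
  shows "f \<in> l2 S" "l2_norm S f = fin_norm f F"
proof -
  have "(\<lambda>u. (cmod (f u))\<^sup>2) summable_on S \<longleftrightarrow> (\<lambda>u. (cmod (f u))\<^sup>2) summable_on F"
    using assms by (intro summable_on_cong_neutral) (auto simp: supported_on_def)
  then show "f \<in> l2 S" using assms by (auto simp: l2_def supported_on_def)
  have "infsum (\<lambda>u. (cmod (f u))\<^sup>2) S = infsum (\<lambda>u. (cmod (f u))\<^sup>2) F"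
    using assms by (intro infsum_cong_neutral) (auto simp: supported_on_def)
  then show "l2_norm S f = fin_norm f F"
    using assms(1) by (simp add: l2_norm_def L2_set_def)
qed

lemma l2_truncation:
  assumes "f \<in> l2 S" "\<epsilon> > 0"
  obtains F where "finite F" "F \<subseteq> S" "l2_norm S (\<lambda>u. f u - (if u \<in> F then f u else 0)) \<le> \<epsilon>"
proof -
  let ?g = "\<lambda>u. (cmod (f u))\<^sup>2"
  have sum: "?g summable_on S" using assms(1) by (simp add: l2_def)
  obtain F where F: "finite F" "F \<subseteq> S" "dist (sum ?g F) (infsum ?g S) \<le> \<epsilon>\<^sup>2"
    using infsum_finite_approximation[OF sum, of "\<epsilon>\<^sup>2"] assms(2) by auto
  have "L2_set (\<lambda>u. cmod (f u - (if u \<in> F then f u else 0))) G \<le> \<epsilon>" if G: "finite G" "G \<subseteq> S" for G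
  proof -
    have "(\<Sum>u\<in>G. (cmod (f u - (if u \<in> F then f u else 0)))\<^sup>2) = (\<Sum>u\<in>G - F. ?g u)"
      using G by (intro sum.mono_neutral_cong_right) auto
    also have "\<dots> = (\<Sum>u\<in>G \<union> F. ?g u) - (\<Sum>u\<in>F. ?g u)"
      using G F by (simp add: sum_diff1 Un_Diff flip: sum_diff)
    also have "(\<Sum>u\<in>G \<union> F. ?g u) \<le> infsum ?g S"
      using G F by (intro finite_sum_le_infsum[OF sum]) auto
    also have "infsum ?g S - (\<Sum>u\<in>F. ?g u) \<le> \<epsilon>\<^sup>2" using F(3) by (simp add: dist_real_def)
    finally show ?thesis using assms(2) unfolding L2_set_def by (intro real_le_lsqrt) (auto intro: sum_nonneg)
  qed
  then have "l2_norm S (\<lambda>u. f u - (if u \<in> F then f u else 0)) \<le> \<epsilon>"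
    using assms by (intro l2_boundI) (auto simp: l2_off)
  then show ?thesis by (rule that[OF F(1,2)])
qed

text \<open>Row \<open>u\<close> lives on the finite set \<open>N u\<close>, and \<open>C\<close>
  bounds the absolute row sums; by Hermitian symmetry it controls the column sums as well, as the
  Schur test requires.\<close>

locale hermitian_kernel =
  fixes S :: "'a set" and K :: "'a \<Rightarrow> 'a \<Rightarrow> complex" and N :: "'a \<Rightarrow> 'a set" and C :: real
  assumes finite_N: "u \<in> S \<Longrightarrow> finite (N u)"
    and N_subset: "u \<in> S \<Longrightarrow> N u \<subseteq> S"
    and N_sym: "u \<in> S \<Longrightarrow> w \<in> N u \<Longrightarrow> u \<in> N w"
    and K_sym: "u \<in> S \<Longrightarrow> w \<in> S \<Longrightarrow> K u w = cnj (K w u)"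
    and K_zero: "u \<in> S \<Longrightarrow> w \<notin> N u \<Longrightarrow> K u w = 0"
    and K_bound: "u \<in> S \<Longrightarrow> (\<Sum>w\<in>N u. cmod (K u w)) \<le> C"
    and C_pos: "0 < C"
begin

definition op :: "('a \<Rightarrow> complex) \<Rightarrow> 'a \<Rightarrow> complex" where
  "op f u = (if u \<in> S then \<Sum>w\<in>N u. K u w * f w else 0)"

lemma op_diff: "op (\<lambda>u. f u - g u) u = op f u - op g u"
  by (simp add: op_def algebra_simps sum_subtractf)

lemma op_add: "op (\<lambda>u. f u + g u) u = op f u + op g u"
  by (simp add: op_def algebra_simps sum.distrib)

lemma op_scale: "op (\<lambda>u. c * f u) u = c * op f u"
  by (simp add: op_def algebra_simps sum_distrib_left)

lemma op_zero: "op (\<lambda>_. 0) u = 0"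
  by (simp add: op_def)

lemma op_eq_sum:
  assumes "finite F" "F \<subseteq> S" "supported_on F f" "u \<in> S"
  shows "op f u = (\<Sum>w\<in>F. K u w * f w)"
proof -
  have "(\<Sum>w\<in>N u. K u w * f w) = (\<Sum>w\<in>N u \<inter> F. K u w * f w)"
    using assms finite_N by (intro sum.mono_neutral_right) (auto simp: supported_on_def)
  also have "\<dots> = (\<Sum>w\<in>F. K u w * f w)"
    using assms K_zero by (intro sum.mono_neutral_left) auto
  finally show ?thesis using assms(4) by (simp add: op_def)
qed

text \<open>The Schur test.\<close>

lemma L2_set_op_le:
  assumes F: "finite F" "F \<subseteq> S"
  shows "fin_norm (op f) F \<le> C * fin_norm f (\<Union>u\<in>F. N u)"
proof -
  let ?G = "\<Union>u\<in>F. N u"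
  have G: "finite ?G" "?G \<subseteq> S" using F finite_N N_subset by auto
  have row: "(cmod (op f u))\<^sup>2 \<le> C * (\<Sum>w\<in>N u. cmod (K u w) * (cmod (f w))\<^sup>2)" if "u \<in> S" for u
  proof -
    have "cmod (op f u) \<le> (\<Sum>w\<in>N u. cmod (K u w) * cmod (f w))"
      using that by (auto simp: op_def norm_mult intro: order.trans[OF norm_sum])
    \<comment> \<open>Splitting \<open>cmod (K u w)\<close> into two square roots lets
      Cauchy-Schwarz separate a row sum from a weighted sum of squares.\<close>
    also have "\<dots> = (\<Sum>w\<in>N u. sqrt (cmod (K u w)) * (sqrt (cmod (K u w)) * cmod (f w)))"
      by (simp flip: mult.assoc)
    finally have "(cmod (op f u))\<^sup>2 \<le> (\<Sum>w\<in>N u. sqrt (cmod (K u w)) * (sqrt (cmod (K u w)) * cmod (f w)))\<^sup>2"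
      by (intro power_mono) auto
    also have "\<dots> \<le> (\<Sum>w\<in>N u. (sqrt (cmod (K u w)))\<^sup>2) * (\<Sum>w\<in>N u. (sqrt (cmod (K u w)) * cmod (f w))\<^sup>2)"
      by (rule Cauchy_Schwarz_ineq_sum)
    also have "\<dots> = (\<Sum>w\<in>N u. cmod (K u w)) * (\<Sum>w\<in>N u. cmod (K u w) * (cmod (f w))\<^sup>2)"
      by (simp add: power_mult_distrib)
    also have "\<dots> \<le> C * (\<Sum>w\<in>N u. cmod (K u w) * (cmod (f w))\<^sup>2)"
      using K_bound[OF that] by (intro mult_right_mono sum_nonneg) auto
    finally show ?thesis .
  qed
  have "(\<Sum>u\<in>F. (cmod (op f u))\<^sup>2) \<le> (\<Sum>u\<in>F. C * (\<Sum>w\<in>N u. cmod (K u w) * (cmod (f w))\<^sup>2))"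
    using F row by (intro sum_mono) auto
  also have "\<dots> = C * (\<Sum>u\<in>F. \<Sum>w\<in>N u. cmod (K u w) * (cmod (f w))\<^sup>2)"
    by (simp add: sum_distrib_left)
  also have "(\<Sum>u\<in>F. \<Sum>w\<in>N u. cmod (K u w) * (cmod (f w))\<^sup>2)
      = (\<Sum>u\<in>F. \<Sum>w\<in>?G. cmod (K u w) * (cmod (f w))\<^sup>2)"
    using F G K_zero by (intro sum.cong refl sum.mono_neutral_left) auto
  also have "\<dots> = (\<Sum>w\<in>?G. \<Sum>u\<in>F. cmod (K u w) * (cmod (f w))\<^sup>2)" by (rule sum.swap)
  \<comment> \<open>Hermitian symmetry turns column sums into row sums, where \<open>C\<close>
    applies a second time.\<close>
  also have "\<dots> = (\<Sum>w\<in>?G. (\<Sum>u\<in>F. cmod (K w u)) * (cmod (f w))\<^sup>2)"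
  proof (intro sum.cong refl)
    fix w assume "w \<in> ?G"
    then have "cmod (K u w) = cmod (K w u)" if "u \<in> F" for u
      using that F G K_sym[of u w] by (metis complex_mod_cnj subsetD)
    then show "(\<Sum>u\<in>F. cmod (K u w) * (cmod (f w))\<^sup>2) = (\<Sum>u\<in>F. cmod (K w u)) * (cmod (f w))\<^sup>2"
      by (simp add: sum_distrib_right)
  qed
  also have "\<dots> \<le> (\<Sum>w\<in>?G. C * (cmod (f w))\<^sup>2)"
  proof (intro sum_mono mult_right_mono)
    fix w assume "w \<in> ?G"
    then have w: "w \<in> S" using G by auto
    have "(\<Sum>u\<in>F. cmod (K w u)) = (\<Sum>u\<in>F \<inter> N w. cmod (K w u))"
      using F K_zero[OF w] by (intro sum.mono_neutral_right) auto
    also have "\<dots> \<le> (\<Sum>u\<in>N w. cmod (K w u))"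
      using finite_N[OF w] by (intro sum_mono2) auto
    also have "\<dots> \<le> C" by (rule K_bound[OF w])
    finally show "(\<Sum>u\<in>F. cmod (K w u)) \<le> C" .
  qed auto
  finally have "(\<Sum>u\<in>F. (cmod (op f u))\<^sup>2) \<le> C * (\<Sum>w\<in>?G. C * (cmod (f w))\<^sup>2)"
    using C_pos by simp
  also have "\<dots> = C\<^sup>2 * (\<Sum>w\<in>?G. (cmod (f w))\<^sup>2)"
    by (simp add: power2_eq_square sum_distrib_left mult.assoc)
  finally have "fin_norm (op f) F \<le> sqrt (C\<^sup>2 * (\<Sum>w\<in>?G. (cmod (f w))\<^sup>2))"
    unfolding L2_set_def by (rule real_sqrt_le_mono)
  then show ?thesis using C_pos by (simp add: L2_set_def real_sqrt_mult)
qed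

lemma l2_op:
  assumes "f \<in> l2 S"
  shows "op f \<in> l2 S" "l2_norm S (op f) \<le> C * l2_norm S f"
proof -
  have *: "fin_norm (op f) F \<le> C * l2_norm S f" if "finite F" "F \<subseteq> S" for F
  proof -
    have "fin_norm (op f) F \<le> C * fin_norm f (\<Union>u\<in>F. N u)"
      by (rule L2_set_op_le[OF that])
    also have "\<dots> \<le> C * l2_norm S f"
      using C_pos that finite_N N_subset by (intro mult_left_mono L2_set_le_l2_norm[OF assms]) auto
    finally show ?thesis .
  qed
  show "op f \<in> l2 S" "l2_norm S (op f) \<le> C * l2_norm S f"
    by (rule l2_boundI[OF _ _ *]; use C_pos in \<open>auto simp: op_def l2_norm_nonneg\<close>)+
qed

definition fin_supp :: "('a \<Rightarrow> complex) \<Rightarrow> bool" where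
  "fin_supp f \<longleftrightarrow> (\<exists>F. finite F \<and> F \<subseteq> S \<and> supported_on F f)"

lemma fin_supp_op: assumes "fin_supp f" shows "fin_supp (op f)"
proof -
  obtain F where F: "finite F" "F \<subseteq> S" "supported_on F f" using assms by (auto simp: fin_supp_def)
  have "supported_on (\<Union>u\<in>F. N u) (op f)"
    unfolding supported_on_def
  proof (intro allI impI)
    fix u assume u: "u \<notin> (\<Union>u\<in>F. N u)"
    show "op f u = 0"
    proof (cases "u \<in> S")
      case True
      then have "w \<notin> F" if "w \<in> N u" for w using N_sym[OF True that] u by auto
      then show ?thesis using F(3) by (auto simp: op_def supported_on_def intro!: sum.neutral)
    qed (simp add: op_def)
  qed
  then show ?thesis unfolding fin_supp_def using F finite_N N_subset
    by (intro exI[of _ "\<Union>u\<in>F. N u"]) auto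
qed

lemma fin_supp_common:
  assumes "fin_supp f" "fin_supp g"
  obtains F where "finite F" "F \<subseteq> S" "supported_on F f" "supported_on F g"
proof -
  obtain F G where "finite F" "F \<subseteq> S" "supported_on F f" "finite G" "G \<subseteq> S" "supported_on G g"
    using assms by (auto simp: fin_supp_def)
  then show ?thesis by (intro that[of "F \<union> G"]) (auto simp: supported_on_def)
qed

lemma fin_supp_combine:
  assumes "fin_supp f" "fin_supp g" shows "fin_supp (\<lambda>u. f u + c * g u)"
  using fin_supp_common[OF assms] unfolding fin_supp_def supported_on_def
  by (metis add.right_neutral mult_zero_right)

lemma fin_supp_l2: "fin_supp f \<Longrightarrow> f \<in> l2 S"
  unfolding fin_supp_def using l2_norm_finite_support(1) by blast

text \<open>Finite support is asked of \<open>f\<close> and \<open>op f\<close> only. The function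
  \<open>g\<close> is arbitrary on \<open>S\<close>; it will be a plane wave, which need not be
  square summable.\<close>

lemma op_symmetric:
  assumes "finite F" "F \<subseteq> S" "supported_on F f" "finite G" "G \<subseteq> S" "supported_on G (op f)"
    and off: "\<And>u. u \<notin> S \<Longrightarrow> g u = 0"
  shows "(\<Sum>u\<in>G. cnj (g u) * op f u) = (\<Sum>u\<in>F. cnj (op g u) * f u)"
proof -
  \<comment> \<open>Contains the support of \<open>op f\<close> and all neighbours of the support of
    \<open>f\<close>, so that both sums extend to it.\<close>
  let ?H = "G \<union> (\<Union>u\<in>F. N u)"
  have "finite (N u)" "N u \<subseteq> S" if "u \<in> F" for u
    using that assms(2) finite_N N_subset by blast+
  then have H: "finite ?H" "?H \<subseteq> S" using assms by auto
  have "(\<Sum>u\<in>G. cnj (g u) * op f u) = (\<Sum>u\<in>?H. cnj (g u) * op f u)"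
    using assms H by (intro sum.mono_neutral_left) (auto simp: supported_on_def)
  also have "\<dots> = (\<Sum>u\<in>?H. \<Sum>w\<in>F. cnj (g u) * (K u w * f w))"
    using H op_eq_sum[OF assms(1-3)] by (intro sum.cong refl) (auto simp: sum_distrib_left subset_iff)
  also have "\<dots> = (\<Sum>w\<in>F. \<Sum>u\<in>?H. cnj (g u) * (K u w * f w))" by (rule sum.swap)
  also have "\<dots> = (\<Sum>w\<in>F. cnj (op g w) * f w)"
  proof (intro sum.cong refl)
    fix w assume w: "w \<in> F"
    then have wS: "w \<in> S" using assms by auto
    have "(\<Sum>u\<in>?H. cnj (g u) * (K u w * f w)) = (\<Sum>u\<in>?H. cnj (K w u * g u) * f w)"
    proof (intro sum.cong refl)
      fix u assume "u \<in> ?H"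
      then have "K u w = cnj (K w u)" using H wS K_sym by blast
      then show "cnj (g u) * (K u w * f w) = cnj (K w u * g u) * f w" by simp
    qed
    also have "\<dots> = (\<Sum>u\<in>N w. cnj (K w u * g u) * f w)"
      using H w wS K_zero[OF wS] by (intro sum.mono_neutral_right) auto
    also have "\<dots> = cnj (op g w) * f w"
      using wS by (simp add: op_def sum_distrib_right)
    finally show "(\<Sum>u\<in>?H. cnj (g u) * (K u w * f w)) = cnj (op g w) * f w" .
  qed
  finally show ?thesis .
qed

lemma l2_norm_op_sq:
  assumes "finite F" "F \<subseteq> S" "supported_on F f" "supported_on F (op f)"
  shows "complex_of_real ((l2_norm S (op f))\<^sup>2) = (\<Sum>u\<in>F. cnj (f u) * op (op f) u)"
proof -
  have "fin_supp (op (op f))" using assms by (intro fin_supp_op) (auto simp: fin_supp_def)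
  then obtain G where G: "finite G" "G \<subseteq> S" "supported_on G (op (op f))" by (auto simp: fin_supp_def)
  have "(\<Sum>u\<in>F \<union> G. cnj (f u) * op (op f) u) = (\<Sum>u\<in>F. cnj (op f u) * op f u)"
  proof (rule op_symmetric[OF assms(1,2,4)])
    show "supported_on (F \<union> G) (op (op f))" using G by (auto simp: supported_on_def)
    show "\<And>u. u \<notin> S \<Longrightarrow> f u = 0" using assms by (auto simp: supported_on_def)
  qed (use assms G in auto)
  moreover have "(\<Sum>u\<in>F \<union> G. cnj (f u) * op (op f) u) = (\<Sum>u\<in>F. cnj (f u) * op (op f) u)"
    using assms G by (intro sum.mono_neutral_right) (auto simp: supported_on_def)
  moreover have "complex_of_real ((l2_norm S (op f))\<^sup>2) = (\<Sum>u\<in>F. cnj (op f u) * op f u)"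
    using l2_norm_finite_support(2)[OF assms(1,2,4)]
    by (simp add: L2_set_def sum_nonneg complex_norm_square mult.commute del: of_real_power)
  ultimately show ?thesis by simp
qed

section \<open>Invertibility from a lower bound on finitely supported functions\<close>

context
  fixes \<delta> :: real
  assumes delta: "0 < \<delta>" and below_fin: "\<And>f. fin_supp f \<Longrightarrow> \<delta> * l2_norm S f \<le> l2_norm S (op f)"
begin

text \<open>One step of Richardson's iteration for \<open>op f = r\<close> contracts the residual.\<close>

lemma richardson_step:
  assumes "fin_supp r"
  shows "(l2_norm S (\<lambda>u. r u - op (op r) u / C\<^sup>2))\<^sup>2 \<le> (1 - \<delta>\<^sup>2 / C\<^sup>2) * (l2_norm S r)\<^sup>2"
proof -
  have "fin_supp (op r)" "fin_supp (op (op r))" using assms fin_supp_op by auto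
  obtain F0 where F0: "finite F0" "F0 \<subseteq> S" "supported_on F0 r" "supported_on F0 (op r)"
    using fin_supp_common[OF assms \<open>fin_supp (op r)\<close>] by metis
  obtain F1 where F1: "finite F1" "F1 \<subseteq> S" "supported_on F1 (op (op r))"
    using \<open>fin_supp (op (op r))\<close> by (auto simp: fin_supp_def)
  define F where "F = F0 \<union> F1"
  have F: "finite F" "F \<subseteq> S" "supported_on F r" "supported_on F (op r)" "supported_on F (op (op r))"
    using F0 F1 by (auto simp: F_def supported_on_def)
  \<comment> \<open>With this step size the quadratic term is at most
    \<open>t * (l2_norm S (op r))\<^sup>2\<close>, half of the gain from the linear term, so one
    such term survives.\<close>
  define t where "t = 1 / C\<^sup>2"
  let ?h = "\<lambda>u. r u - op (op r) u / C\<^sup>2"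
  have nsq: "(l2_norm S f)\<^sup>2 = (\<Sum>u\<in>F. (cmod (f u))\<^sup>2)" if "supported_on F f" for f
    using l2_norm_finite_support(2)[OF F(1,2) that] by (simp add: L2_set_def sum_nonneg)
  have h: "supported_on F ?h" using F by (auto simp: supported_on_def)
  have "(l2_norm S ?h)\<^sup>2 = (\<Sum>u\<in>F. (cmod (r u))\<^sup>2 - 2 * t * Re (cnj (r u) * op (op r) u) + t\<^sup>2 * (cmod (op (op r) u))\<^sup>2)"
    unfolding nsq[OF h]
  proof (intro sum.cong refl)
    fix u
    have eq: "?h u = r u - of_real t * op (op r) u" by (simp add: t_def)
    show "(cmod (?h u))\<^sup>2 = (cmod (r u))\<^sup>2 - 2 * t * Re (cnj (r u) * op (op r) u) + t\<^sup>2 * (cmod (op (op r) u))\<^sup>2"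
      unfolding eq by (simp only: cmod_power2) (simp add: power2_eq_square algebra_simps)
  qed
  also have "\<dots> = (l2_norm S r)\<^sup>2 - 2 * t * Re (\<Sum>u\<in>F. cnj (r u) * op (op r) u) + t\<^sup>2 * (l2_norm S (op (op r)))\<^sup>2"
    by (simp add: nsq F sum.distrib sum_subtractf sum_distrib_left algebra_simps)
  also have "Re (\<Sum>u\<in>F. cnj (r u) * op (op r) u) = (l2_norm S (op r))\<^sup>2"
    using l2_norm_op_sq[OF F(1-4)] by (metis Re_complex_of_real)
  also have "t\<^sup>2 * (l2_norm S (op (op r)))\<^sup>2 \<le> t\<^sup>2 * (C * l2_norm S (op r))\<^sup>2"
    using l2_op(2)[OF fin_supp_l2[OF \<open>fin_supp (op r)\<close>]]
    by (intro mult_left_mono power_mono) (auto simp: l2_norm_nonneg)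
  also have "t\<^sup>2 * (C * l2_norm S (op r))\<^sup>2 = t * (l2_norm S (op r))\<^sup>2"
    using C_pos by (simp add: t_def power_mult_distrib power2_eq_square)
  finally have "(l2_norm S ?h)\<^sup>2 \<le> (l2_norm S r)\<^sup>2 - t * (l2_norm S (op r))\<^sup>2" by simp
  also have "\<dots> \<le> (l2_norm S r)\<^sup>2 - t * (\<delta> * l2_norm S r)\<^sup>2"
    using below_fin[OF assms] delta C_pos
    by (intro diff_left_mono mult_left_mono power_mono) (auto simp: t_def l2_norm_nonneg)
  finally show ?thesis by (simp add: t_def power_mult_distrib algebra_simps)
qed

text \<open>Repeating the step from 0 makes the residual decay geometrically, while every iterate
  stays finitely supported, so that the lower bound can be used each time.\<close>

lemma dense_range:
  assumes "fin_supp f" "0 < \<epsilon>"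
  obtains g where "fin_supp g" "l2_norm S (\<lambda>u. f u - op g u) \<le> \<epsilon>"
proof -
  \<comment> \<open>The maximum with 0 gives \<open>0 \<le> q\<close> without comparing
    \<open>\<delta>\<close> with \<open>C\<close>.\<close>
  define q where "q = max 0 (1 - \<delta>\<^sup>2 / C\<^sup>2)"
  have q: "0 \<le> q" "q < 1" using delta C_pos by (auto simp: q_def)
  have *: "\<exists>g. fin_supp g \<and> (l2_norm S (\<lambda>u. f u - op g u))\<^sup>2 \<le> q ^ k * (l2_norm S f)\<^sup>2" for k
  proof (induction k)
    case 0
    have "fin_supp (\<lambda>_. 0)" by (auto simp: fin_supp_def supported_on_def)
    then show ?case by (intro exI[of _ "\<lambda>_. 0"]) (simp add: op_zero)
  next
    case (Suc k)
    then obtain g where g: "fin_supp g" "(l2_norm S (\<lambda>u. f u - op g u))\<^sup>2 \<le> q ^ k * (l2_norm S f)\<^sup>2"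
      by auto
    let ?r = "\<lambda>u. f u - op g u"
    let ?g = "\<lambda>u. g u + complex_of_real (1 / C\<^sup>2) * op ?r u"
    have r: "fin_supp ?r" using fin_supp_combine[OF assms(1) fin_supp_op[OF g(1)], of "-1"] by simp
    have "(\<lambda>u. f u - op ?g u) = (\<lambda>u. ?r u - op (op ?r) u / C\<^sup>2)"
      by (rule ext) (simp only: op_add op_scale, simp)
    then have "(l2_norm S (\<lambda>u. f u - op ?g u))\<^sup>2 \<le> (1 - \<delta>\<^sup>2 / C\<^sup>2) * (l2_norm S ?r)\<^sup>2"
      using richardson_step[OF r] by simp
    also have "\<dots> \<le> q * (l2_norm S ?r)\<^sup>2" by (intro mult_right_mono) (auto simp: q_def)
    also have "\<dots> \<le> q * (q ^ k * (l2_norm S f)\<^sup>2)" using g(2) q by (intro mult_left_mono)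
    finally have "(l2_norm S (\<lambda>u. f u - op ?g u))\<^sup>2 \<le> q ^ Suc k * (l2_norm S f)\<^sup>2" by (simp add: mult.assoc)
    moreover have "fin_supp ?g" by (rule fin_supp_combine[OF g(1) fin_supp_op[OF r]])
    ultimately show ?case by blast
  qed
  have "(\<lambda>k. q ^ k * (l2_norm S f)\<^sup>2) \<longlonglongrightarrow> 0 * (l2_norm S f)\<^sup>2"
    using q by (intro tendsto_intros LIMSEQ_realpow_zero)
  then have "eventually (\<lambda>k. q ^ k * (l2_norm S f)\<^sup>2 < \<epsilon>\<^sup>2) sequentially"
    using assms(2) by (intro order_tendstoD) auto
  then obtain k where k: "q ^ k * (l2_norm S f)\<^sup>2 < \<epsilon>\<^sup>2" by (auto simp: eventually_sequentially)
  obtain g where "fin_supp g" "(l2_norm S (\<lambda>u. f u - op g u))\<^sup>2 \<le> \<epsilon>\<^sup>2" using *[of k] k by force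
  then show ?thesis using assms(2) by (intro that[of g]) (auto intro: power2_le_imp_le)
qed

text \<open>Density of the finitely supported functions and boundedness of \<open>op\<close> carry
  the lower bound over to all of \<open>l2 S\<close>.\<close>

lemma bounded_below:
  assumes "f \<in> l2 S"
  shows "\<delta> * l2_norm S f \<le> l2_norm S (op f)"
proof (rule field_le_epsilon)
  fix e :: real assume e: "0 < e"
  \<comment> \<open>The truncation error enters once as \<open>\<delta> * \<epsilon>\<close> and
    once as \<open>C * \<epsilon>\<close>; together they make \<open>e\<close>.\<close>
  define \<epsilon> where "\<epsilon> = e / (C + \<delta>)"
  have eps: "0 < \<epsilon>" "\<epsilon> * (C + \<delta>) = e" using e C_pos delta by (auto simp: \<epsilon>_def)
  obtain F where F: "finite F" "F \<subseteq> S" "l2_norm S (\<lambda>u. f u - (if u \<in> F then f u else 0)) \<le> \<epsilon>"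
    by (rule l2_truncation[OF assms eps(1)])
  let ?g = "\<lambda>u. if u \<in> F then f u else 0"
  let ?h = "\<lambda>u. f u - ?g u"
  have g: "fin_supp ?g" using F by (auto simp: fin_supp_def supported_on_def)
  have gl: "?g \<in> l2 S" by (rule fin_supp_l2[OF g])
  have h: "?h \<in> l2 S" by (rule l2_diff(1)[OF assms gl])
  have g_neg: "(\<lambda>u. - ?g u) \<in> l2 S" "l2_norm S (\<lambda>u. - ?g u) = l2_norm S ?g"
    using gl by (auto simp: l2_def l2_norm_def)
  have "l2_norm S f \<le> l2_norm S ?h + l2_norm S ?g"
    using l2_diff(2)[OF h g_neg(1)] g_neg(2) by simp
  moreover have "l2_norm S (op ?g) \<le> l2_norm S (op f) + l2_norm S (op ?h)"
  proof -
    have "op ?g = (\<lambda>u. op f u - op ?h u)" by (rule ext) (simp only: op_diff, simp)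
    then show ?thesis using l2_diff(2)[OF l2_op(1)[OF assms] l2_op(1)[OF h]] by simp
  qed
  moreover have "l2_norm S (op ?h) \<le> C * \<epsilon>"
    using l2_op(2)[OF h] F(3) C_pos by (meson mult_left_mono order.trans less_imp_le)
  moreover have "\<delta> * l2_norm S f \<le> \<delta> * (\<epsilon> + l2_norm S ?g)"
    using calculation(1) F(3) delta by (intro mult_left_mono) auto
  ultimately have "\<delta> * l2_norm S f \<le> \<delta> * \<epsilon> + (l2_norm S (op f) + C * \<epsilon>)"
    using below_fin[OF g] by (simp add: distrib_left)
  then show "\<delta> * l2_norm S f \<le> l2_norm S (op f) + e" using eps(2) by (simp add: algebra_simps)
qed

text \<open>Approximate solutions are Cauchy by the lower bound. Their pointwise limit is in
  \<open>l2 S\<close> since the norms are bounded, and it is a solution since \<open>op\<close> is a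
  finite sum at each point.\<close>

lemma op_surj:
  assumes f: "f \<in> l2 S"
  obtains g where "g \<in> l2 S" "op g = f"
proof -
  have "\<exists>g. fin_supp g \<and> l2_norm S (\<lambda>u. f u - op g u) \<le> 1 / Suc n" for n
  proof -
    \<comment> \<open>Half of the error is spent on truncating \<open>f\<close>, half on solving
      approximately for the truncation.\<close>
    have e: "0 < 1 / (2 * real (Suc n))" by simp
    obtain F where F: "finite F" "F \<subseteq> S"
      "l2_norm S (\<lambda>u. f u - (if u \<in> F then f u else 0)) \<le> 1 / (2 * real (Suc n))"
      by (rule l2_truncation[OF f e])
    let ?h = "\<lambda>u. if u \<in> F then f u else 0"
    have h: "fin_supp ?h" using F by (auto simp: fin_supp_def supported_on_def)
    obtain g where g: "fin_supp g" "l2_norm S (\<lambda>u. ?h u - op g u) \<le> 1 / (2 * real (Suc n))"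
      by (rule dense_range[OF h e])
    have "l2_norm S (\<lambda>u. (f u - ?h u) - (op g u - ?h u)) \<le>
        l2_norm S (\<lambda>u. f u - ?h u) + l2_norm S (\<lambda>u. op g u - ?h u)"
      using f fin_supp_l2[OF h] fin_supp_l2[OF fin_supp_op[OF g(1)]] by (intro l2_diff) auto
    moreover have "l2_norm S (\<lambda>u. op g u - ?h u) = l2_norm S (\<lambda>u. ?h u - op g u)"
      by (simp add: l2_norm_def norm_minus_commute)
    ultimately have "l2_norm S (\<lambda>u. f u - op g u) \<le> 1 / (2 * real (Suc n)) + 1 / (2 * real (Suc n))"
      using F(3) g(2) by simp
    then show ?thesis using g(1) by (intro exI[of _ g]) (simp add: field_simps)
  qed
  then obtain g where g: "\<And>n. fin_supp (g n)" "\<And>n. l2_norm S (\<lambda>u. f u - op (g n) u) \<le> 1 / Suc n"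
    by metis
  have gl: "g n \<in> l2 S" "op (g n) \<in> l2 S" for n using g(1) fin_supp_l2 fin_supp_op by auto
  have dist: "\<delta> * l2_norm S (\<lambda>u. g n u - g m u) \<le> 1 / Suc n + 1 / Suc m" for n m
  proof -
    have "\<delta> * l2_norm S (\<lambda>u. g n u - g m u) \<le> l2_norm S (op (\<lambda>u. g n u - g m u))"
      by (rule bounded_below[OF l2_diff(1)[OF gl(1) gl(1)]])
    also have "op (\<lambda>u. g n u - g m u) = (\<lambda>u. (f u - op (g m) u) - (f u - op (g n) u))"
      by (rule ext) (simp add: op_diff)
    also have "l2_norm S \<dots> \<le> 1 / Suc m + 1 / Suc n"
      by (rule order.trans[OF l2_diff(2)[OF l2_diff(1)[OF f gl(2)] l2_diff(1)[OF f gl(2)]]])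
        (intro add_mono g(2))
    finally show ?thesis by simp
  qed
  have "Cauchy (\<lambda>n. g n u)" for u
  proof (rule metric_CauchyI)
    fix e :: real assume "0 < e"
    then obtain M where M: "1 / real (Suc M) < \<delta> * e / 2"
      using delta reals_Archimedean[of "\<delta> * e / 2"] by (auto simp: inverse_eq_divide)
    have "dist (g m u) (g n u) < e" if "M \<le> m" "M \<le> n" for m n
    proof -
      have "1 / real (Suc m) \<le> 1 / real (Suc M)" "1 / real (Suc n) \<le> 1 / real (Suc M)"
        using that by (auto simp: divide_simps)
      then have "\<delta> * l2_norm S (\<lambda>u. g m u - g n u) < \<delta> * e" using dist[of m n] M by linarith
      then have "l2_norm S (\<lambda>u. g m u - g n u) < e" using delta by simp
      then show ?thesis
        using cmod_le_l2_norm[OF l2_diff(1)[OF gl(1)[of m] gl(1)[of n]], of u] by (simp add: dist_norm)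
    qed
    then show "\<exists>M. \<forall>m\<ge>M. \<forall>n\<ge>M. dist (g m u) (g n u) < e" by blast
  qed
  then have "\<exists>l. (\<lambda>n. g n u) \<longlonglongrightarrow> l" for u using Cauchy_convergent convergent_def by blast
  then obtain G where G: "\<And>u. (\<lambda>n. g n u) \<longlonglongrightarrow> G u" by metis
  have bound: "l2_norm S (g n) \<le> (l2_norm S f + 1) / \<delta>" for n
  proof -
    have "\<delta> * l2_norm S (g n) \<le> l2_norm S (op (g n))" by (rule bounded_below[OF gl(1)])
    also have "\<dots> = l2_norm S (\<lambda>u. f u - (f u - op (g n) u))" by simp
    also have "\<dots> \<le> l2_norm S f + 1 / Suc n"
      using l2_diff(2)[OF f l2_diff(1)[OF f gl(2)[of n]]] g(2)[of n] by linarith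
    also have "1 / real (Suc n) \<le> 1" by simp
    finally show ?thesis using delta by (simp add: field_simps)
  qed
  have "G \<in> l2 S"
  proof (rule l2_boundI(1))
    show "G u = 0" if "u \<notin> S" for u
      using G[of u] l2_off[OF gl(1) that] by (simp add: LIMSEQ_const_iff)
    show "0 \<le> (l2_norm S f + 1) / \<delta>" using delta l2_norm_nonneg[of S f] by simp
    fix F assume F: "finite F" "F \<subseteq> S"
    have "(\<lambda>n. fin_norm (g n) F) \<longlonglongrightarrow> fin_norm G F"
      unfolding L2_set_def by (intro tendsto_intros G)
    then show "fin_norm G F \<le> (l2_norm S f + 1) / \<delta>"
      by (rule LIMSEQ_le_const2) (use L2_set_le_l2_norm[OF gl(1) F] bound order.trans in blast)
  qed
  moreover have "op G = f"
  proof
    fix u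
    have "(\<lambda>n. op (g n) u) \<longlonglongrightarrow> op G u"
      unfolding op_def by (cases "u \<in> S") (auto intro!: tendsto_intros G)
    moreover have "(\<lambda>n. op (g n) u) \<longlonglongrightarrow> f u"
    proof (rule Lim_null_comparison[THEN LIM_zero_cancel])
      have "norm (op (g n) u - f u) \<le> 1 / Suc n" for n
        using cmod_le_l2_norm[OF l2_diff(1)[OF f gl(2)[of n]], of u] g(2)[of n]
        by (simp add: norm_minus_commute)
      then show "eventually (\<lambda>n. norm (op (g n) u - f u) \<le> 1 / Suc n) sequentially" by simp
      show "(\<lambda>n. 1 / real (Suc n)) \<longlonglongrightarrow> 0"
        using LIMSEQ_inverse_real_of_nat by (simp add: inverse_eq_divide)
    qed
    ultimately show "op G u = f u" by (rule LIMSEQ_unique)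
  qed
  ultimately show ?thesis by (rule that)
qed

theorem op_invertible: "bij_betw op (l2 S) (l2 S)" "\<exists>B. \<forall>f\<in>l2 S. l2_norm S f \<le> B * l2_norm S (op f)"
proof -
  have "inj_on op (l2 S)"
  proof (rule inj_onI)
    fix f g assume fg: "f \<in> l2 S" "g \<in> l2 S" "op f = op g"
    let ?h = "\<lambda>u. f u - g u"
    have h: "?h \<in> l2 S" by (rule l2_diff(1)[OF fg(1,2)])
    have "op ?h = (\<lambda>u. 0)" by (rule ext) (simp add: op_diff fg(3))
    then have "\<delta> * l2_norm S ?h \<le> 0" using bounded_below[OF h] by (simp add: l2_norm_def)
    then have "l2_norm S ?h \<le> 0" using delta by (simp add: mult_le_0_iff)
    then have "cmod (f u - g u) \<le> 0" for u using cmod_le_l2_norm[OF h, of u] by linarith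
    then show "f = g" by (simp add: fun_eq_iff)
  qed
  moreover have "op ` l2 S = l2 S"
  proof
    show "l2 S \<subseteq> op ` l2 S" using op_surj by (metis image_eqI subsetI)
  qed (use l2_op(1) in auto)
  ultimately show "bij_betw op (l2 S) (l2 S)" by (simp add: bij_betw_def)
  show "\<exists>B. \<forall>f\<in>l2 S. l2_norm S f \<le> B * l2_norm S (op f)"
    using bounded_below delta by (intro exI[of _ "1 / \<delta>"]) (auto simp: field_simps)
qed

end

end

section \<open>Periodic graphs and their fundamental graphs\<close>

lemma phase_add: "phase (m + n) \<theta> = phase m \<theta> + phase n \<theta>"
  by (simp add: phase_def distrib_right sum.distrib)

lemma phase_minus: "phase (- m) \<theta> = - phase m \<theta>"
  by (simp add: phase_def sum_negf)

lemma phase_zero: "phase 0 \<theta> = 0" "phase m 0 = 0"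
  by (simp_all add: phase_def)

text \<open>The unitary character of the lattice at quasimomentum \<open>\<theta>\<close>.\<close>

definition chi :: "int ^ 'd \<Rightarrow> real ^ 'd \<Rightarrow> complex" where
  "chi m \<theta> = exp (\<i> * complex_of_real (phase m \<theta>))"

lemma chi_add: "chi (m + n) \<theta> = chi m \<theta> * chi n \<theta>"
  by (simp add: chi_def phase_add distrib_left exp_add)

lemma chi_zero: "chi 0 \<theta> = 1" "chi m 0 = 1"
  by (simp_all add: chi_def phase_zero)

lemma cnj_chi: "cnj (chi m \<theta>) = chi (- m) \<theta>"
  by (simp add: chi_def phase_minus exp_cnj)

lemma cmod_chi: "cmod (chi m \<theta>) = 1"
  by (simp add: chi_def)

lemma Re_chi: "Re (chi m \<theta>) = cos (phase m \<theta>)"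
  by (simp add: chi_def flip: cis_conv_exp)

context periodic_graph
begin

abbreviation "V \<equiv> vertices \<Gamma>"
abbreviation "W \<equiv> verts (fund_graph \<Gamma>)"
abbreviation "F \<equiv> arcs (fund_graph \<Gamma>)"
abbreviation "src \<equiv> tail (ograph \<Gamma>)"
abbreviation "tgt \<equiv> head (ograph \<Gamma>)"
abbreviation "fsrc \<equiv> tail (fund_graph \<Gamma>)"
abbreviation "ftgt \<equiv> head (fund_graph \<Gamma>)"
abbreviation "outs \<equiv> out_arcs (ograph \<Gamma>)"
abbreviation "E \<equiv> oedges \<Gamma>"
abbreviation "ipart \<equiv> int_part \<Gamma>"
abbreviation "fpart \<equiv> frac_part \<Gamma>"
abbreviation "lvec \<equiv> lattice_vec \<Gamma>"
abbreviation "orbit \<equiv> edge_orbit \<Gamma>"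
abbreviation "idx \<equiv> fund_index \<Gamma>"
abbreviation "Br \<equiv> bridges \<Gamma>"

interpretation bd: bidirected_digraph "ograph \<Gamma>" "arev \<Gamma>"
  by (rule bidirected)

lemma lvec_add: "lvec (m + n) = lvec m + lvec n"
  by (simp add: lattice_vec_def scaleR_add_left sum.distrib)

lemma lvec_zero: "lvec 0 = 0"
  by (simp add: lattice_vec_def)

lemma lvec_minus: "lvec (- m) = - lvec m"
  by (simp add: lattice_vec_def sum_negf)

lemma period_coordinates: "\<exists>r. x = (\<Sum>s\<in>UNIV. r s *\<^sub>R period \<Gamma> s)"
proof -
  have "x \<in> span (range (period \<Gamma>))" using period_span by simp
  then obtain c where "x = (\<Sum>a\<in>range (period \<Gamma>). c a *\<^sub>R a)"
    by (auto simp: span_finite)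
  also have "\<dots> = (\<Sum>s\<in>UNIV. c (period \<Gamma> s) *\<^sub>R period \<Gamma> s)"
    by (subst sum.reindex[OF period_inj]) simp
  finally show ?thesis by (intro exI[of _ "\<lambda>s. c (period \<Gamma> s)"])
qed

lemma period_coordinates_zero:
  assumes "(\<Sum>s\<in>UNIV. r s *\<^sub>R period \<Gamma> s) = 0" shows "r s = 0"
proof -
  have "(\<Sum>a\<in>range (period \<Gamma>). r (inv_into UNIV (period \<Gamma>) a) *\<^sub>R a) = 0"
    by (subst sum.reindex[OF period_inj]) (simp add: assms inv_f_f[OF period_inj])
  then have "r (inv_into UNIV (period \<Gamma>) (period \<Gamma> s)) = 0"
    by (intro independentD[OF period_independent finite_imageI[OF finite] order_refl _ rangeI])
  then show ?thesis by (simp add: inv_f_f[OF period_inj])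
qed

lemma period_coordinates_unique:
  assumes "(\<Sum>s\<in>UNIV. r s *\<^sub>R period \<Gamma> s) = (\<Sum>s\<in>UNIV. r' s *\<^sub>R period \<Gamma> s)"
  shows "r s = r' s"
  using period_coordinates_zero[of "\<lambda>s. r s - r' s" s] assms
  by (simp add: scaleR_diff_left sum_subtractf)

lemma lvec_eq_0_iff: "lvec m = 0 \<longleftrightarrow> m = 0"
  using period_coordinates_zero[of "\<lambda>s. real_of_int (m $ s)"]
  by (auto simp: lattice_vec_def vec_eq_iff)

text \<open>The integer vector consists of the floors of the coordinates relative to origin and
  periods. This justifies \<open>THE\<close> in \<open>int_part\<close>.\<close>

lemma ipart_ex1: "\<exists>!m. u - lvec m \<in> cell \<Gamma>"
proof -
  obtain r where r: "u - origin \<Gamma> = (\<Sum>s\<in>UNIV. r s *\<^sub>R period \<Gamma> s)"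
    using period_coordinates by blast
  have shifted: "u - lvec m = origin \<Gamma> + (\<Sum>s\<in>UNIV. (r s - real_of_int (m $ s)) *\<^sub>R period \<Gamma> s)" for m
  proof -
    have "(\<Sum>s\<in>UNIV. (r s - real_of_int (m $ s)) *\<^sub>R period \<Gamma> s) = (u - origin \<Gamma>) - lvec m"
      unfolding r lattice_vec_def by (simp add: scaleR_diff_left sum_subtractf)
    then show ?thesis by simp
  qed
  show ?thesis
  proof (rule ex1I[of _ "\<chi> s. \<lfloor>r s\<rfloor>"])
    have "0 \<le> r s - of_int \<lfloor>r s\<rfloor> \<and> r s - of_int \<lfloor>r s\<rfloor> < 1" for s by linarith
    then show "u - lvec (\<chi> s. \<lfloor>r s\<rfloor>) \<in> cell \<Gamma>"
      unfolding shifted cell_def by (intro CollectI exI[of _ "\<lambda>s. r s - of_int \<lfloor>r s\<rfloor>"]) auto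
  next
    fix m assume "u - lvec m \<in> cell \<Gamma>"
    then obtain x where x: "\<forall>s. 0 \<le> x s \<and> x s < 1"
      "u - lvec m = origin \<Gamma> + (\<Sum>s\<in>UNIV. x s *\<^sub>R period \<Gamma> s)"
      unfolding cell_def by blast
    then have "(\<Sum>s\<in>UNIV. (r s - real_of_int (m $ s)) *\<^sub>R period \<Gamma> s) = (\<Sum>s\<in>UNIV. x s *\<^sub>R period \<Gamma> s)"
      unfolding shifted by simp
    then have "r s - real_of_int (m $ s) = x s" for s by (rule period_coordinates_unique)
    then have "m $ s = \<lfloor>r s\<rfloor>" for s using x(1)[rule_format, of s]
      by (smt (verit) floor_unique of_int_less_iff)
    then show "m = (\<chi> s. \<lfloor>r s\<rfloor>)" by (simp add: vec_eq_iff)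
  qed
qed

lemma fpart_in_cell: "fpart u \<in> cell \<Gamma>"
  unfolding frac_part_def int_part_def by (rule theI'[OF ipart_ex1])

lemma ipart_eqI: "u - lvec m \<in> cell \<Gamma> \<Longrightarrow> ipart u = m"
  unfolding int_part_def by (rule the1_equality[OF ipart_ex1])

lemma ipart_cell: "u \<in> cell \<Gamma> \<Longrightarrow> ipart u = 0"
  by (rule ipart_eqI) (simp add: lvec_zero)

lemma fpart_cell: "u \<in> cell \<Gamma> \<Longrightarrow> fpart u = u"
  by (simp add: frac_part_def ipart_cell lvec_zero)

lemma ipart_shift: "ipart (u + lvec m) = ipart u + m"
  using fpart_in_cell[of u] by (intro ipart_eqI) (simp add: frac_part_def lvec_add algebra_simps)

lemma fpart_shift: "fpart (u + lvec m) = fpart u"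
  by (simp add: frac_part_def ipart_shift lvec_add)

lemma frac_plus_int: "fpart u + lvec (ipart u) = u"
  by (simp add: frac_part_def)

lemma vertex_shift: "u \<in> V \<Longrightarrow> u + lvec m \<in> V"
  using vertex_periodic[of m] by blast

lemma W_eq: "W = V \<inter> cell \<Gamma>"
  by (simp add: fund_graph_def)

lemma fpart_in_W: "u \<in> V \<Longrightarrow> fpart u \<in> W"
  using vertex_shift[of u "- ipart u"] fpart_in_cell[of u]
  by (simp add: W_eq lvec_minus frac_part_def)

lemma W_subset_V: "w \<in> W \<Longrightarrow> w \<in> V"
  by (simp add: W_eq)

lemma fpart_W: "w \<in> W \<Longrightarrow> fpart w = w"
  by (simp add: W_eq fpart_cell)

lemma ipart_W: "w \<in> W \<Longrightarrow> ipart w = 0"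
  by (simp add: W_eq ipart_cell)

lemma bounded_cell: "bounded (cell \<Gamma>)"
proof (rule boundedI)
  fix u assume "u \<in> cell \<Gamma>"
  then obtain x where x: "\<forall>s. 0 \<le> x s \<and> x s < 1" "u = origin \<Gamma> + (\<Sum>s\<in>UNIV. x s *\<^sub>R period \<Gamma> s)"
    unfolding cell_def by blast
  have "norm (\<Sum>s\<in>UNIV. x s *\<^sub>R period \<Gamma> s) \<le> (\<Sum>s\<in>UNIV. norm (period \<Gamma> s))"
    using x(1) by (intro sum_norm_le) (auto simp: less_imp_le mult_left_le_one_le)
  then show "norm u \<le> norm (origin \<Gamma>) + (\<Sum>s\<in>UNIV. norm (period \<Gamma> s))"
    unfolding x(2) by (intro order.trans[OF norm_triangle_ineq]) simp
qed

lemma finite_W: "finite W"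
  unfolding W_eq by (rule locally_finite[OF bounded_cell])

lemma frac_shift_vertex: "w \<in> W \<Longrightarrow> fpart (w + lvec m) = w"
  by (simp add: fpart_shift fpart_W)

lemma src_in_V: "e \<in> E \<Longrightarrow> src e \<in> V" and tgt_in_V: "e \<in> E \<Longrightarrow> tgt e \<in> V"
  by simp_all

lemma edge_index_shift: "e \<in> E \<Longrightarrow> edge_index \<Gamma> (shift \<Gamma> m e) = edge_index \<Gamma> e"
  by (simp add: edge_index_def shift_tail shift_head ipart_shift)

lemma fsrc_orbit: "e \<in> E \<Longrightarrow> fsrc (orbit e) = fpart (src e)"
  by (simp add: fund_graph_def edge_orbit_def image_image shift_tail fpart_shift)

lemma ftgt_orbit: "e \<in> E \<Longrightarrow> ftgt (orbit e) = fpart (tgt e)"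
  by (simp add: fund_graph_def edge_orbit_def image_image shift_head fpart_shift)

lemma index_orbit: "e \<in> E \<Longrightarrow> idx (orbit e) = edge_index \<Gamma> e"
  by (simp add: fund_index_def edge_orbit_def image_image edge_index_shift)

lemma F_eq: "F = orbit ` E"
  by (simp add: fund_graph_def)

lemma fsrc_in_W: "X \<in> F \<Longrightarrow> fsrc X \<in> W" and ftgt_in_W: "X \<in> F \<Longrightarrow> ftgt X \<in> W"
  by (auto simp: F_eq fsrc_orbit ftgt_orbit fpart_in_W)

lemma orbit_shift:
  assumes "e \<in> E" shows "orbit (shift \<Gamma> m e) = orbit e"
proof -
  have "orbit (shift \<Gamma> m e) = (\<lambda>n. shift \<Gamma> n e) ` range (\<lambda>n. n + m)"
    by (simp only: edge_orbit_def shift_add[OF assms, symmetric] image_image)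
  also have "range (\<lambda>n. n + m) = UNIV" by (metis diff_add_cancel surjI)
  finally show ?thesis by (simp add: edge_orbit_def)
qed

lemma edge_in_orbit: "e \<in> E \<Longrightarrow> e \<in> orbit e"
  unfolding edge_orbit_def using shift_zero by (metis rangeI)

text \<open>A translation that fixes the tail of an edge is zero, hence injectivity; and each
  fundamental edge leaving \<open>fpart u\<close> has a lift leaving \<open>u\<close>. Sums over
  edges of the infinite graph thus become sums over fundamental edges.\<close>

lemma bij_betw_outs:
  assumes u: "u \<in> V"
  shows "bij_betw orbit (outs u) {X \<in> F. fsrc X = fpart u}"
  unfolding bij_betw_def
proof
  show "inj_on orbit (outs u)"
  proof (rule inj_onI)
    fix e e' assume e: "e \<in> outs u" "e' \<in> outs u" "orbit e = orbit e'"
    then have "e' \<in> orbit e" using edge_in_orbit[of e'] by (simp add: out_arcs_def)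
    then obtain m where m: "e' = shift \<Gamma> m e" by (auto simp: edge_orbit_def)
    then have "lvec m = 0" using e(1,2) by (simp add: out_arcs_def shift_tail)
    then show "e = e'" using m e(1) by (simp add: lvec_eq_0_iff out_arcs_def shift_zero)
  qed
  show "orbit ` outs u = {X \<in> F. fsrc X = fpart u}"
  proof (intro equalityI subsetI)
    fix X assume "X \<in> {X \<in> F. fsrc X = fpart u}"
    then obtain e where e: "e \<in> E" "X = orbit e" "fpart (src e) = fpart u"
      by (auto simp: F_eq fsrc_orbit)
    \<comment> \<open>The translation from the cell of the tail of \<open>e\<close> to the cell of
      \<open>u\<close>.\<close>
    define e' where "e' = shift \<Gamma> (ipart u - ipart (src e)) e"
    have "src e' = fpart (src e) + lvec (ipart u)"
      unfolding e'_def shift_tail[OF e(1)] diff_conv_add_uminus lvec_add lvec_minus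
      by (simp add: frac_part_def)
    then have "src e' = u" by (simp add: e(3) frac_plus_int)
    moreover have "orbit e' = X" by (simp add: e'_def e(1,2) orbit_shift)
    moreover have "e' \<in> E" by (simp add: e'_def e(1) shift_arcs)
    ultimately show "X \<in> orbit ` outs u" by (auto simp: out_arcs_def)
  qed (auto simp: out_arcs_def F_eq fsrc_orbit)
qed

lemma finite_F: "finite F"
proof -
  have "F \<subseteq> (\<Union>w\<in>W. orbit ` outs w)"
  proof
    fix X assume X: "X \<in> F"
    then have w: "fsrc X \<in> W" by (rule fsrc_in_W)
    then have "X \<in> {Y \<in> F. fsrc Y = fpart (fsrc X)}" using X by (simp add: fpart_W)
    then have "X \<in> orbit ` outs (fsrc X)"
      using bij_betw_outs[OF W_subset_V[OF w]] by (simp add: bij_betw_def)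
    then show "X \<in> (\<Union>w\<in>W. orbit ` outs w)" using w by blast
  qed
  then show ?thesis
    by (rule finite_subset) (use finite_W finite_degree W_subset_V in blast)
qed

lemma deg_eq_card: "u \<in> V \<Longrightarrow> deg \<Gamma> u = card {X \<in> F. fsrc X = fpart u}"
  unfolding out_degree_def by (rule bij_betw_same_card[OF bij_betw_outs])

lemma deg_frac_part: "u \<in> V \<Longrightarrow> deg \<Gamma> (fpart u) = deg \<Gamma> u"
  using deg_eq_card[of u] deg_eq_card[of "fpart u"] fpart_in_W[of u]
  by (simp add: W_subset_V fpart_W)

lemma deg_W: "w \<in> W \<Longrightarrow> deg \<Gamma> w = card {X \<in> F. fsrc X = w}"
  by (simp add: deg_eq_card W_subset_V fpart_W)

section \<open>Reversal of fundamental edges, connectedness\<close>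

definition frev :: "'e set \<Rightarrow> 'e set" where "frev X = arev \<Gamma> ` X"

lemma frev_orbit: "e \<in> E \<Longrightarrow> frev (orbit e) = orbit (arev \<Gamma> e)"
  by (simp add: frev_def edge_orbit_def image_image shift_arev)

lemma frev_frev: "frev (frev X) = X"
  by (simp add: frev_def image_image)

lemma frev_props:
  assumes "X \<in> F"
  shows "frev X \<in> F" "fsrc (frev X) = ftgt X" "ftgt (frev X) = fsrc X"
    "idx (frev X) = - idx X"
proof -
  obtain e where e: "e \<in> E" "X = orbit e" using assms by (auto simp: F_eq)
  then have e': "arev \<Gamma> e \<in> E" by simp
  show "frev X \<in> F" using e' by (simp add: e frev_orbit F_eq)
  show "fsrc (frev X) = ftgt X" using e e' by (simp add: frev_orbit fsrc_orbit ftgt_orbit)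
  show "ftgt (frev X) = fsrc X" using e e' by (simp add: frev_orbit fsrc_orbit ftgt_orbit)
  show "idx (frev X) = - idx X"
    using e e' by (simp add: frev_orbit index_orbit edge_index_def)
qed

lemma sum_frev:
  assumes "\<And>X. X \<in> F \<Longrightarrow> X \<in> A \<Longrightarrow> frev X \<in> B" "\<And>X. X \<in> F \<Longrightarrow> X \<in> B \<Longrightarrow> frev X \<in> A"
  shows "(\<Sum>X\<in>F \<inter> A. f X) = (\<Sum>X\<in>F \<inter> B. f (frev X))"
  by (rule sum.reindex_bij_witness[of _ frev frev]) (use assms frev_props(1) frev_frev in auto)

text \<open>Every edge has its reverse, so connectedness provides a directed path to each vertex,
  along which membership in \<open>Z\<close> propagates.\<close>

lemma connected_closed:
  assumes "u \<in> V" "u \<in> Z" and step: "\<And>e. e \<in> E \<Longrightarrow> src e \<in> Z \<Longrightarrow> tgt e \<in> Z"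
  shows "V \<subseteq> Z"
proof
  fix w assume "w \<in> V"
  have "symmetric (ograph \<Gamma>)"
    unfolding symmetric_conv by (metis bd.arev_in_arcs bd.head_arev bd.tail_arev)
  then have "strongly_connected (ograph \<Gamma>)"
    using bd.symmetric_connected_imp_strongly_connected connected by blast
  then have "u \<rightarrow>\<^sup>*\<^bsub>ograph \<Gamma>\<^esub> w"
    using assms(1) \<open>w \<in> V\<close> by (simp add: strongly_connected_def)
  then show "w \<in> Z"
  proof (induction rule: bd.reachable_induct)
    case base
    show ?case by (rule assms(2))
  next
    case (step x y)
    then show ?case using assms(3) by (auto elim: reachableE)
  qed
qed

lemma V_nonempty: "V \<noteq> {}"
  using connected unfolding connected_def strongly_connected_def by simp

lemma W_nonempty: "W \<noteq> {}"
  using V_nonempty fpart_in_W by blast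

lemma fund_connected_closed:
  assumes "w \<in> W" "w \<in> Z" and step: "\<And>X. X \<in> F \<Longrightarrow> fsrc X \<in> Z \<Longrightarrow> ftgt X \<in> Z"
  shows "W \<subseteq> Z"
proof -
  have "V \<subseteq> {u. fpart u \<in> Z}"
  proof (rule connected_closed)
    fix e assume e: "e \<in> E" "src e \<in> {u. fpart u \<in> Z}"
    then show "tgt e \<in> {u. fpart u \<in> Z}"
      using step[of "orbit e"] by (simp add: F_eq fsrc_orbit ftgt_orbit)
  qed (use assms W_subset_V fpart_W in auto)
  then show ?thesis using W_subset_V fpart_W by fastforce
qed

section \<open>Plane waves and the kernel of the operator\<close>

definition plane_wave :: "real ^ 'd \<Rightarrow> (real ^ 'd \<Rightarrow> complex) \<Rightarrow> real ^ 'd \<Rightarrow> complex" where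
  "plane_wave \<theta> \<phi> u = (if u \<in> V then chi (ipart u) \<theta> * \<phi> (fpart u) else 0)"

text \<open>\<open>H(\<theta>)\<close> acting on functions on \<open>W\<close> instead of coordinate
  vectors, hence free of the enumeration \<open>v\<close>; \<open>mv_hmat\<close> identifies it with
  the Floquet matrix.\<close>

definition floquet_op :: "(real ^ 'd \<Rightarrow> real) \<Rightarrow> real ^ 'd \<Rightarrow> (real ^ 'd \<Rightarrow> complex) \<Rightarrow> real ^ 'd \<Rightarrow> complex" where
  "floquet_op Q \<theta> \<phi> w = of_real (real (deg \<Gamma> w) + Q w) * \<phi> w -
     (\<Sum>X | X \<in> F \<and> fsrc X = w. chi (idx X) \<theta> * \<phi> (ftgt X))"

text \<open>Along an edge the integer part changes by the edge index, so the phase at the target is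
  the phase at \<open>u\<close> times the Floquet phase of the orbit; \<open>bij_betw_outs\<close>
  then transfers the sum.\<close>

lemma schroedinger_plane_wave:
  assumes Q: "periodic_potential \<Gamma> Q" and u: "u \<in> V"
  shows "schroedinger \<Gamma> Q (plane_wave \<theta> \<phi>) u = plane_wave \<theta> (floquet_op Q \<theta> \<phi>) u"
proof -
  let ?c = "chi (ipart u) \<theta>" and ?w = "fpart u"
  have Qw: "Q ?w = Q u"
    using Q fpart_in_W[OF u] frac_plus_int[of u] unfolding periodic_potential_def
    by (metis W_subset_V)
  have tgt: "plane_wave \<theta> \<phi> (tgt e) = ?c * (chi (idx (orbit e)) \<theta> * \<phi> (ftgt (orbit e)))"
    if "e \<in> outs u" for e
  proof -
    have e: "e \<in> E" "src e = u" using that by (auto simp: out_arcs_def)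
    have "ipart (tgt e) = ipart u + edge_index \<Gamma> e" by (simp add: edge_index_def e(2))
    then show ?thesis
      using e by (simp add: plane_wave_def chi_add index_orbit ftgt_orbit)
  qed
  have "(\<Sum>e\<in>outs u. plane_wave \<theta> \<phi> (tgt e)) =
      (\<Sum>e\<in>outs u. ?c * (chi (idx (orbit e)) \<theta> * \<phi> (ftgt (orbit e))))"
    by (intro sum.cong refl tgt)
  also have "\<dots> = (\<Sum>X | X \<in> F \<and> fsrc X = ?w. ?c * (chi (idx X) \<theta> * \<phi> (ftgt X)))"
    by (rule sum.reindex_bij_betw[OF bij_betw_outs[OF u]])
  finally have "(\<Sum>e\<in>outs u. plane_wave \<theta> \<phi> (tgt e)) =
      ?c * (\<Sum>X | X \<in> F \<and> fsrc X = ?w. chi (idx X) \<theta> * \<phi> (ftgt X))"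
    by (simp add: sum_distrib_left)
  then show ?thesis
    using u by (simp add: schroedinger_def laplacian_def sum_subtractf floquet_op_def
        plane_wave_def[of _ _ u] deg_frac_part Qw algebra_simps flip: out_degree_def)
qed

lemma deg_bounded: "\<exists>B. \<forall>u\<in>V. real (deg \<Gamma> u) \<le> B"
proof (intro exI ballI)
  fix u assume u: "u \<in> V"
  have "deg \<Gamma> u \<le> card F"
    unfolding deg_eq_card[OF u] by (rule card_mono[OF finite_F]) auto
  then show "real (deg \<Gamma> u) \<le> real (card F)" by simp
qed

lemma potential_bounded:
  assumes "periodic_potential \<Gamma> Q" shows "\<exists>B. \<forall>u\<in>V. \<bar>Q u\<bar> \<le> B"
proof (intro exI ballI)
  fix u assume u: "u \<in> V"
  have "Q (fpart u) = Q u"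
    using assms fpart_in_W[OF u] frac_plus_int[of u] unfolding periodic_potential_def
    by (metis W_subset_V)
  then show "\<bar>Q u\<bar> \<le> Max ((\<lambda>w. \<bar>Q w\<bar>) ` W)"
    using finite_W fpart_in_W[OF u] by (metis Max_ge finite_imageI image_eqI)
qed

definition nbhd :: "real ^ 'd \<Rightarrow> (real ^ 'd) set" where
  "nbhd u = insert u (tgt ` outs u)"

text \<open>The kernel of \<open>H - z\<close>. Parallel edges are counted by the cardinality, and
  an oriented loop cancels between that count and the degree. The set \<open>nbhd u\<close> contains
  \<open>u\<close> in order to cover the diagonal.\<close>

definition kernel :: "(real ^ 'd \<Rightarrow> real) \<Rightarrow> real \<Rightarrow> real ^ 'd \<Rightarrow> real ^ 'd \<Rightarrow> complex" where
  "kernel Q z u w = (if u = w then of_real (real (deg \<Gamma> u) + Q u - z) else 0) - of_nat (card {e \<in> outs u. tgt e = w})"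

lemma sum_outs_by_target:
  assumes "u \<in> V"
  shows "(\<Sum>w\<in>nbhd u. of_nat (card {e \<in> outs u. tgt e = w}) * g w) = (\<Sum>e\<in>outs u. g (tgt e) :: 'b :: comm_semiring_1)"
proof -
  have fin: "finite (outs u)" by (rule finite_degree[OF assms])
  have "(\<Sum>w\<in>nbhd u. of_nat (card {e \<in> outs u. tgt e = w}) * g w) = (\<Sum>w\<in>nbhd u. \<Sum>e | e \<in> outs u \<and> tgt e = w. g (tgt e))"
    by (intro sum.cong refl) simp
  also have "\<dots> = (\<Sum>e\<in>outs u. g (tgt e))"
    using fin by (intro sum.group) (auto simp: nbhd_def)
  finally show ?thesis .
qed

lemma hermitian_kernel_exists:
  assumes Q: "periodic_potential \<Gamma> Q"
  obtains C where "hermitian_kernel V (kernel Q z) nbhd C"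
proof -
  obtain B1 B2 where B1: "\<And>u. u \<in> V \<Longrightarrow> real (deg \<Gamma> u) \<le> B1" and B2: "\<And>u. u \<in> V \<Longrightarrow> \<bar>Q u\<bar> \<le> B2"
    using deg_bounded potential_bounded[OF Q] by auto
  \<comment> \<open>A row sum is at most twice the degree plus \<open>\<bar>Q u\<bar>\<close> plus
    \<open>\<bar>z\<bar>\<close>; the summand 1 makes \<open>C\<close> positive.\<close>
  define C where "C = 2 * \<bar>B1\<bar> + \<bar>B2\<bar> + \<bar>z\<bar> + 1"
  have "hermitian_kernel V (kernel Q z) nbhd C"
  proof
    show "finite (nbhd u)" if "u \<in> V" for u using finite_degree[OF that] by (simp add: nbhd_def)
    show "nbhd u \<subseteq> V" if "u \<in> V" for u using that by (auto simp: nbhd_def out_arcs_def)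
    show "u \<in> nbhd w" if uw: "u \<in> V" "w \<in> nbhd u" for u w
    proof (cases "w = u")
      case False
      then obtain e where "e \<in> E" "src e = u" "tgt e = w"
        using uw by (auto simp: nbhd_def out_arcs_def)
      then have "arev \<Gamma> e \<in> outs w" "tgt (arev \<Gamma> e) = u" by (auto simp: out_arcs_def)
      then show ?thesis unfolding nbhd_def by (metis image_eqI insertCI)
    qed (simp add: nbhd_def)
    show "kernel Q z u w = cnj (kernel Q z w u)" if "u \<in> V" "w \<in> V" for u w
    proof -
      have "bij_betw (arev \<Gamma>) {e \<in> outs u. tgt e = w} {e \<in> outs w. tgt e = u}"
        by (rule bij_betw_byWitness[where f' = "arev \<Gamma>"]) (auto simp: out_arcs_def)
      then have "card {e \<in> outs u. tgt e = w} = card {e \<in> outs w. tgt e = u}"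
        by (rule bij_betw_same_card)
      then show ?thesis by (auto simp: kernel_def)
    qed
    show "kernel Q z u w = 0" if "u \<in> V" "w \<notin> nbhd u" for u w
    proof -
      have "{e \<in> outs u. tgt e = w} = {}" "u \<noteq> w" using that by (auto simp: nbhd_def)
      then show ?thesis by (simp only: kernel_def if_False card.empty of_nat_0 diff_zero)
    qed
    show "(\<Sum>w\<in>nbhd u. cmod (kernel Q z u w)) \<le> C" if u: "u \<in> V" for u
    proof -
      have fin: "finite (nbhd u)" using finite_degree[OF u] by (simp add: nbhd_def)
      have "(\<Sum>w\<in>nbhd u. cmod (kernel Q z u w)) \<le>
          (\<Sum>w\<in>nbhd u. (if u = w then \<bar>real (deg \<Gamma> u) + Q u - z\<bar> else 0) + real (card {e \<in> outs u. tgt e = w}))"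
      proof (intro sum_mono)
        fix w
        show "cmod (kernel Q z u w) \<le> (if u = w then \<bar>real (deg \<Gamma> u) + Q u - z\<bar> else 0) + real (card {e \<in> outs u. tgt e = w})"
          unfolding kernel_def by (rule order.trans[OF norm_triangle_ineq4]) (auto simp del: of_real_add of_real_diff)
      qed
      also have "\<dots> = \<bar>real (deg \<Gamma> u) + Q u - z\<bar> + real (deg \<Gamma> u)"
        using sum_outs_by_target[OF u, of "\<lambda>_. 1 :: real"] fin
        by (simp add: sum.distrib out_degree_def) (simp add: nbhd_def)
      also have "\<dots> \<le> C" using B1[OF u] B2[OF u] by (simp add: C_def)
      finally show ?thesis .
    qed
    show "0 < C" by (simp add: C_def)
  qed
  then show ?thesis by (rule that)
qed

lemma op_kernel:
  assumes "hermitian_kernel V (kernel Q z) nbhd C" and off: "\<And>u. u \<notin> V \<Longrightarrow> f u = 0"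
  shows "hermitian_kernel.op V (kernel Q z) nbhd f u = schroedinger \<Gamma> Q f u - of_real z * f u"
proof -
  interpret hermitian_kernel V "kernel Q z" nbhd C by (rule assms(1))
  show ?thesis
  proof (cases "u \<in> V")
    case True
    have "op f u = (\<Sum>w\<in>nbhd u. (if u = w then of_real (real (deg \<Gamma> u) + Q u - z) * f w else 0) -
        of_nat (card {e \<in> outs u. tgt e = w}) * f w)"
      unfolding op_def kernel_def using True by (auto simp: left_diff_distrib intro!: sum.cong)
    also have "\<dots> = of_real (real (deg \<Gamma> u) + Q u - z) * f u - (\<Sum>e\<in>outs u. f (tgt e))"
      using finite_N[OF True] sum_outs_by_target[OF True, of f] by (simp add: sum_subtractf) (simp add: nbhd_def)
    also have "\<dots> = schroedinger \<Gamma> Q f u - of_real z * f u"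
      by (simp add: schroedinger_def laplacian_def sum_subtractf out_degree_def algebra_simps)
    finally show ?thesis .
  next
    case False
    then have "outs u = {}" using src_in_V by (auto simp: out_arcs_def)
    then show ?thesis using False off by (simp add: op_def schroedinger_def laplacian_def)
  qed
qed

end

section \<open>Bands\<close>

text \<open>Adding \<open>c\<close> times the identity to \<open>B\<close> shifts its eigenvalues
  and keeps its eigenvectors, which reduces the claim to the comparison without constraints.\<close>

lemma eigenvalue_shift:
  assumes A: "hermitian n A" "eigensystem n A u \<mu>" and B: "hermitian n B" "eigensystem n B w \<kappa>"
    and le: "\<And>x. qform n A x \<le> qform n B x + c * nsq n x" and "i < n"
  shows "\<mu> i \<le> \<kappa> i + c"
proof -
  let ?B = "\<lambda>j k. B j k + (if j = k then complex_of_real c else 0)"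
  have mvB: "mv n ?B x j = mv n B x j + of_real c * x j" if "j < n" for x j
  proof -
    have "mv n ?B x j = (\<Sum>k<n. B j k * x k + (if j = k then of_real c * x k else 0))"
      unfolding mv_def by (intro sum.cong refl) (simp add: distrib_right)
    then show ?thesis using that by (simp add: sum.distrib mv_def)
  qed
  have herm: "hermitian n ?B"
    unfolding hermitian_def
  proof (intro allI impI)
    fix j k assume "j < n" "k < n"
    then have "B j k = cnj (B k j)" using B(1) unfolding hermitian_def by blast
    then show "?B j k = cnj (?B k j)" by auto
  qed
  have sys: "eigensystem n ?B w (\<lambda>i. \<kappa> i + c)"
    using B(2) unfolding eigensystem_def by (auto simp: mvB distrib_right)
  have qf: "qform n ?B x = qform n B x + c * nsq n x" for x
  proof -
    have "hip n x (mv n ?B x) = hip n x (\<lambda>j. mv n B x j + of_real c * x j)"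
      by (intro hip_cong refl) (simp add: mvB)
    then show ?thesis by (simp add: qform_def hip_add_right hip_scale_right hip_self)
  qed
  show ?thesis
    using eigenvalue_comparison[OF A herm sys, of 0 "\<lambda>_ _. 0" i] \<open>i < n\<close> by (simp add: qf le)
qed

lemma chi_continuous: "continuous_on UNIV (chi m)"
  unfolding chi_def phase_def by (intro continuous_intros)

lemma chi_period: "chi m (\<chi> s. \<theta> $ s + 2 * pi * real_of_int (n $ s)) = chi m \<theta>"
proof -
  define N where "N = (\<Sum>s\<in>UNIV. m $ s * n $ s)"
  have "phase m (\<chi> s. \<theta> $ s + 2 * pi * real_of_int (n $ s)) = phase m \<theta> + 2 * pi * real_of_int N"
    by (simp add: phase_def N_def algebra_simps sum.distrib sum_distrib_left)
  then have "chi m (\<chi> s. \<theta> $ s + 2 * pi * real_of_int (n $ s)) =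
      chi m \<theta> * exp (\<i> * (2 * pi * real_of_int N))"
    by (simp add: chi_def distrib_left exp_add)
  also have "exp (\<i> * (2 * pi * real_of_int N)) = 1"
    unfolding exp_eq_1 by (intro conjI exI[of _ N]) simp_all
  finally show ?thesis by simp
qed

locale floquet = periodic_graph \<Gamma> for \<Gamma> :: "('d::finite, 'e) lattice_graph" +
  fixes v :: "nat \<Rightarrow> real ^ 'd"
  assumes enum: "bij_betw v {1..num_verts \<Gamma>} (verts (fund_graph \<Gamma>))"
begin

abbreviation "\<nu> \<equiv> num_verts \<Gamma>"

lemma nu_pos: "0 < \<nu>"
  using finite_W W_nonempty by (simp add: num_verts_def card_gt_0_iff)

lemma enum_Suc: "bij_betw (\<lambda>j. v (Suc j)) {..<\<nu>} W"
proof -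
  have "bij_betw Suc {..<\<nu>} {1..\<nu>}"
    by (rule bij_betw_byWitness[where f' = "\<lambda>j. j - 1"]) auto
  from bij_betw_trans[OF this enum] show ?thesis by (simp add: o_def)
qed

lemma v_in_W: "j < \<nu> \<Longrightarrow> v (Suc j) \<in> W"
  using enum_Suc by (auto simp: bij_betw_def)

lemma v_eq_iff: "j < \<nu> \<Longrightarrow> k < \<nu> \<Longrightarrow> v (Suc j) = v (Suc k) \<longleftrightarrow> j = k"
  using enum_Suc by (auto simp: bij_betw_def inj_on_def)

definition lift :: "(real ^ 'd \<Rightarrow> complex) \<Rightarrow> nat \<Rightarrow> complex" where
  "lift \<phi> j = \<phi> (v (Suc j))"

lemma lift_surj: "\<exists>\<phi>. \<forall>j<\<nu>. x j = lift \<phi> j"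
proof (intro exI allI impI)
  fix j assume "j < \<nu>"
  then show "x j = lift (\<lambda>w. x (the_inv_into {..<\<nu>} (\<lambda>j. v (Suc j)) w)) j"
    using enum_Suc the_inv_into_f_f[of "\<lambda>j. v (Suc j)" "{..<\<nu>}" j] by (simp add: lift_def bij_betw_def)
qed

lemma sum_W: "(\<Sum>w\<in>W. g w) = (\<Sum>j<\<nu>. g (v (Suc j)))"
  by (rule sum.reindex_bij_betw[OF enum_Suc, symmetric])

abbreviation "wsq \<phi> \<equiv> \<Sum>w\<in>W. (cmod (\<phi> w))\<^sup>2"

lemma nsq_lift: "nsq \<nu> (lift \<phi>) = wsq \<phi>"
  by (simp add: sum_W nsq_def lift_def)

text \<open>Floquet matrices with the phases replaced by arbitrary edge weights; the weight \<open>0\<close> removes an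
  edge.\<close>

definition weighted_mat :: "(real ^ 'd \<Rightarrow> real) \<Rightarrow> ('e set \<Rightarrow> complex) \<Rightarrow> nat \<Rightarrow> nat \<Rightarrow> complex" where
  "weighted_mat g c j k = (if j = k then of_real (g (v (Suc j))) else 0) -
     (\<Sum>X | X \<in> F \<and> fsrc X = v (Suc j) \<and> ftgt X = v (Suc k). c X)"

definition weighted_form :: "(real ^ 'd \<Rightarrow> real) \<Rightarrow> ('e set \<Rightarrow> complex) \<Rightarrow> (real ^ 'd \<Rightarrow> complex) \<Rightarrow> real" where
  "weighted_form g c \<phi> = (\<Sum>w\<in>W. g w * (cmod (\<phi> w))\<^sup>2) -
     (\<Sum>X\<in>F. Re (cnj (\<phi> (fsrc X)) * c X * \<phi> (ftgt X)))"

text \<open>The condition that makes \<open>weighted_mat\<close> Hermitian; the Floquet phases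
  satisfy it, and so do the weights that delete all bridges.\<close>

definition weight :: "('e set \<Rightarrow> complex) \<Rightarrow> bool" where
  "weight c \<longleftrightarrow> (\<forall>X\<in>F. c (frev X) = cnj (c X))"

lemma mv_weighted_mat:
  assumes "j < \<nu>"
  shows "mv \<nu> (weighted_mat g c) (lift \<phi>) j = of_real (g (v (Suc j))) * \<phi> (v (Suc j)) -
    (\<Sum>X | X \<in> F \<and> fsrc X = v (Suc j). c X * \<phi> (ftgt X))"
proof -
  let ?S = "{X. X \<in> F \<and> fsrc X = v (Suc j)}"
  have "mv \<nu> (weighted_mat g c) (lift \<phi>) j = (\<Sum>k<\<nu>. (if j = k then of_real (g (v (Suc j))) * \<phi> (v (Suc j)) else 0) -
      (\<Sum>X | X \<in> F \<and> fsrc X = v (Suc j) \<and> ftgt X = v (Suc k). c X) * \<phi> (v (Suc k)))"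
    unfolding mv_def weighted_mat_def lift_def by (intro sum.cong refl) (auto simp: left_diff_distrib)
  also have "\<dots> = of_real (g (v (Suc j))) * \<phi> (v (Suc j)) -
      (\<Sum>k<\<nu>. (\<Sum>X | X \<in> F \<and> fsrc X = v (Suc j) \<and> ftgt X = v (Suc k). c X) * \<phi> (v (Suc k)))"
    using assms by (simp add: sum_subtractf)
  also have "(\<Sum>k<\<nu>. (\<Sum>X | X \<in> F \<and> fsrc X = v (Suc j) \<and> ftgt X = v (Suc k). c X) * \<phi> (v (Suc k)))
      = (\<Sum>w\<in>W. \<Sum>X | X \<in> ?S \<and> ftgt X = w. c X * \<phi> (ftgt X))"
    unfolding sum_W by (intro sum.cong refl) (auto simp: sum_distrib_right conj_assoc intro!: sum.cong)
  also have "\<dots> = (\<Sum>X\<in>?S. c X * \<phi> (ftgt X))"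
    using finite_F finite_W ftgt_in_W by (intro sum.group) auto
  finally show ?thesis .
qed

lemma qform_weighted_mat: "qform \<nu> (weighted_mat g c) (lift \<phi>) = weighted_form g c \<phi>"
proof -
  have "hip \<nu> (lift \<phi>) (mv \<nu> (weighted_mat g c) (lift \<phi>)) =
    (\<Sum>j<\<nu>. cnj (\<phi> (v (Suc j))) * (of_real (g (v (Suc j))) * \<phi> (v (Suc j)) -
      (\<Sum>X | X \<in> F \<and> fsrc X = v (Suc j). c X * \<phi> (ftgt X))))"
    unfolding hip_def by (intro sum.cong refl) (simp add: mv_weighted_mat, simp add: lift_def)
  also have "\<dots> = (\<Sum>w\<in>W. cnj (\<phi> w) * (of_real (g w) * \<phi> w - (\<Sum>X | X \<in> F \<and> fsrc X = w. c X * \<phi> (ftgt X))))"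
    by (rule sum_W[symmetric])
  also have "\<dots> = (\<Sum>w\<in>W. of_real (g w * (cmod (\<phi> w))\<^sup>2)) -
      (\<Sum>w\<in>W. \<Sum>X | X \<in> F \<and> fsrc X = w. cnj (\<phi> (fsrc X)) * c X * \<phi> (ftgt X))"
    unfolding sum_subtractf[symmetric] of_real_mult complex_norm_square
    by (intro sum.cong refl) (simp add: right_diff_distrib sum_distrib_left algebra_simps)
  also have "(\<Sum>w\<in>W. \<Sum>X | X \<in> F \<and> fsrc X = w. cnj (\<phi> (fsrc X)) * c X * \<phi> (ftgt X)) =
      (\<Sum>X\<in>F. cnj (\<phi> (fsrc X)) * c X * \<phi> (ftgt X))"
    using finite_F finite_W fsrc_in_W by (intro sum.group) auto
  finally have "hip \<nu> (lift \<phi>) (mv \<nu> (weighted_mat g c) (lift \<phi>)) =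
      of_real (\<Sum>w\<in>W. g w * (cmod (\<phi> w))\<^sup>2) - (\<Sum>X\<in>F. cnj (\<phi> (fsrc X)) * c X * \<phi> (ftgt X))"
    by (simp only: of_real_sum)
  then show ?thesis by (simp only: qform_def weighted_form_def minus_complex.sel Re_complex_of_real Re_sum)
qed

lemma hermitian_weighted_mat:
  assumes "weight c" shows "hermitian \<nu> (weighted_mat g c)"
  unfolding hermitian_def
proof (intro allI impI)
  fix j k
  let ?A = "\<lambda>j k. {X. fsrc X = v (Suc j) \<and> ftgt X = v (Suc k)}"
  have "(\<Sum>X\<in>F \<inter> ?A j k. c X) = (\<Sum>X\<in>F \<inter> ?A k j. c (frev X))"
    by (rule sum_frev) (auto simp: frev_props)
  also have "\<dots> = (\<Sum>X\<in>F \<inter> ?A k j. cnj (c X))"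
    using assms by (intro sum.cong) (auto simp: weight_def)
  finally show "weighted_mat g c j k = cnj (weighted_mat g c k j)"
    by (auto simp: weighted_mat_def Int_def)
qed

lemma trace_weighted_mat:
  "(\<Sum>j<\<nu>. Re (weighted_mat g c j j)) = (\<Sum>w\<in>W. g w) - (\<Sum>X | X \<in> F \<and> fsrc X = ftgt X. Re (c X))"
proof -
  let ?S = "{X \<in> F. fsrc X = ftgt X}"
  have "(\<Sum>j<\<nu>. Re (weighted_mat g c j j)) =
      (\<Sum>w\<in>W. g w - (\<Sum>X | X \<in> ?S \<and> fsrc X = w. Re (c X)))"
    unfolding sum_W by (intro sum.cong refl) (auto simp: weighted_mat_def intro!: sum.cong)
  also have "\<dots> = (\<Sum>w\<in>W. g w) - (\<Sum>w\<in>W. \<Sum>X | X \<in> ?S \<and> fsrc X = w. Re (c X))"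
    by (rule sum_subtractf)
  also have "(\<Sum>w\<in>W. \<Sum>X | X \<in> ?S \<and> fsrc X = w. Re (c X)) = (\<Sum>X\<in>?S. Re (c X))"
    using finite_F finite_W fsrc_in_W ftgt_in_W by (intro sum.group) auto
  finally show ?thesis .
qed

abbreviation chis :: "real ^ 'd \<Rightarrow> 'e set \<Rightarrow> complex" where
  "chis \<theta> X \<equiv> chi (idx X) \<theta>"

abbreviation hdiag :: "(real ^ 'd \<Rightarrow> real) \<Rightarrow> real ^ 'd \<Rightarrow> real" where
  "hdiag Q w \<equiv> real (deg \<Gamma> w) + Q w"

abbreviation "hop \<theta> \<phi> X \<equiv> cnj (\<phi> (fsrc X)) * chis \<theta> X * \<phi> (ftgt X)"

lemma weight_chis: "weight (chis \<theta>)"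
  by (simp add: weight_def frev_props cnj_chi)

lemma floquet_laplacian_chi:
  "floquet_laplacian \<Gamma> v (Suc j) (Suc k) \<theta> =
    (if Suc j = Suc k then of_nat (deg \<Gamma> (v (Suc j))) else 0) -
    (\<Sum>X | X \<in> F \<and> fsrc X = v (Suc j) \<and> ftgt X = v (Suc k). chis \<theta> X)"
  by (simp add: floquet_laplacian_def chi_def)

lemma floquet_matrix_entry:
  assumes "j < \<nu>" "k < \<nu>"
  shows "floquet_matrix \<Gamma> v Q \<theta> $$ (j, k) = weighted_mat (hdiag Q) (chis \<theta>) j k"
  using assms by (simp add: floquet_matrix_def floquet_laplacian_chi weighted_mat_def)

abbreviation ev :: "(real ^ 'd \<Rightarrow> real) \<Rightarrow> real ^ 'd \<Rightarrow> nat \<Rightarrow> real" where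
  "ev Q \<theta> i \<equiv> nth_eigenvalue (floquet_matrix \<Gamma> v Q \<theta>) (Suc i)"

abbreviation "hmat Q \<theta> \<equiv> weighted_mat (hdiag Q) (chis \<theta>)"
abbreviation "hform Q \<theta> \<equiv> weighted_form (hdiag Q) (chis \<theta>)"

lemma hermitian_hmat: "hermitian \<nu> (hmat Q \<theta>)"
  by (rule hermitian_weighted_mat[OF weight_chis])

text \<open>Ties the eigenvalues read off from characteristic polynomials to an eigensystem; from
  here on all comparisons of forms apply to \<open>ev\<close>.\<close>

lemma eigensystem_hmat: "\<exists>u. eigensystem \<nu> (hmat Q \<theta>) u (ev Q \<theta>)"
proof -
  let ?M = "floquet_matrix \<Gamma> v Q \<theta>"
  have M: "?M \<in> carrier_mat \<nu> \<nu>" by (simp add: floquet_matrix_def)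
  obtain u \<mu> where sys: "eigensystem \<nu> (hmat Q \<theta>) u \<mu>"
    by (rule spectral_theorem[OF hermitian_hmat])
  have mv: "mv \<nu> (\<lambda>j k. ?M $$ (j, k)) x j = mv \<nu> (hmat Q \<theta>) x j" if "j < \<nu>" for x j
    unfolding mv_def using that by (intro sum.cong refl) (simp add: floquet_matrix_entry)
  have "eigensystem \<nu> (\<lambda>j k. ?M $$ (j, k)) u \<mu>"
    using sys unfolding eigensystem_def by (simp add: mv)
  then have "ev Q \<theta> i = \<mu> i" if "i < \<nu>" for i
    using nth_eigenvalue_eigensystem(2)[OF M _ that] by blast
  then have "eigensystem \<nu> (hmat Q \<theta>) u (ev Q \<theta>)"
    using sys unfolding eigensystem_def by simp
  then show ?thesis by blast
qed

lemma qform_lift_le: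
  assumes "\<And>\<phi>. weighted_form g c \<phi> \<le> weighted_form g' c' \<phi> + a * wsq \<phi>"
  shows "qform \<nu> (weighted_mat g c) x \<le> qform \<nu> (weighted_mat g' c') x + a * nsq \<nu> x"
proof -
  obtain \<phi> where x: "\<And>j. j < \<nu> \<Longrightarrow> x j = lift \<phi> j" using lift_surj by blast
  have "qform \<nu> A x = qform \<nu> A (lift \<phi>)" "nsq \<nu> x = nsq \<nu> (lift \<phi>)" for A
    using x by (auto intro: qform_cong nsq_cong)
  then show ?thesis using assms[of \<phi>] by (simp add: qform_weighted_mat nsq_lift)
qed

lemma weighted_eigenvalue_shift:
  assumes "weight c" "weight c'" "eigensystem \<nu> (weighted_mat g c) u \<mu>"
    "eigensystem \<nu> (weighted_mat g' c') w \<kappa>" "i < \<nu>"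
    and "\<And>\<phi>. weighted_form g c \<phi> \<le> weighted_form g' c' \<phi> + a * wsq \<phi>"
  shows "\<mu> i \<le> \<kappa> i + a"
  by (rule eigenvalue_shift[OF hermitian_weighted_mat[OF assms(1)] assms(3)
    hermitian_weighted_mat[OF assms(2)] assms(4) qform_lift_le[OF assms(6)] assms(5)])

lemma ev_shift:
  assumes "i < \<nu>" "\<And>\<phi>. hform Q \<theta> \<phi> \<le> hform Q' \<theta>' \<phi> + a * wsq \<phi>"
  shows "ev Q \<theta> i \<le> ev Q' \<theta>' i + a"
  using eigensystem_hmat[of Q \<theta>] eigensystem_hmat[of Q' \<theta>']
    weighted_eigenvalue_shift[OF weight_chis weight_chis _ _ assms] by blast

lemma ev_mono: "i \<le> j \<Longrightarrow> j < \<nu> \<Longrightarrow> ev Q \<theta> i \<le> ev Q \<theta> j"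
  using eigensystem_hmat[of Q \<theta>] eigensystem_mono by blast

lemma ev_min_le: "ev Q \<theta> 0 * wsq \<phi> \<le> hform Q \<theta> \<phi>"
  using eigensystem_hmat[of Q \<theta>] qform_ge_min[OF _ hermitian_hmat, of Q \<theta> _ "ev Q \<theta>" "lift \<phi>"]
  by (auto simp: qform_weighted_mat nsq_lift)

lemma ev_max_ge: "hform Q \<theta> \<phi> \<le> ev Q \<theta> (\<nu> - 1) * wsq \<phi>"
  using eigensystem_hmat[of Q \<theta>] qform_le_max[OF _ hermitian_hmat, of Q \<theta> _ "ev Q \<theta>" "lift \<phi>"]
  by (auto simp: qform_weighted_mat nsq_lift)

text \<open>The two vertices may coincide, so each square separately is bounded by the whole sum and
  2ab \<le> a^2 + b^2 absorbs the factor 2.\<close>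

lemma mult_cmod_le_sum:
  assumes "w \<in> W" "w' \<in> W"
  shows "cmod (\<phi> w) * cmod (\<phi> w') \<le> wsq \<phi>"
proof -
  let ?n = "\<Sum>w\<in>W. (cmod (\<phi> w))\<^sup>2"
  have "(cmod (\<phi> w))\<^sup>2 \<le> ?n" "(cmod (\<phi> w'))\<^sup>2 \<le> ?n"
    using assms finite_W by (auto intro!: member_le_sum)
  moreover have "2 * (cmod (\<phi> w) * cmod (\<phi> w')) \<le> (cmod (\<phi> w))\<^sup>2 + (cmod (\<phi> w'))\<^sup>2"
    using sum_squares_bound[of "cmod (\<phi> w)" "cmod (\<phi> w')"] by (simp add: mult.assoc)
  ultimately show ?thesis by linarith
qed

text \<open>Changing the phases changes the form by at most this sum times the squared norm, and
  \<open>ev_shift\<close> passes that on to each eigenvalue. Continuity of the eigenvalues follows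
  from it alone.\<close>

lemma ev_lipschitz:
  assumes "i < \<nu>"
  shows "\<bar>ev Q \<theta> i - ev Q \<theta>' i\<bar> \<le> (\<Sum>X\<in>F. cmod (chis \<theta> X - chis \<theta>' X))"
proof -
  have le: "ev Q \<theta> i \<le> ev Q \<theta>' i + (\<Sum>X\<in>F. cmod (chis \<theta> X - chis \<theta>' X))" for \<theta> \<theta>'
  proof (rule ev_shift[OF assms])
    fix \<phi> :: "real ^ 'd \<Rightarrow> complex"
    let ?n = "\<Sum>w\<in>W. (cmod (\<phi> w))\<^sup>2"
    have "Re (hop \<theta>' \<phi> X) - Re (hop \<theta> \<phi> X)
        \<le> cmod (chis \<theta> X - chis \<theta>' X) * ?n" if "X \<in> F" for X
    proof -
      have "Re (hop \<theta>' \<phi> X) - Re (hop \<theta> \<phi> X)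
          = Re (cnj (\<phi> (fsrc X)) * (chis \<theta>' X - chis \<theta> X) * \<phi> (ftgt X))"
        by (simp add: algebra_simps)
      also have "\<dots> \<le> cmod (cnj (\<phi> (fsrc X)) * (chis \<theta>' X - chis \<theta> X) * \<phi> (ftgt X))"
        by (rule complex_Re_le_cmod)
      also have "\<dots> = cmod (chis \<theta> X - chis \<theta>' X) * (cmod (\<phi> (fsrc X)) * cmod (\<phi> (ftgt X)))"
        by (simp add: norm_mult norm_minus_commute)
      also have "\<dots> \<le> cmod (chis \<theta> X - chis \<theta>' X) * ?n"
        using that by (intro mult_left_mono mult_cmod_le_sum fsrc_in_W ftgt_in_W) auto
      finally show ?thesis .
    qed
    then have "(\<Sum>X\<in>F. Re (hop \<theta>' \<phi> X) - Re (hop \<theta> \<phi> X))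
        \<le> (\<Sum>X\<in>F. cmod (chis \<theta> X - chis \<theta>' X) * ?n)"
      by (rule sum_mono)
    then show "hform Q \<theta> \<phi> \<le> hform Q \<theta>' \<phi> + (\<Sum>X\<in>F. cmod (chis \<theta> X - chis \<theta>' X)) * ?n"
      unfolding weighted_form_def sum_subtractf sum_distrib_right by linarith
  qed
  have "(\<Sum>X\<in>F. cmod (chis \<theta>' X - chis \<theta> X)) = (\<Sum>X\<in>F. cmod (chis \<theta> X - chis \<theta>' X))"
    by (simp add: norm_minus_commute)
  with le[of \<theta> \<theta>'] le[of \<theta>' \<theta>] show ?thesis by linarith
qed

lemma ev_continuous: "i < \<nu> \<Longrightarrow> continuous_on UNIV (\<lambda>\<theta>. ev Q \<theta> i)"
proof (simp add: continuous_on_def, intro allI)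
  fix \<theta>0 assume i: "i < \<nu>"
  have chi: "((\<lambda>\<theta>. chis \<theta> X) \<longlongrightarrow> chis \<theta>0 X) (at \<theta>0)" for X
    using chi_continuous[of "idx X"] by (simp add: continuous_on_def)
  have "((\<lambda>\<theta>. \<Sum>X\<in>F. cmod (chis \<theta> X - chis \<theta>0 X)) \<longlongrightarrow> (\<Sum>X\<in>F. cmod (chis \<theta>0 X - chis \<theta>0 X))) (at \<theta>0)"
    by (intro tendsto_intros chi)
  then have "((\<lambda>\<theta>. \<Sum>X\<in>F. cmod (chis \<theta> X - chis \<theta>0 X)) \<longlongrightarrow> 0) (at \<theta>0)" by simp
  then show "((\<lambda>\<theta>. ev Q \<theta> i) \<longlongrightarrow> ev Q \<theta>0 i) (at \<theta>0)"
  proof (rule LIM_zero_cancel[OF Lim_null_comparison, rotated])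
    show "\<forall>\<^sub>F \<theta> in at \<theta>0. norm (ev Q \<theta> i - ev Q \<theta>0 i) \<le> (\<Sum>X\<in>F. cmod (chis \<theta> X - chis \<theta>0 X))"
      unfolding real_norm_def by (intro always_eventually allI ev_lipschitz[OF i])
  qed
qed

lemma floquet_matrix_period:
  "floquet_matrix \<Gamma> v Q (\<chi> s. \<theta> $ s + 2 * pi * real_of_int (n $ s)) = floquet_matrix \<Gamma> v Q \<theta>"
  unfolding floquet_matrix_def by (intro arg_cong[where f = "Matrix.mat \<nu> \<nu>"] ext)
    (simp add: floquet_laplacian_chi chi_period split: prod.split)

abbreviation "bmin Q \<equiv> band_min \<Gamma> v Q"
abbreviation "bmax Q \<equiv> band_max \<Gamma> v Q"

text \<open>As a continuous image of a connected space the band is an interval; periodicity replaces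
  the space by a compact box, so the ends are attained.\<close>

lemma band_eq_Icc:
  assumes "n \<in> {1..\<nu>}"
  shows "band \<Gamma> v Q n = {bmin Q n..bmax Q n}" "bmin Q n \<le> bmax Q n"
proof -
  obtain i where i: "n = Suc i" "i < \<nu>" using assms by (cases n) auto
  let ?box = "cbox 0 (\<chi> s. 2 * pi) :: (real ^ 'd) set"
  have cont: "continuous_on A (\<lambda>\<theta>. ev Q \<theta> i)" for A
    using ev_continuous[OF i(2)] continuous_on_subset by blast
  have "band \<Gamma> v Q n = (\<lambda>\<theta>. ev Q \<theta> i) ` ?box"
  proof (intro equalityI subsetI)
    fix y assume "y \<in> band \<Gamma> v Q n"
    then obtain \<theta> where \<theta>: "y = ev Q \<theta> i" by (auto simp: band_def i)
    \<comment> \<open>Subtracts the whole periods, which leaves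
      \<open>2 * pi * frac (\<theta> $ s / (2 * pi))\<close> in each coordinate.\<close>
    define n' :: "int ^ 'd" where "n' = (\<chi> s. - \<lfloor>\<theta> $ s / (2 * pi)\<rfloor>)"
    let ?\<theta> = "\<chi> s. \<theta> $ s + 2 * pi * real_of_int (n' $ s)"
    have "y = ev Q ?\<theta> i" by (simp only: \<theta> floquet_matrix_period)
    moreover have "?\<theta> \<in> ?box"
    proof -
      have "\<theta> $ s + 2 * pi * real_of_int (n' $ s) = 2 * pi * frac (\<theta> $ s / (2 * pi))" for s
        by (simp add: n'_def frac_def algebra_simps)
      then show ?thesis
        by (auto simp: mem_box_cart frac_lt_1 less_imp_le mult_left_le)
    qed
    ultimately show "y \<in> (\<lambda>\<theta>. ev Q \<theta> i) ` ?box" by blast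
  qed (auto simp: band_def i)
  then have "compact (band \<Gamma> v Q n)"
    using compact_continuous_image[OF cont compact_cbox] by simp
  moreover have "Topological_Spaces.connected (band \<Gamma> v Q n)"
    using connected_continuous_image[OF cont connected_UNIV] by (simp add: band_def i)
  ultimately obtain a b where ab: "band \<Gamma> v Q n = {a..b}"
    using connected_compact_interval_1[of "band \<Gamma> v Q n"] by (auto simp: box_real)
  have "band \<Gamma> v Q n \<noteq> {}" by (simp add: band_def)
  then have "a \<le> b" using ab by auto
  with ab show "band \<Gamma> v Q n = {bmin Q n..bmax Q n}" "bmin Q n \<le> bmax Q n"
    by (simp_all add: band_min_def band_max_def)
qed

abbreviation "bands Q N \<equiv> \<Union>n\<in>N. {bmin Q n..bmax Q n}"

lemma ev_in_band: "i < \<nu> \<Longrightarrow> bmin Q (Suc i) \<le> ev Q \<theta> i \<and> ev Q \<theta> i \<le> bmax Q (Suc i)"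
  using band_eq_Icc(1)[of "Suc i" Q] unfolding band_def by auto

lemma band_bounds:
  assumes "i < \<nu>" "\<And>\<theta>. a \<le> ev Q \<theta> i" "\<And>\<theta>. ev Q \<theta> i \<le> b"
  shows "a \<le> bmin Q (Suc i)" "bmax Q (Suc i) \<le> b"
proof -
  have "bmin Q (Suc i) \<in> band \<Gamma> v Q (Suc i)" "bmax Q (Suc i) \<in> band \<Gamma> v Q (Suc i)"
    using assms(1) band_eq_Icc[of "Suc i" Q] by auto
  then show "a \<le> bmin Q (Suc i)" "bmax Q (Suc i) \<le> b"
    using assms(2,3) unfolding band_def by auto
qed

lemma band_ends_mono:
  assumes "m \<le> n" "1 \<le> m" "n \<le> \<nu>"
  shows "bmin Q m \<le> bmin Q n" "bmax Q m \<le> bmax Q n"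
proof -
  obtain i j where ij: "m = Suc i" "n = Suc j" "i \<le> j" "j < \<nu>"
    using assms by (cases m; cases n) auto
  then have "i < \<nu>" by simp
  have le: "ev Q \<theta> i \<le> ev Q \<theta> j" for \<theta> using ij by (intro ev_mono)
  show "bmin Q m \<le> bmin Q n"
    unfolding ij(1,2)
  proof (rule band_bounds(1)[OF ij(4)])
    show "bmin Q (Suc i) \<le> ev Q \<theta> j" for \<theta>
      using ev_in_band[OF \<open>i < \<nu>\<close>, of Q \<theta>] le[of \<theta>] by linarith
    show "ev Q \<theta> j \<le> bmax Q (Suc j)" for \<theta> using ev_in_band[OF ij(4)] by blast
  qed
  show "bmax Q m \<le> bmax Q n"
    unfolding ij(1,2)
  proof (rule band_bounds(2)[OF \<open>i < \<nu>\<close>])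
    show "ev Q \<theta> i \<le> bmax Q (Suc j)" for \<theta>
      using ev_in_band[OF ij(4), of Q \<theta>] le[of \<theta>] by linarith
    show "bmin Q (Suc i) \<le> ev Q \<theta> i" for \<theta> using ev_in_band[OF \<open>i < \<nu>\<close>] by blast
  qed
qed

end

section \<open>Lengths of bands and gaps\<close>

lemma eq_cmod_if_Re_eq_cmod:
  assumes "Re z = cmod z" shows "z = of_real (cmod z)"
proof -
  have "(cmod z)\<^sup>2 = (Re z)\<^sup>2 + (Im z)\<^sup>2" by (rule cmod_power2)
  then have "Im z = 0" by (simp add: assms)
  then show ?thesis using assms by (simp add: complex_eq_iff)
qed

context floquet
begin

lemma bridges_iff: "X \<in> Br \<longleftrightarrow> X \<in> F \<and> idx X \<noteq> 0"
  by (simp add: bridges_def)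

lemma bridges_subset: "Br \<subseteq> F"
  by (auto simp: bridges_iff)

lemma sum_F_split: "(\<Sum>X\<in>F. g X) = (\<Sum>X\<in>F - Br. g X) + (\<Sum>X\<in>Br. g X)"
  by (rule sum.subset_diff[OF bridges_subset finite_F])

lemma frev_bridge: "X \<in> Br \<Longrightarrow> frev X \<in> Br"
  by (simp add: bridges_iff frev_props)

text \<open>Edges that are not bridges have index 0 and phase 1, so the bridges carry all the
  dependence on \<open>\<theta>\<close>.\<close>

lemma hform_split:
  "hform Q \<theta> \<phi> = (\<Sum>w\<in>W. hdiag Q w * (cmod (\<phi> w))\<^sup>2)
    - (\<Sum>X\<in>F - Br. Re (cnj (\<phi> (fsrc X)) * \<phi> (ftgt X)))
    - (\<Sum>X\<in>Br. Re (hop \<theta> \<phi> X))"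
proof -
  have "(\<Sum>X\<in>F - Br. Re (hop \<theta> \<phi> X)) =
      (\<Sum>X\<in>F - Br. Re (cnj (\<phi> (fsrc X)) * \<phi> (ftgt X)))"
    by (intro sum.cong refl) (simp add: bridges_iff chi_zero)
  then show ?thesis unfolding weighted_form_def by (simp only: sum_F_split diff_diff_eq)
qed

definition bridge_degree :: "real ^ 'd \<Rightarrow> real" where
  "bridge_degree w = real (card {X \<in> Br. fsrc X = w})"

lemma sum_by_source:
  fixes h :: "real ^ 'd \<Rightarrow> real"
  assumes "A \<subseteq> F"
  shows "(\<Sum>X\<in>A. h (fsrc X)) = (\<Sum>w\<in>W. real (card {X \<in> A. fsrc X = w}) * h w)"
proof -
  have "(\<Sum>w\<in>W. real (card {X \<in> A. fsrc X = w}) * h w) = (\<Sum>w\<in>W. \<Sum>X | X \<in> A \<and> fsrc X = w. h (fsrc X))"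
    by (intro sum.cong refl) simp
  also have "\<dots> = (\<Sum>X\<in>A. h (fsrc X))"
    using assms finite_F finite_W fsrc_in_W by (intro sum.group) (auto intro: finite_subset)
  finally show ?thesis ..
qed

lemma sum_bridge_degree: "(\<Sum>w\<in>W. bridge_degree w) = real (card Br)"
  using sum_by_source[OF bridges_subset, of "\<lambda>_. 1"] by (simp add: bridge_degree_def)

text \<open>|ab| \<le> (|a|^2 + |b|^2) / 2 produces a mean of sums over sources and over targets.
  Reversal permutes the bridges and exchanges their ends, so both sums are equal.\<close>

lemma bridge_form_bound:
  "\<bar>\<Sum>X\<in>Br. Re (hop \<theta> \<phi> X)\<bar> \<le>
    (\<Sum>w\<in>W. bridge_degree w * (cmod (\<phi> w))\<^sup>2)"
proof -
  have "\<bar>\<Sum>X\<in>Br. Re (hop \<theta> \<phi> X)\<bar> \<le>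
      (\<Sum>X\<in>Br. ((cmod (\<phi> (fsrc X)))\<^sup>2 + (cmod (\<phi> (ftgt X)))\<^sup>2) / 2)"
  proof (rule order.trans[OF sum_abs], rule sum_mono)
    fix X
    have "\<bar>Re (hop \<theta> \<phi> X)\<bar> \<le> cmod (hop \<theta> \<phi> X)"
      by (rule abs_Re_le_cmod)
    also have "\<dots> = cmod (\<phi> (fsrc X)) * cmod (\<phi> (ftgt X))" by (simp add: norm_mult cmod_chi)
    also have "\<dots> \<le> ((cmod (\<phi> (fsrc X)))\<^sup>2 + (cmod (\<phi> (ftgt X)))\<^sup>2) / 2"
      using sum_squares_bound[of "cmod (\<phi> (fsrc X))" "cmod (\<phi> (ftgt X))"] by (simp add: mult.assoc)
    finally show "\<bar>Re (hop \<theta> \<phi> X)\<bar> \<le>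
        ((cmod (\<phi> (fsrc X)))\<^sup>2 + (cmod (\<phi> (ftgt X)))\<^sup>2) / 2" .
  qed
  also have "\<dots> = ((\<Sum>X\<in>Br. (cmod (\<phi> (fsrc X)))\<^sup>2) + (\<Sum>X\<in>Br. (cmod (\<phi> (ftgt X)))\<^sup>2)) / 2"
    by (simp only: sum.distrib flip: sum_divide_distrib)
  also have "(\<Sum>X\<in>Br. (cmod (\<phi> (ftgt X)))\<^sup>2) = (\<Sum>X\<in>Br. (cmod (\<phi> (fsrc X)))\<^sup>2)"
    by (rule sum.reindex_bij_witness[of _ frev frev])
      (auto simp: frev_bridge frev_frev frev_props(2) bridges_subset[THEN subsetD])
  also have "((\<Sum>X\<in>Br. (cmod (\<phi> (fsrc X)))\<^sup>2) + (\<Sum>X\<in>Br. (cmod (\<phi> (fsrc X)))\<^sup>2)) / 2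
      = (\<Sum>w\<in>W. bridge_degree w * (cmod (\<phi> w))\<^sup>2)"
    using sum_by_source[OF bridges_subset, of "\<lambda>w. (cmod (\<phi> w))\<^sup>2"] by (simp add: bridge_degree_def)
  finally show ?thesis .
qed

lemma sum_1_nu: "(\<Sum>n=1..\<nu>. g n) = (\<Sum>i<\<nu>. g (Suc i))"
  by (rule sum.reindex_bij_witness[of _ Suc "\<lambda>n. n - 1"]) auto

text \<open>The bridges perturb the remaining graph by a form between \<open>- bridge_degree\<close> and
  \<open>bridge_degree\<close>, so that the bands lie between the eigenvalues of two constant matrices whose
  traces differ by \<open>2 \<beta>\<close>.\<close>

lemma sum_band_lengths_le:
  "(\<Sum>n=1..\<nu>. bmax Q n - bmin Q n) \<le> 2 * real (card Br)"
proof -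
  \<comment> \<open>Weight 0 deletes the bridges, so that neither comparison matrix depends on
    \<open>\<theta>\<close>.\<close>
  define c where "c = (\<lambda>X. if X \<in> Br then 0 else 1 :: complex)"
  have c: "weight c"
    unfolding weight_def
  proof
    fix X assume "X \<in> F"
    have "frev X \<in> Br \<longleftrightarrow> X \<in> Br" using frev_bridge frev_frev by metis
    then show "c (frev X) = cnj (c X)" by (simp add: c_def)
  qed
  let ?g = "\<lambda>s w. hdiag Q w + s * bridge_degree w"
  have form: "weighted_form (?g s) c \<phi> = (\<Sum>w\<in>W. hdiag Q w * (cmod (\<phi> w))\<^sup>2)
      + s * (\<Sum>w\<in>W. bridge_degree w * (cmod (\<phi> w))\<^sup>2)
      - (\<Sum>X\<in>F - Br. Re (cnj (\<phi> (fsrc X)) * \<phi> (ftgt X)))" for s \<phi>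
  proof -
    have "(\<Sum>X\<in>F. Re (cnj (\<phi> (fsrc X)) * c X * \<phi> (ftgt X))) =
        (\<Sum>X\<in>F - Br. Re (cnj (\<phi> (fsrc X)) * \<phi> (ftgt X)))"
      unfolding sum_F_split by (simp add: c_def)
    then show ?thesis
      unfolding weighted_form_def by (simp add: distrib_right sum.distrib sum_distrib_left mult.assoc)
  qed
  obtain u1 \<mu>1 where sys1: "eigensystem \<nu> (weighted_mat (?g 1) c) u1 \<mu>1"
    by (rule spectral_theorem[OF hermitian_weighted_mat[OF c]])
  obtain u2 \<mu>2 where sys2: "eigensystem \<nu> (weighted_mat (?g (-1)) c) u2 \<mu>2"
    by (rule spectral_theorem[OF hermitian_weighted_mat[OF c]])
  have upper: "ev Q \<theta> i \<le> \<mu>1 i" if "i < \<nu>" for \<theta> i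
  proof -
    obtain u where u: "eigensystem \<nu> (hmat Q \<theta>) u (ev Q \<theta>)" using eigensystem_hmat by blast
    have "ev Q \<theta> i \<le> \<mu>1 i + 0"
    proof (rule weighted_eigenvalue_shift[OF weight_chis c u sys1 that])
      show "hform Q \<theta> \<phi> \<le> weighted_form (?g 1) c \<phi> + 0 * wsq \<phi>" for \<phi>
        unfolding form hform_split using bridge_form_bound[of \<phi> \<theta>] by linarith
    qed
    then show ?thesis by simp
  qed
  have lower: "\<mu>2 i \<le> ev Q \<theta> i" if "i < \<nu>" for \<theta> i
  proof -
    obtain u where u: "eigensystem \<nu> (hmat Q \<theta>) u (ev Q \<theta>)" using eigensystem_hmat by blast
    have "\<mu>2 i \<le> ev Q \<theta> i + 0"
    proof (rule weighted_eigenvalue_shift[OF c weight_chis sys2 u that])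
      show "weighted_form (?g (-1)) c \<phi> \<le> hform Q \<theta> \<phi> + 0 * wsq \<phi>" for \<phi>
        unfolding form hform_split using bridge_form_bound[of \<phi> \<theta>] by linarith
    qed
    then show ?thesis by simp
  qed
  have "(\<Sum>n=1..\<nu>. bmax Q n - bmin Q n) \<le> (\<Sum>i<\<nu>. \<mu>1 i - \<mu>2 i)"
    unfolding sum_1_nu
  proof (rule sum_mono)
    fix i assume "i \<in> {..<\<nu>}"
    then have "i < \<nu>" by simp
    then show "bmax Q (Suc i) - bmin Q (Suc i) \<le> \<mu>1 i - \<mu>2 i"
      using band_bounds[OF \<open>i < \<nu>\<close> lower[OF \<open>i < \<nu>\<close>] upper[OF \<open>i < \<nu>\<close>]] by linarith
  qed
  \<comment> \<open>Both matrices have the same edge weights, so their loop terms cancel in the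
    difference of the traces.\<close>
  also have "\<dots> = (\<Sum>w\<in>W. ?g 1 w) - (\<Sum>w\<in>W. ?g (-1) w)"
    unfolding sum_subtractf trace_eq_sum_eigenvalues[OF sys1] trace_eq_sum_eigenvalues[OF sys2]
      trace_weighted_mat by simp
  also have "\<dots> = (\<Sum>w\<in>W. 2 * bridge_degree w)"
    unfolding sum_subtractf[symmetric] by (intro sum.cong refl) simp
  also have "\<dots> = 2 * (\<Sum>w\<in>W. bridge_degree w)" by (rule sum_distrib_left[symmetric])
  finally show ?thesis by (simp add: sum_bridge_degree)
qed

lemma mv_hmat:
  assumes "j < \<nu>"
  shows "mv \<nu> (hmat Q \<theta>) (lift \<phi>) j = floquet_op Q \<theta> \<phi> (v (Suc j))"
  using mv_weighted_mat[OF assms, of "hdiag Q" "chis \<theta>" \<phi>] by (simp add: floquet_op_def)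

section \<open>Non-degeneracy of the first band\<close>

lemma eigenfunction_exists:
  assumes "i < \<nu>"
  obtains \<phi> where "wsq \<phi> = 1" "\<forall>w\<in>W. floquet_op Q \<theta> \<phi> w = of_real (ev Q \<theta> i) * \<phi> w"
    "hform Q \<theta> \<phi> = ev Q \<theta> i"
proof -
  obtain u where u: "eigensystem \<nu> (hmat Q \<theta>) u (ev Q \<theta>)" using eigensystem_hmat by blast
  obtain \<phi> where \<phi>: "\<forall>j<\<nu>. u i j = lift \<phi> j" using lift_surj by blast
  have nsq: "nsq \<nu> (lift \<phi>) = 1"
  proof -
    have "nsq \<nu> (lift \<phi>) = nsq \<nu> (u i)" using \<phi> by (intro nsq_cong) simp
    also have "of_real (nsq \<nu> (u i)) = 1"
      using eigensystem_orthonormal[OF u assms assms] by (simp add: hip_self)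
    then have "nsq \<nu> (u i) = 1" by simp
    finally show ?thesis .
  qed
  have mv: "mv \<nu> (hmat Q \<theta>) (lift \<phi>) j = of_real (ev Q \<theta> i) * lift \<phi> j" if "j < \<nu>" for j
  proof -
    have "mv \<nu> (hmat Q \<theta>) (lift \<phi>) j = mv \<nu> (hmat Q \<theta>) (u i) j" using \<phi> by (intro mv_cong) simp
    then show ?thesis using eigensystem_eigen[OF u assms that] \<phi> that by simp
  qed
  show ?thesis
  proof (rule that[of \<phi>])
    show "wsq \<phi> = 1" using nsq by (simp add: nsq_lift)
    show "\<forall>w\<in>W. floquet_op Q \<theta> \<phi> w = of_real (ev Q \<theta> i) * \<phi> w"
    proof
      fix w assume "w \<in> W"
      obtain j where "j < \<nu>" "w = v (Suc j)" using enum_Suc \<open>w \<in> W\<close> by (auto simp: bij_betw_def)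
      then show "floquet_op Q \<theta> \<phi> w = of_real (ev Q \<theta> i) * \<phi> w"
        using mv[of j] by (simp add: mv_hmat lift_def)
    qed
    have "qform \<nu> (hmat Q \<theta>) (lift \<phi>) = Re (hip \<nu> (lift \<phi>) (\<lambda>j. of_real (ev Q \<theta> i) * lift \<phi> j))"
      unfolding qform_def by (intro arg_cong[where f = Re] hip_cong) (auto simp: mv)
    then show "hform Q \<theta> \<phi> = ev Q \<theta> i"
      by (simp add: qform_weighted_mat hip_scale_right hip_self nsq)
  qed
qed

text \<open>If the first band is a point, the modulus of a ground state of \<open>H(\<theta>)\<close> is a ground state of
  \<open>H(0)\<close>, hence positive by connectedness, and there is no cancellation in the form of \<open>H(\<theta>)\<close>.\<close>

lemma degenerate_first_band_phases:
  assumes "\<And>\<theta>. ev Q \<theta> 0 = ev Q 0 0"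
  obtains \<phi> where "\<forall>w\<in>W. \<phi> w \<noteq> 0"
    "\<forall>X\<in>F. hop \<theta> \<phi> X = of_real (cmod (\<phi> (fsrc X)) * cmod (\<phi> (ftgt X)))"
proof -
  obtain \<phi> where \<phi>: "wsq \<phi> = 1" "hform Q \<theta> \<phi> = ev Q \<theta> 0"
    by (rule eigenfunction_exists[OF nu_pos])
  define \<psi> where "\<psi> = (\<lambda>w. complex_of_real (cmod (\<phi> w)))"
  have \<psi>1: "wsq \<psi> = 1" using \<phi>(1) by (simp add: \<psi>_def)
  let ?t = "\<lambda>X. Re (hop \<theta> \<phi> X)"
  let ?p = "\<lambda>X. cmod (\<phi> (fsrc X)) * cmod (\<phi> (ftgt X))"
  have norm: "cmod (hop \<theta> \<phi> X) = ?p X" for X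
    by (simp add: norm_mult cmod_chi)
  have tp: "?t X \<le> ?p X" for X
    using complex_Re_le_cmod[of "hop \<theta> \<phi> X"] unfolding norm .
  \<comment> \<open>The diagonal terms see only moduli, and each edge term is replaced by its
    modulus; passing from \<open>\<phi>\<close> to \<open>\<psi>\<close> and phase 0 cannot raise
    the form (diamagnetic inequality).\<close>
  have form_diff: "hform Q \<theta> \<phi> - hform Q 0 \<psi> = (\<Sum>X\<in>F. ?p X - ?t X)"
    unfolding weighted_form_def sum_subtractf by (simp add: \<psi>_def chi_zero)
  \<comment> \<open>Squeeze: \<open>ev Q 0 0 \<le> hform Q 0 \<psi> \<le> hform Q \<theta> \<phi> =
    ev Q \<theta> 0\<close>. The outer terms agree, which forces equality edge by edge.\<close>
  have "ev Q 0 0 \<le> hform Q 0 \<psi>" using ev_min_le[of Q 0 \<psi>] \<psi>1 by simp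
  moreover have "0 \<le> (\<Sum>X\<in>F. ?p X - ?t X)" using tp by (intro sum_nonneg) simp
  ultimately have ground: "hform Q 0 \<psi> = ev Q 0 0" and zero: "(\<Sum>X\<in>F. ?p X - ?t X) = 0"
    using form_diff \<phi>(2) assms[of \<theta>] by linarith+
  have "?p X - ?t X = 0" if "X \<in> F" for X
    using zero that tp finite_F by (subst (asm) sum_nonneg_eq_0_iff) auto
  then have eq: "hop \<theta> \<phi> X = of_real (?p X)" if "X \<in> F" for X
    using that norm[of X] eq_cmod_if_Re_eq_cmod[of "hop \<theta> \<phi> X"] by simp
  have op: "floquet_op Q 0 \<psi> w = of_real (ev Q 0 0) * \<psi> w" if w: "w \<in> W" for w
  proof -
    obtain j where j: "j < \<nu>" "w = v (Suc j)" using enum_Suc w by (auto simp: bij_betw_def)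
    obtain u where u: "eigensystem \<nu> (hmat Q 0) u (ev Q 0)" using eigensystem_hmat by blast
    have "qform \<nu> (hmat Q 0) (lift \<psi>) = ev Q 0 0 * nsq \<nu> (lift \<psi>)"
      using ground \<psi>1 by (simp add: qform_weighted_mat nsq_lift)
    then have "mv \<nu> (hmat Q 0) (lift \<psi>) j = of_real (ev Q 0 0) * lift \<psi> j"
      by (rule ground_state_eigenvector[OF u hermitian_hmat _ j(1)])
    then show ?thesis using j by (simp add: mv_hmat lift_def)
  qed
  have "\<phi> w \<noteq> 0" if w: "w \<in> W" for w
  proof
    assume "\<phi> w = 0"
    have "W \<subseteq> {w. w \<in> W \<longrightarrow> \<psi> w = 0}"
    proof (rule fund_connected_closed[OF w])
      show "w \<in> {w. w \<in> W \<longrightarrow> \<psi> w = 0}" using \<open>\<phi> w = 0\<close> by (simp add: \<psi>_def)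
      fix X assume X: "X \<in> F" "fsrc X \<in> {w. w \<in> W \<longrightarrow> \<psi> w = 0}"
      then have z: "\<psi> (fsrc X) = 0" "fsrc X \<in> W" using fsrc_in_W by auto
      \<comment> \<open>At a zero of \<open>\<psi>\<close> the eigenvalue equation leaves a sum of
        nonnegative terms equal to 0, so the zero spreads to all neighbours.\<close>
      have "(\<Sum>Y | Y \<in> F \<and> fsrc Y = fsrc X. \<psi> (ftgt Y)) = 0"
        using op[OF z(2)] z(1) by (simp add: floquet_op_def chi_zero)
      then have "complex_of_real (\<Sum>Y | Y \<in> F \<and> fsrc Y = fsrc X. cmod (\<phi> (ftgt Y))) = 0"
        by (simp add: \<psi>_def)
      then have "(\<Sum>Y | Y \<in> F \<and> fsrc Y = fsrc X. cmod (\<phi> (ftgt Y))) = 0"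
        by (simp only: of_real_eq_0_iff)
      then have "cmod (\<phi> (ftgt X)) = 0"
        using finite_F X(1) by (subst (asm) sum_nonneg_eq_0_iff) auto
      then show "ftgt X \<in> {w. w \<in> W \<longrightarrow> \<psi> w = 0}" by (simp add: \<psi>_def)
    qed
    then have "wsq \<psi> = 0" by (intro sum.neutral) auto
    with \<psi>1 show False by simp
  qed
  then show ?thesis using eq by (intro that[of \<phi>]) auto
qed

lemma first_band_nondegenerate:
  assumes "j \<in> {1..\<nu>}" "k \<in> {1..\<nu>}"
    and nonconst: "\<not> (\<lambda>\<theta>. cmod (floquet_laplacian \<Gamma> v j k \<theta>)) constant_on UNIV"
  shows "bmin Q 1 < bmax Q 1"
proof (rule ccontr)
  assume "\<not> bmin Q 1 < bmax Q 1"
  then have const: "ev Q \<theta> 0 = ev Q 0 0" for \<theta>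
    using ev_in_band[OF nu_pos, of Q \<theta>] ev_in_band[OF nu_pos, of Q 0] by simp
  obtain j' k' where jk: "j = Suc j'" "k = Suc k'" "j' < \<nu>" "k' < \<nu>"
    using assms(1,2) by (cases j; cases k) auto
  let ?A = "{X. X \<in> F \<and> fsrc X = v j \<and> ftgt X = v k}"
  have "cmod (floquet_laplacian \<Gamma> v j k \<theta>) = \<bar>(if j = k then real (deg \<Gamma> (v j)) else 0) - real (card ?A)\<bar>" for \<theta>
  proof -
    obtain \<phi> where \<phi>: "\<forall>w\<in>W. \<phi> w \<noteq> 0"
      "\<forall>X\<in>F. hop \<theta> \<phi> X = of_real (cmod (\<phi> (fsrc X)) * cmod (\<phi> (ftgt X)))"
      by (rule degenerate_first_band_phases[of Q \<theta>, OF const])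
    \<comment> \<open>The identity for \<open>hop\<close> determines the phase of an edge from its
      end points, so all parallel edges from \<open>v j\<close> to \<open>v k\<close> share this
      phase of modulus 1.\<close>
    define a where "a = complex_of_real (cmod (\<phi> (v j)) * cmod (\<phi> (v k))) / (cnj (\<phi> (v j)) * \<phi> (v k))"
    have nz: "\<phi> (v j) \<noteq> 0" "\<phi> (v k) \<noteq> 0" using \<phi>(1) v_in_W jk by auto
    have "chis \<theta> X = a" if "X \<in> ?A" for X
      using bspec[OF \<phi>(2), of X] that nz by (simp add: a_def field_simps)
    then have sum: "(\<Sum>X\<in>?A. chis \<theta> X) = of_nat (card ?A) * a" by simp
    have fl: "floquet_laplacian \<Gamma> v j k \<theta> = (if j = k then of_nat (deg \<Gamma> (v j)) else 0) - of_nat (card ?A) * a"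
      unfolding jk(1,2) floquet_laplacian_chi using sum unfolding jk(1,2) by simp
    have cm: "cmod a = 1" using nz by (simp add: a_def norm_divide norm_mult)
    show ?thesis
    proof (cases "j = k")
      case True
      \<comment> \<open>On the diagonal the degree is present too; with \<open>a = 1\<close> its
        difference from the edge sum is a real number independent of
        \<open>\<theta>\<close>.\<close>
      then have "a = 1" using nz by (simp add: a_def complex_norm_square[symmetric] power2_eq_square mult.commute flip: of_real_mult)
      then have "floquet_laplacian \<Gamma> v j k \<theta> = of_real (real (deg \<Gamma> (v j)) - real (card ?A))"
        using fl True by simp
      then show ?thesis using True by (simp only: norm_of_real) simp
    next
      case False
      then show ?thesis using fl cm by (simp add: norm_mult)
    qed
  qed
  then have "(\<lambda>\<theta>. cmod (floquet_laplacian \<Gamma> v j k \<theta>)) constant_on UNIV"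
    unfolding constant_on_def by blast
  with nonconst show False by contradiction
qed

section \<open>Test functions and the width of the spectrum\<close>

lemma sum_deg: "(\<Sum>w\<in>W. real (deg \<Gamma> w)) = real (card F)"
  using sum_by_source[OF order_refl, of "\<lambda>_. 1"] by (simp add: deg_W)

lemma hform_one: "hform Q 0 (\<lambda>_. 1) = (\<Sum>w\<in>W. Q w)"
  by (simp add: weighted_form_def chi_zero sum.distrib sum_deg)

text \<open>The form of a point mass is degree plus potential minus the number of oriented loops at
  \<open>w\<close>, and that number lies between 0 and the degree.\<close>

lemma hform_delta:
  assumes w: "w \<in> W"
  shows "Q w \<le> hform Q 0 (\<lambda>u. if u = w then 1 else 0)"
    "hform Q 0 (\<lambda>u. if u = w then 1 else 0) \<le> real (deg \<Gamma> w) + Q w"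
proof -
  let ?L = "{X \<in> F. fsrc X = w \<and> ftgt X = w}"
  have "(\<Sum>u\<in>W. hdiag Q u * (cmod (if u = w then 1 else 0))\<^sup>2) = (\<Sum>u\<in>W. if u = w then hdiag Q w else 0)"
    by (intro sum.cong) auto
  also have "\<dots> = hdiag Q w" using w finite_W by simp
  moreover have "(\<Sum>X\<in>F. Re (cnj (if fsrc X = w then 1 else 0) * chis 0 X * (if ftgt X = w then 1 else 0)))
      = (\<Sum>X\<in>F. if fsrc X = w \<and> ftgt X = w then 1 else 0)"
    by (intro sum.cong) (auto simp: chi_zero)
  moreover have "(\<Sum>X\<in>F. if fsrc X = w \<and> ftgt X = w then 1 else 0) = real (card ?L)"
    using finite_F by (simp add: sum.If_cases Int_def)
  ultimately have "hform Q 0 (\<lambda>u. if u = w then 1 else 0) = hdiag Q w - real (card ?L)"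
    by (simp add: weighted_form_def)
  moreover have "card ?L \<le> deg \<Gamma> w"
    unfolding deg_W[OF w] using finite_F by (intro card_mono) auto
  ultimately show "Q w \<le> hform Q 0 (\<lambda>u. if u = w then 1 else 0)"
    "hform Q 0 (\<lambda>u. if u = w then 1 else 0) \<le> real (deg \<Gamma> w) + Q w" by simp_all
qed

lemma deg_le_max_deg: "w \<in> W \<Longrightarrow> real (deg \<Gamma> w) \<le> max_deg \<Gamma>"
  unfolding max_deg_def using deg_bounded W_subset_V by (intro cSUP_upper) (auto intro: bdd_aboveI2)

text \<open>For the first term of the maximum, \<open>Q \<ge> q0\<close> puts the top at least at
  the top for zero potential plus \<open>q0\<close>, and the constant function puts the bottom at
  most at \<open>q1\<close>. For the second, point masses at a maximum and a minimum of
  \<open>Q\<close> give width at least \<open>q1 - q0 - max_deg \<Gamma>\<close>, which suffices as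
  degrees are nonnegative.\<close>

lemma spectrum_width_ge_C0: "C0 \<Gamma> v Q \<le> bmax Q \<nu> - bmin Q 1"
proof -
  define q1 where "q1 = Max ((\<lambda>n. Q (v n)) ` {1..\<nu>})"
  define q0 where "q0 = Min ((\<lambda>n. Q (v n)) ` {1..\<nu>})"
  have "v ` {1..\<nu>} = W" using enum by (simp add: bij_betw_def)
  then have im: "(\<lambda>n. Q (v n)) ` {1..\<nu>} = Q ` W" by (metis image_image)
  have q: "q0 \<le> Q w" "Q w \<le> q1" if "w \<in> W" for w
    unfolding q0_def q1_def im using that finite_W by auto
  have "q0 \<in> Q ` W" "q1 \<in> Q ` W"
    unfolding q0_def q1_def im using finite_W W_nonempty by simp_all
  then obtain w0 w1 where w0: "w0 \<in> W" "Q w0 = q0" and w1: "w1 \<in> W" "Q w1 = q1" by auto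
  have last: "Suc (\<nu> - 1) = \<nu>" "\<nu> - 1 < \<nu>" using nu_pos by auto
  have first: "bmin Q 1 \<le> ev Q 0 0" using ev_in_band[OF nu_pos, of Q 0] by simp
  have top: "ev Q \<theta> (\<nu> - 1) \<le> bmax Q \<nu>" for \<theta> using ev_in_band[OF last(2), of Q \<theta>] last(1) by simp
  have delta1: "(\<Sum>u\<in>W. (cmod (if u = w then 1 else 0))\<^sup>2) = 1" if "w \<in> W" for w
  proof -
    have "(\<Sum>u\<in>W. (cmod (if u = w then 1 else 0))\<^sup>2) = (\<Sum>u\<in>W. if u = w then 1 else 0)"
      by (intro sum.cong) auto
    then show ?thesis using that finite_W by simp
  qed
  have "ev Q 0 0 * real \<nu> \<le> q1 * real \<nu>"
  proof -
    have "ev Q 0 0 * real (card W) \<le> (\<Sum>w\<in>W. Q w)"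
      using ev_min_le[of Q 0 "\<lambda>_. 1"] by (simp add: hform_one)
    also have "\<dots> \<le> q1 * real (card W)" using sum_bounded_above[of W Q q1] q(2) by (simp add: mult.commute)
    finally show ?thesis by (simp add: num_verts_def)
  qed
  then have 1: "ev Q 0 0 \<le> q1" using nu_pos by simp
  have 2: "bmax (\<lambda>_. 0) \<nu> \<le> bmax Q \<nu> - q0"
  proof -
    have "bmax (\<lambda>_. 0) (Suc (\<nu> - 1)) \<le> bmax Q \<nu> - q0"
    proof (rule band_bounds(2)[OF last(2)])
      show "bmin (\<lambda>_. 0) (Suc (\<nu> - 1)) \<le> ev (\<lambda>_. 0) \<theta> (\<nu> - 1)" for \<theta>
        using ev_in_band[OF last(2)] by blast
      fix \<theta>
      have "ev (\<lambda>_. 0) \<theta> (\<nu> - 1) \<le> ev Q \<theta> (\<nu> - 1) + - q0"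
      proof (rule ev_shift[OF last(2)])
        fix \<phi> :: "real ^ 'd \<Rightarrow> complex"
        have "(\<Sum>w\<in>W. q0 * (cmod (\<phi> w))\<^sup>2) \<le> (\<Sum>w\<in>W. Q w * (cmod (\<phi> w))\<^sup>2)"
          using q(1) by (intro sum_mono mult_right_mono) auto
        moreover have "hform Q \<theta> \<phi> = hform (\<lambda>_. 0) \<theta> \<phi> + (\<Sum>w\<in>W. Q w * (cmod (\<phi> w))\<^sup>2)"
          by (simp add: weighted_form_def distrib_right sum.distrib)
        ultimately show "hform (\<lambda>_. 0) \<theta> \<phi> \<le> hform Q \<theta> \<phi> + - q0 * wsq \<phi>"
          unfolding sum_distrib_left[symmetric] by simp
      qed
      then show "ev (\<lambda>_. 0) \<theta> (\<nu> - 1) \<le> bmax Q \<nu> - q0" using top[of \<theta>] by linarith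
    qed
    then show ?thesis by (simp only: last(1))
  qed
  have 3: "q1 \<le> ev Q 0 (\<nu> - 1)"
    using ev_max_ge[of Q 0 "\<lambda>u. if u = w1 then 1 else 0"] hform_delta(1)[OF w1(1), of Q] w1 delta1[OF w1(1)] by simp
  have 4: "ev Q 0 0 \<le> max_deg \<Gamma> + q0"
    using ev_min_le[of Q 0 "\<lambda>u. if u = w0 then 1 else 0"] hform_delta(2)[OF w0(1), of Q] w0
      delta1[OF w0(1)] deg_le_max_deg[OF w0(1)] by simp
  have "0 \<le> max_deg \<Gamma>" using deg_le_max_deg[OF w0(1)] by (meson of_nat_0_le_iff order_trans)
  then show ?thesis
    using 1 2 3 4 first top[of 0] unfolding C0_def potential_range_def q1_def[symmetric] q0_def[symmetric]
    by auto
qed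

section \<open>Sums of gap lengths\<close>

lemma gaps_between_eq:
  assumes "N \<subseteq> {1..\<nu>}"
  shows "gaps_between \<Gamma> v Q N = interval_gaps N (bmin Q) (bmax Q)"
proof -
  have "band \<Gamma> v Q l = {bmin Q l..bmax Q l}" if "l \<in> N" for l
    using assms that by (intro band_eq_Icc) auto
  then show ?thesis unfolding gaps_between_def interval_gaps_def by (simp cong: ball_cong)
qed

lemma sum_gaps:
  assumes N: "N \<subseteq> {1..\<nu>}" and p: "p \<in> N" "bmin Q p = bmin Q 1"
    and q: "q \<in> N" "bmax Q q = bmax Q \<nu>"
    and \<gamma>: "bij_betw \<gamma> {1..s} (gaps_between \<Gamma> v Q N)"
  shows "(\<Sum>n=1..s. measure lborel (\<gamma> n)) = bmax Q \<nu> - bmin Q 1 -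
    measure lborel (bands Q N)"
proof -
  have "(\<Sum>n=1..s. measure lborel (\<gamma> n)) = (\<Sum>g\<in>gaps_between \<Gamma> v Q N. measure lborel g)"
    by (rule sum.reindex_bij_betw[OF \<gamma>])
  also have "\<dots> = bmax Q q - bmin Q p -
      measure lborel (bands Q N)"
    unfolding gaps_between_eq[OF N]
  proof (rule sum_gap_lengths)
    show "finite N" using N finite_subset by blast
    show "bmin Q n \<le> bmax Q n" if "n \<in> N" for n
      using N that by (intro band_eq_Icc(2)) auto
    show "bmin Q p \<le> bmin Q n" if "n \<in> N" for n
      unfolding p(2) using N that by (intro band_ends_mono(1)) auto
    show "bmax Q n \<le> bmax Q q" if "n \<in> N" for n
      unfolding q(2) using N that by (intro band_ends_mono(2)) auto
  qed (use p q in auto)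
  finally show ?thesis by (simp add: p q)
qed

lemma measure_band: "n \<in> {1..\<nu>} \<Longrightarrow> measure lborel (band \<Gamma> v Q n) = bmax Q n - bmin Q n"
  using band_eq_Icc[of n Q] by simp

abbreviation "gap_enum \<gamma> s Q \<equiv> bij_betw \<gamma> {1..s :: nat} (all_gaps \<Gamma> v Q) \<or>
  (nondegenerate_ends \<Gamma> v Q \<and> bij_betw \<gamma> {1..s} (strict_gaps \<Gamma> v Q))"

text \<open>Both readings of gaps lead to one formula, with \<open>N\<close> all bands or only the
  non-degenerate ones. Members of \<open>N\<close> must reach both ends of the spectrum; in the
  second case \<open>nondegenerate_ends\<close> provides this.\<close>

lemma gap_families:
  assumes "gap_enum \<gamma> s Q"
  obtains N where "nondegenerate \<Gamma> v Q \<subseteq> N" "N \<subseteq> {1..\<nu>}"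
    "(\<Sum>n=1..s. measure lborel (\<gamma> n)) = bmax Q \<nu> - bmin Q 1 -
      measure lborel (bands Q N)"
  using assms
proof
  assume \<gamma>: "bij_betw \<gamma> {1..s} (all_gaps \<Gamma> v Q)"
  show ?thesis
  proof (rule that[of "{1..\<nu>}"])
    show "(\<Sum>n=1..s. measure lborel (\<gamma> n)) = bmax Q \<nu> - bmin Q 1 -
        measure lborel (bands Q {1..\<nu>})"
      using nu_pos \<gamma> by (intro sum_gaps[of _ 1 _ \<nu>]) (auto simp: all_gaps_def)
  qed (auto simp: nondegenerate_def)
next
  assume "nondegenerate_ends \<Gamma> v Q \<and> bij_betw \<gamma> {1..s} (strict_gaps \<Gamma> v Q)"
  then obtain p q where pq: "p \<in> nondegenerate \<Gamma> v Q" "bmin Q p = bmin Q 1"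
    "q \<in> nondegenerate \<Gamma> v Q" "bmax Q q = bmax Q \<nu>"
    and \<gamma>: "bij_betw \<gamma> {1..s} (gaps_between \<Gamma> v Q (nondegenerate \<Gamma> v Q))"
    unfolding nondegenerate_ends_def strict_gaps_def by blast
  have sub: "nondegenerate \<Gamma> v Q \<subseteq> {1..\<nu>}" by (auto simp: nondegenerate_def)
  show ?thesis by (rule that[OF order_refl sub sum_gaps[OF sub pq \<gamma>]])
qed

lemma sum_lengths_nondegenerate:
  assumes "nondegenerate \<Gamma> v Q \<subseteq> N" "N \<subseteq> {1..\<nu>}"
  shows "(\<Sum>n\<in>N. bmax Q n - bmin Q n) = (\<Sum>n=1..\<nu>. bmax Q n - bmin Q n)"
proof (rule sum.mono_neutral_left)
  show "\<forall>n\<in>{1..\<nu>} - N. bmax Q n - bmin Q n = 0"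
  proof
    fix n assume n: "n \<in> {1..\<nu>} - N"
    then have "\<not> bmin Q n < bmax Q n" using assms(1) by (auto simp: nondegenerate_def)
    then show "bmax Q n - bmin Q n = 0" using band_eq_Icc(2)[of n Q] n by simp
  qed
qed (use assms in auto)

text \<open>Overlaps of bands only enlarge the gaps: the union has measure at most the sum of the
  lengths, and bands left out of \<open>N\<close> have length 0.\<close>

lemma gap_sum_ge:
  assumes "gap_enum \<gamma> s Q"
  shows "(\<Sum>n=1..s. measure lborel (\<gamma> n)) \<ge>
    bmax Q \<nu> - bmin Q 1 - 2 * real (card Br)"
proof -
  obtain N where N: "nondegenerate \<Gamma> v Q \<subseteq> N" "N \<subseteq> {1..\<nu>}"
    "(\<Sum>n=1..s. measure lborel (\<gamma> n)) = bmax Q \<nu> - bmin Q 1 -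
      measure lborel (bands Q N)"
    by (rule gap_families[OF assms])
  have "measure lborel (bands Q N) \<le>
      (\<Sum>n\<in>N. bmax Q n - bmin Q n)"
    using N(2) finite_subset[OF N(2)] band_eq_Icc(2) by (intro measure_UN_Icc_le) auto
  also have "\<dots> \<le> 2 * real (card Br)"
    unfolding sum_lengths_nondegenerate[OF N(1,2)] by (rule sum_band_lengths_le)
  finally show ?thesis using N(3) by linarith
qed

section \<open>Precise loop graphs with all bridges at one vertex\<close>

context
  fixes \<theta>\<^sub>0 :: "real ^ 'd" and w\<^sub>0 :: "real ^ 'd"
  assumes w0: "w\<^sub>0 \<in> W" and loops: "\<And>X. X \<in> Br \<Longrightarrow> fsrc X = w\<^sub>0 \<and> ftgt X = w\<^sub>0"
    and precise: "\<And>X. X \<in> Br \<Longrightarrow> cos (phase (idx X) \<theta>\<^sub>0) = -1"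
begin

text \<open>With source and target equal, the two values of \<open>\<phi>\<close> combine to a
  squared modulus, so \<open>\<theta>\<close> enters through one scalar, the sum of the
  cosines.\<close>

lemma hform_loop:
  "hform Q \<theta> \<phi> = (\<Sum>w\<in>W. hdiag Q w * (cmod (\<phi> w))\<^sup>2)
    - (\<Sum>X\<in>F - Br. Re (cnj (\<phi> (fsrc X)) * \<phi> (ftgt X)))
    - (\<Sum>X\<in>Br. cos (phase (idx X) \<theta>)) * (cmod (\<phi> w\<^sub>0))\<^sup>2"
proof -
  have "Re (hop \<theta> \<phi> X) = cos (phase (idx X) \<theta>) * (cmod (\<phi> w\<^sub>0))\<^sup>2"
    if "X \<in> Br" for X
  proof -
    have "hop \<theta> \<phi> X = of_real ((cmod (\<phi> w\<^sub>0))\<^sup>2) * chis \<theta> X"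
      using loops[OF that] by (simp add: complex_norm_square del: of_real_power)
    then have "Re (hop \<theta> \<phi> X) = Re (of_real ((cmod (\<phi> w\<^sub>0))\<^sup>2) * chis \<theta> X)"
      by (rule arg_cong)
    also have "\<dots> = cos (phase (idx X) \<theta>) * (cmod (\<phi> w\<^sub>0))\<^sup>2"
      by (simp add: Re_chi mult.commute del: of_real_power)
    finally show ?thesis .
  qed
  then show ?thesis unfolding hform_split sum_distrib_right by simp
qed

text \<open>The sum of cosines is largest at 0 and smallest at \<open>\<theta>\<^sub>0\<close>,
  where each equals -1. The forms are ordered accordingly, so all bands have their ends at the same
  two quasimomenta.\<close>

lemma loop_band:
  assumes "i < \<nu>"
  shows "bmin Q (Suc i) = ev Q 0 i" "bmax Q (Suc i) = ev Q \<theta>\<^sub>0 i"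
proof -
  have "hform Q 0 \<phi> \<le> hform Q \<theta> \<phi> + 0 * wsq \<phi>" for \<theta> \<phi>
    unfolding hform_loop by (simp, intro mult_right_mono sum_mono) (auto simp: phase_zero)
  then have 1: "ev Q 0 i \<le> ev Q \<theta> i" for \<theta> using ev_shift[OF assms, of Q 0 Q \<theta> 0] by simp
  have "hform Q \<theta> \<phi> \<le> hform Q \<theta>\<^sub>0 \<phi> + 0 * wsq \<phi>" for \<theta> \<phi>
    unfolding hform_loop by (simp, intro mult_right_mono sum_mono) (auto simp: precise)
  then have 2: "ev Q \<theta> i \<le> ev Q \<theta>\<^sub>0 i" for \<theta> using ev_shift[OF assms, of Q \<theta> Q \<theta>\<^sub>0 0] by simp
  show "bmin Q (Suc i) = ev Q 0 i" "bmax Q (Suc i) = ev Q \<theta>\<^sub>0 i"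
    using band_bounds[OF assms 1 2] ev_in_band[OF assms, of Q 0] ev_in_band[OF assms, of Q \<theta>\<^sub>0] by auto
qed

text \<open>\<open>H(\<theta>\<^sub>0)\<close> is a rank one perturbation of \<open>H(0)\<close>.\<close>

lemma loop_interlacing:
  assumes "Suc i < \<nu>" shows "ev Q \<theta>\<^sub>0 i \<le> ev Q 0 (Suc i)"
proof -
  obtain j where j: "j < \<nu>" "w\<^sub>0 = v (Suc j)" using enum_Suc w0 by (auto simp: bij_betw_def)
  obtain u where u: "eigensystem \<nu> (hmat Q \<theta>\<^sub>0) u (ev Q \<theta>\<^sub>0)" using eigensystem_hmat by blast
  obtain u' where u': "eigensystem \<nu> (hmat Q 0) u' (ev Q 0)" using eigensystem_hmat by blast
  \<comment> \<open>The single constraint: vanishing at \<open>w\<^sub>0\<close>, where the two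
    forms agree.\<close>
  let ?q = "\<lambda>r l. if l = j then 1 else 0 :: complex"
  have "ev Q \<theta>\<^sub>0 i \<le> ev Q 0 (i + 1)"
  proof (rule eigenvalue_comparison[OF hermitian_hmat u hermitian_hmat u', where q = ?q])
    fix x assume x0: "\<And>r :: nat. r < 1 \<Longrightarrow> hip \<nu> (?q r) x = 0"
    have "hip \<nu> (?q 0) x = (\<Sum>l<\<nu>. if l = j then x l else 0)"
      unfolding hip_def by (intro sum.cong) auto
    then have xj: "x j = 0" using x0[of 0] j(1) by simp
    obtain \<phi> where \<phi>: "\<forall>l<\<nu>. x l = lift \<phi> l" using lift_surj by blast
    then have "\<phi> w\<^sub>0 = 0" using xj j by (simp add: lift_def)
    then have "hform Q \<theta>\<^sub>0 \<phi> = hform Q 0 \<phi>" by (simp add: hform_loop)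
    moreover have "qform \<nu> A x = qform \<nu> A (lift \<phi>)" for A using \<phi> by (intro qform_cong) simp
    ultimately show "qform \<nu> (hmat Q \<theta>\<^sub>0) x \<le> qform \<nu> (hmat Q 0) x" by (simp add: qform_weighted_mat)
  qed (use assms in simp)
  then show ?thesis by simp
qed

text \<open>The band ends belong to two common quasimomenta, so the lengths sum to a difference of
  traces, to which each bridge contributes 1 - (-1) = 2.\<close>

lemma loop_sum_lengths:
  "(\<Sum>n=1..\<nu>. bmax Q n - bmin Q n) = 2 * real (card Br)"
proof -
  let ?L = "{X \<in> F. fsrc X = ftgt X}"
  have BL: "Br \<subseteq> ?L" using loops bridges_subset by force
  have tr: "(\<Sum>i<\<nu>. ev Q \<theta> i) = (\<Sum>w\<in>W. hdiag Q w) - (\<Sum>X\<in>?L. Re (chis \<theta> X))" for \<theta>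
  proof -
    obtain u where u: "eigensystem \<nu> (hmat Q \<theta>) u (ev Q \<theta>)" using eigensystem_hmat by blast
    show ?thesis unfolding trace_eq_sum_eigenvalues[OF u] by (rule trace_weighted_mat)
  qed
  have "(\<Sum>n=1..\<nu>. bmax Q n - bmin Q n) = (\<Sum>i<\<nu>. ev Q \<theta>\<^sub>0 i - ev Q 0 i)"
    unfolding sum_1_nu by (intro sum.cong refl) (simp add: loop_band)
  also have "\<dots> = (\<Sum>X\<in>?L. Re (chis 0 X) - Re (chis \<theta>\<^sub>0 X))"
    by (simp add: sum_subtractf tr)
  also have "\<dots> = (\<Sum>X\<in>Br. Re (chis 0 X) - Re (chis \<theta>\<^sub>0 X))"
    using BL finite_F by (intro sum.mono_neutral_right) (auto simp: bridges_iff chi_zero)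
  also have "\<dots> = (\<Sum>X\<in>Br. 2)"
    by (intro sum.cong refl) (simp add: Re_chi precise phase_zero)
  finally show ?thesis by simp
qed

text \<open>Interlacing separates the bands up to end points, so the union has the sum of the
  lengths as its measure. The full family serves for the spectrum, general \<open>N\<close> for the
  gap sums.\<close>

lemma loop_measure_UN:
  assumes "nondegenerate \<Gamma> v Q \<subseteq> N" "N \<subseteq> {1..\<nu>}"
  shows "measure lborel (bands Q N) = 2 * real (card Br)"
proof -
  have "measure lborel (bands Q N) =
      (\<Sum>n\<in>N. bmax Q n - bmin Q n)"
  proof (rule measure_UN_Icc_nonoverlapping)
    show "finite N" using assms(2) finite_subset by blast
    show "bmin Q n \<le> bmax Q n" if "n \<in> N" for n
      using assms(2) that by (intro band_eq_Icc(2)) auto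
    fix m n assume mn: "m \<in> N" "n \<in> N" "m < n"
    then obtain i j where ij: "m = Suc i" "n = Suc j" "i < j" "j < \<nu>"
      using assms(2) by (cases m; cases n) auto
    have "ev Q \<theta>\<^sub>0 i \<le> ev Q 0 (Suc i)" using ij by (intro loop_interlacing) simp
    also have "\<dots> \<le> ev Q 0 j" using ij by (intro ev_mono) auto
    finally show "bmax Q m \<le> bmin Q n" using ij by (simp add: loop_band)
  qed
  then show ?thesis by (simp only: sum_lengths_nondegenerate[OF assms] loop_sum_lengths)
qed

lemma loop_gap_sum:
  assumes "gap_enum \<gamma> s Q"
  shows "(\<Sum>n=1..s. measure lborel (\<gamma> n)) =
    bmax Q \<nu> - bmin Q 1 - 2 * real (card Br)"
proof -
  obtain N where N: "nondegenerate \<Gamma> v Q \<subseteq> N" "N \<subseteq> {1..\<nu>}"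
    "(\<Sum>n=1..s. measure lborel (\<gamma> n)) = bmax Q \<nu> - bmin Q 1 -
      measure lborel (bands Q N)"
    by (rule gap_families[OF assms])
  then show ?thesis using loop_measure_UN[OF N(1,2)] by simp
qed

end

end

section \<open>The spectrum is the union of the bands\<close>

text \<open>For each nonzero \<open>m\<close> the excluded frequencies form countably many
  hyperplanes; a countable union of null sets does not cover the space.\<close>

lemma generic_frequency:
  fixes M :: "(int ^ 'd::finite) set"
  assumes "finite M" "0 \<notin> M"
  obtains \<psi> where "\<And>m. m \<in> M \<Longrightarrow> chi m \<psi> \<noteq> 1"
proof -
  let ?H = "\<lambda>(m, k). {\<theta> :: real ^ 'd. (\<chi> s. real_of_int (m $ s)) \<bullet> \<theta> = 2 * pi * real_of_int k}"
  have "negligible (\<Union>(?H ` (M \<times> (UNIV :: int set))))"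
  proof (rule negligible_countable_Union)
    show "countable (?H ` (M \<times> (UNIV :: int set)))"
      using assms(1) by (intro countable_image countable_SIGMA) (auto intro: countable_finite)
    fix T assume "T \<in> ?H ` (M \<times> (UNIV :: int set))"
    then obtain m k where mk: "m \<in> M" "T = ?H (m, k)" by auto
    then have "m \<noteq> 0" using assms(2) by auto
    then have "(\<chi> s. real_of_int (m $ s)) \<noteq> 0" by (auto simp: vec_eq_iff)
    then show "negligible T" unfolding mk(2) prod.case by (intro negligible_hyperplane) simp
  qed
  then have "\<Union>(?H ` (M \<times> (UNIV :: int set))) \<noteq> UNIV" by (metis non_negligible_UNIV)
  then obtain \<psi> where \<psi>: "\<psi> \<notin> \<Union>(?H ` (M \<times> (UNIV :: int set)))" by blast
  have "chi m \<psi> \<noteq> 1" if "m \<in> M" for m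
  proof
    assume "chi m \<psi> = 1"
    then obtain k :: int where "phase m \<psi> = real_of_int (2 * k) * pi"
      unfolding chi_def exp_eq_1 by auto
    then have "\<psi> \<in> ?H (m, k)" by (simp add: phase_def inner_vec_def)
    then show False using \<psi> that by blast
  qed
  then show ?thesis by (rule that)
qed

lemma chi_scaleR: "chi m (real k *\<^sub>R \<psi>) = chi m \<psi> ^ k"
proof -
  have "phase m (real k *\<^sub>R \<psi>) = real k * phase m \<psi>"
    by (simp add: phase_def sum_distrib_left algebra_simps)
  then show ?thesis by (simp add: chi_def exp_of_nat_mult[symmetric] algebra_simps)
qed

text \<open>For \<open>z \<noteq> 1\<close> the geometric sums stay bounded, so their means tend to
  0.\<close>

lemma mean_power_tendsto:
  fixes z :: complex
  assumes "cmod z = 1"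
  shows "(\<lambda>K. (\<Sum>k<K. z ^ k) / of_nat K) \<longlonglongrightarrow> (if z = 1 then 1 else 0)"
proof (cases "z = 1")
  case True
  have "eventually (\<lambda>K. (\<Sum>k<K. z ^ k) / of_nat K = 1) sequentially"
    using eventually_gt_at_top[of 0] by eventually_elim (simp add: True)
  then show ?thesis using True by (simp add: tendsto_eventually)
next
  case False
  have "(\<lambda>K. (\<Sum>k<K. z ^ k) / of_nat K) \<longlonglongrightarrow> 0"
  proof (rule Lim_null_comparison)
    have "norm ((\<Sum>k<K. z ^ k) / of_nat K) \<le> (2 / cmod (z - 1)) / real K" for K
    proof -
      have "cmod (z ^ K - 1) \<le> 2"
        using norm_triangle_ineq4[of "z ^ K" 1] by (simp add: norm_power assms)
      then have "cmod ((z ^ K - 1) / (z - 1)) \<le> 2 / cmod (z - 1)"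
        by (simp add: norm_divide divide_right_mono)
      then show ?thesis
        unfolding geometric_sum[OF False] norm_divide[of _ "of_nat K"] norm_of_nat
        by (rule divide_right_mono) simp
    qed
    then show "eventually (\<lambda>K. norm ((\<Sum>k<K. z ^ k) / of_nat K) \<le> (2 / cmod (z - 1)) / real K) sequentially"
      by simp
    show "(\<lambda>K. (2 / cmod (z - 1)) / real K) \<longlonglongrightarrow> 0" by (rule lim_const_over_n)
  qed
  with False show ?thesis by simp
qed

text \<open>Parseval's identity, with a mean along the orbit of a generic frequency instead of the integral
  over the torus.\<close>

lemma bohr_mean_tendsto:
  fixes a :: "'b \<Rightarrow> complex" and m :: "'b \<Rightarrow> int ^ 'd::finite"
  assumes "finite I" and generic: "\<And>i j. i \<in> I \<Longrightarrow> j \<in> I \<Longrightarrow> i \<noteq> j \<Longrightarrow> chi (m i - m j) \<psi> \<noteq> 1"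
  shows "(\<lambda>K. (\<Sum>k<K. (cmod (\<Sum>i\<in>I. a i * cnj (chi (m i) (real k *\<^sub>R \<psi>))))\<^sup>2) / real K)
    \<longlonglongrightarrow> (\<Sum>i\<in>I. (cmod (a i))\<^sup>2)"
proof -
  let ?c = "\<lambda>k. (cmod (\<Sum>i\<in>I. a i * cnj (chi (m i) (real k *\<^sub>R \<psi>))))\<^sup>2"
  let ?d = "\<lambda>i j. a i * cnj (a j)"
  have sq: "complex_of_real (?c k) =
      (\<Sum>i\<in>I. \<Sum>j\<in>I. ?d i j * chi (m j - m i) \<psi> ^ k)" for k
  proof -
    have "chi (m j - m i) \<psi> ^ k = chi (m j) (real k *\<^sub>R \<psi>) * cnj (chi (m i) (real k *\<^sub>R \<psi>))" for i j
      by (simp add: cnj_chi flip: chi_add chi_scaleR)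
    then show ?thesis
      unfolding complex_norm_square by (simp add: sum_product algebra_simps)
  qed
  have "complex_of_real ((\<Sum>k<K. ?c k) / real K)
      = (\<Sum>i\<in>I. \<Sum>j\<in>I. ?d i j * ((\<Sum>k<K. chi (m j - m i) \<psi> ^ k) / of_nat K))" for K
  proof -
    have "complex_of_real ((\<Sum>k<K. ?c k) / real K)
        = (\<Sum>k<K. \<Sum>i\<in>I. \<Sum>j\<in>I. ?d i j * chi (m j - m i) \<psi> ^ k) / of_nat K"
      unfolding of_real_divide of_real_sum sq by simp
    also have "(\<Sum>k<K. \<Sum>i\<in>I. \<Sum>j\<in>I. ?d i j * chi (m j - m i) \<psi> ^ k) =
        (\<Sum>i\<in>I. \<Sum>k<K. \<Sum>j\<in>I. ?d i j * chi (m j - m i) \<psi> ^ k)"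
      by (rule sum.swap)
    also have "\<dots> = (\<Sum>i\<in>I. \<Sum>j\<in>I. \<Sum>k<K. ?d i j * chi (m j - m i) \<psi> ^ k)"
      by (intro sum.cong refl sum.swap)
    finally show ?thesis by (simp add: sum_distrib_left sum_divide_distrib)
  qed
  moreover have "(\<lambda>K. \<Sum>i\<in>I. \<Sum>j\<in>I. ?d i j * ((\<Sum>k<K. chi (m j - m i) \<psi> ^ k) / of_nat K))
      \<longlonglongrightarrow> (\<Sum>i\<in>I. \<Sum>j\<in>I. ?d i j * (if chi (m j - m i) \<psi> = 1 then 1 else 0))"
    by (intro tendsto_intros mean_power_tendsto cmod_chi)
  \<comment> \<open>Genericity leaves only the diagonal terms of the expanded square.\<close>
  moreover have "(\<Sum>i\<in>I. \<Sum>j\<in>I. ?d i j * (if chi (m j - m i) \<psi> = 1 then 1 else 0)) =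
      complex_of_real (\<Sum>i\<in>I. (cmod (a i))\<^sup>2)"
  proof -
    have "(\<Sum>j\<in>I. ?d i j * (if chi (m j - m i) \<psi> = 1 then 1 else 0)) =
        (\<Sum>j\<in>I. if j = i then a i * cnj (a i) else 0)" if "i \<in> I" for i
      using generic that by (intro sum.cong refl) (auto simp: chi_zero)
    then show ?thesis
      using assms(1) by (simp add: complex_norm_square del: of_real_power)
  qed
  ultimately have "(\<lambda>K. complex_of_real ((\<Sum>k<K. ?c k) / real K))
      \<longlonglongrightarrow> complex_of_real (\<Sum>i\<in>I. (cmod (a i))\<^sup>2)"
    by (simp only:)
  then show ?thesis by (simp only: tendsto_of_real_iff)
qed

section \<open>Volume growth of boxes\<close>

definition int_box :: "nat \<Rightarrow> (int ^ 'd::finite) set" where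
  "int_box n = {m. \<forall>s. m $ s \<in> {- int n..int n}}"

lemma int_box: "finite (int_box n :: (int ^ 'd::finite) set)"
  "card (int_box n :: (int ^ 'd) set) = (2 * n + 1) ^ CARD('d)"
proof -
  let ?P = "PiE UNIV (\<lambda>_ :: 'd. {- int n..int n})"
  have bij: "bij_betw (\<lambda>f. \<chi> s. f s) ?P (int_box n :: (int ^ 'd) set)"
    by (rule bij_betw_byWitness[where f' = "\<lambda>m s. m $ s"]) (auto simp: int_box_def PiE_iff)
  have "finite ?P" by (intro finite_PiE) auto
  then show "finite (int_box n :: (int ^ 'd) set)" using bij_betw_finite[OF bij] by simp
  have "card {- int n..int n} = 2 * n + 1" by (simp only: card_atLeastAtMost_int)
  then have "card ?P = (2 * n + 1) ^ CARD('d)" by (simp add: card_PiE)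
  then show "card (int_box n :: (int ^ 'd) set) = (2 * n + 1) ^ CARD('d)"
    using bij_betw_same_card[OF bij] by simp
qed

text \<open>A shell of fixed width is negligible against the box: after division by
  \<open>(2 * n + 1) ^ d\<close> the right side tends to 0.\<close>

lemma no_linear_growth:
  assumes "\<And>n. real ((2 * n + 1) ^ d) \<le> B * (real ((2 * (n + r) + 1) ^ d) - real ((2 * n + 1) ^ d))"
  shows False
proof -
  have lim: "(\<lambda>n. real (2 * (n + r) + 1) / real (2 * n + 1)) \<longlonglongrightarrow> 1"
  proof -
    have "(\<lambda>n. 1 + 2 * real r * (1 / real (2 * n + 1))) \<longlonglongrightarrow> 1 + 2 * real r * 0"
    proof (intro tendsto_intros)
      have "filterlim (\<lambda>n. real (2 * n + 1)) at_top sequentially"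
        by (rule filterlim_at_top_mono[OF filterlim_real_sequentially]) simp
      then show "(\<lambda>n. 1 / real (2 * n + 1)) \<longlonglongrightarrow> 0"
        by (rule real_tendsto_divide_at_top[OF tendsto_const])
    qed
    moreover have "1 + 2 * real r * (1 / real (2 * n + 1)) = real (2 * (n + r) + 1) / real (2 * n + 1)" for n
      by (simp add: field_simps)
    ultimately show ?thesis by simp
  qed
  have "(\<lambda>n. B * ((real (2 * (n + r) + 1) / real (2 * n + 1)) ^ d - 1)) \<longlonglongrightarrow> B * (1 ^ d - 1)"
    by (intro tendsto_intros lim)
  moreover have "1 \<le> B * ((real (2 * (n + r) + 1) / real (2 * n + 1)) ^ d - 1)" for n
  proof -
    have pos: "0 < real (2 * n + 1) ^ d" by simp
    have "1 * real (2 * n + 1) ^ d \<le> B * (real (2 * (n + r) + 1) ^ d - real (2 * n + 1) ^ d)"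
      using assms[of n] by (simp only: of_nat_power mult_1)
    then have "1 \<le> (B * (real (2 * (n + r) + 1) ^ d - real (2 * n + 1) ^ d)) / real (2 * n + 1) ^ d"
      using pos by (simp only: pos_le_divide_eq)
    also have "\<dots> = B * ((real (2 * (n + r) + 1) / real (2 * n + 1)) ^ d - 1)"
      using pos by (simp only: power_divide right_diff_distrib diff_divide_distrib times_divide_eq_right) simp
    finally show ?thesis .
  qed
  ultimately have "1 \<le> B * (1 ^ d - 1)" by (intro LIMSEQ_le_const) auto
  then show False by simp
qed

context floquet
begin

text \<open>The Gelfand transform of \<open>f\<close> restricted to \<open>G\<close>, that is, its
  pairing with the plane wave of the point mass at \<open>w\<close>.\<close>

definition bloch :: "(real ^ 'd) set \<Rightarrow> real ^ 'd \<Rightarrow> (real ^ 'd \<Rightarrow> complex) \<Rightarrow> real ^ 'd \<Rightarrow> complex" where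
  "bloch G \<theta> f w = (\<Sum>u | u \<in> G \<and> fpart u = w. f u * cnj (chi (ipart u) \<theta>))"

text \<open>Hermitian symmetry tested on a point mass, in the form in which \<open>bloch_op\<close>
  takes the operator off the plane wave again.\<close>

lemma floquet_op_sym:
  assumes "w \<in> W"
  shows "(\<Sum>w'\<in>W. cnj (floquet_op Q \<theta> (\<lambda>u. if u = w then 1 else 0) w') * \<phi> w') = floquet_op Q \<theta> \<phi> w"
proof -
  let ?d = "\<lambda>u. if u = w then 1 else 0 :: complex"
  obtain j where j: "j < \<nu>" "w = v (Suc j)" using enum_Suc assms by (auto simp: bij_betw_def)
  have "(\<Sum>w'\<in>W. cnj (floquet_op Q \<theta> ?d w') * \<phi> w') = hip \<nu> (mv \<nu> (hmat Q \<theta>) (lift ?d)) (lift \<phi>)"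
    unfolding sum_W hip_def by (intro sum.cong refl) (simp add: mv_hmat, simp add: lift_def)
  also have "\<dots> = hip \<nu> (lift ?d) (mv \<nu> (hmat Q \<theta>) (lift \<phi>))"
    by (rule hip_mv_sym[OF hermitian_hmat, symmetric])
  also have "\<dots> = (\<Sum>k<\<nu>. if k = j then mv \<nu> (hmat Q \<theta>) (lift \<phi>) j else 0)"
    unfolding hip_def using j by (intro sum.cong refl) (auto simp: lift_def v_eq_iff)
  also have "\<dots> = floquet_op Q \<theta> \<phi> w" using j by (simp add: mv_hmat)
  finally show ?thesis .
qed

lemma floquet_residual_ge:
  assumes "0 \<le> \<delta>" "\<And>i. i < \<nu> \<Longrightarrow> \<delta> \<le> \<bar>ev Q \<theta> i - x\<bar>"
  shows "\<delta>\<^sup>2 * wsq \<phi> \<le> (\<Sum>w\<in>W. (cmod (floquet_op Q \<theta> \<phi> w - of_real x * \<phi> w))\<^sup>2)"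
proof -
  obtain u where u: "eigensystem \<nu> (hmat Q \<theta>) u (ev Q \<theta>)" using eigensystem_hmat by blast
  have "\<delta>\<^sup>2 * nsq \<nu> (lift \<phi>) \<le> nsq \<nu> (\<lambda>j. mv \<nu> (hmat Q \<theta>) (lift \<phi>) j - of_real x * lift \<phi> j)"
    by (rule nsq_residual_ge[OF u hermitian_hmat assms])
  also have "\<dots> = nsq \<nu> (lift (\<lambda>w. floquet_op Q \<theta> \<phi> w - of_real x * \<phi> w))"
    by (intro nsq_cong) (simp add: mv_hmat, simp add: lift_def)
  finally show ?thesis by (simp only: nsq_lift)
qed

end

text \<open>The point \<open>x\<close> is built into the kernel, so that \<open>ker.op\<close> is
  \<open>H - x\<close> on functions vanishing off the vertices. The bound \<open>C\<close> depends
  on \<open>x\<close>, hence one instance of the locale for each point.\<close>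

locale floquet_spectrum = floquet \<Gamma> v + ker: hermitian_kernel "vertices \<Gamma>" "kernel Q x" nbhd C
  for \<Gamma> :: "('d::finite, 'e) lattice_graph" and v and Q :: "real ^ 'd \<Rightarrow> real" and x C :: real +
  assumes per: "periodic_potential \<Gamma> Q"
begin

lemma op_eq: "(\<And>u. u \<notin> V \<Longrightarrow> f u = 0) \<Longrightarrow> ker.op f u = schroedinger \<Gamma> Q f u - of_real x * f u"
  by (rule op_kernel[OF ker.hermitian_kernel_axioms])

lemma op_plane_wave:
  assumes "u \<in> V"
  shows "ker.op (plane_wave \<theta> \<phi>) u = plane_wave \<theta> (\<lambda>w. floquet_op Q \<theta> \<phi> w - of_real x * \<phi> w) u"
proof -
  have "ker.op (plane_wave \<theta> \<phi>) u = schroedinger \<Gamma> Q (plane_wave \<theta> \<phi>) u - of_real x * plane_wave \<theta> \<phi> u"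
    by (rule op_eq) (simp add: plane_wave_def)
  also have "\<dots> = plane_wave \<theta> (floquet_op Q \<theta> \<phi>) u - of_real x * plane_wave \<theta> \<phi> u"
    by (simp only: schroedinger_plane_wave[OF per assms])
  finally show ?thesis using assms by (simp add: plane_wave_def algebra_simps)
qed

text \<open>A Bloch component is a pairing with a plane wave, onto which \<open>H - x\<close> can be
  moved by symmetry; there it acts through the Floquet operator.\<close>

lemma bloch_op:
  assumes G: "finite G" "G \<subseteq> V" "supported_on G f" "supported_on G (ker.op f)" and w: "w \<in> W"
  shows "bloch G \<theta> (ker.op f) w = floquet_op Q \<theta> (bloch G \<theta> f) w - of_real x * bloch G \<theta> f w"
proof -
  let ?d = "\<lambda>u. if u = w then 1 else 0 :: complex"
  let ?E = "\<lambda>w'. floquet_op Q \<theta> ?d w' - of_real x * ?d w'"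
  have "bloch G \<theta> (ker.op f) w = (\<Sum>u\<in>G. cnj (plane_wave \<theta> ?d u) * ker.op f u)"
    unfolding bloch_def using G by (intro sum.mono_neutral_cong_left) (auto simp: plane_wave_def)
  also have "\<dots> = (\<Sum>u\<in>G. cnj (ker.op (plane_wave \<theta> ?d) u) * f u)"
    by (rule ker.op_symmetric[OF G(1-3) G(1,2,4)]) (simp add: plane_wave_def)
  also have "\<dots> = (\<Sum>u\<in>G. cnj (?E (fpart u)) * (f u * cnj (chi (ipart u) \<theta>)))"
    using G(2) by (intro sum.cong refl) (auto simp: op_plane_wave plane_wave_def)
  also have "\<dots> = (\<Sum>w'\<in>W. \<Sum>u | u \<in> G \<and> fpart u = w'. cnj (?E (fpart u)) * (f u * cnj (chi (ipart u) \<theta>)))"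
    using G finite_W fpart_in_W by (intro sum.group[symmetric]) auto
  also have "\<dots> = (\<Sum>w'\<in>W. cnj (?E w') * bloch G \<theta> f w')"
    unfolding bloch_def by (intro sum.cong refl) (simp add: sum_distrib_left)
  also have "\<dots> = (\<Sum>w'\<in>W. cnj (floquet_op Q \<theta> ?d w') * bloch G \<theta> f w') -
      (\<Sum>w'\<in>W. if w' = w then of_real x * bloch G \<theta> f w else 0)"
    unfolding sum_subtractf[symmetric] by (intro sum.cong refl) (auto simp: algebra_simps)
  also have "\<dots> = floquet_op Q \<theta> (bloch G \<theta> f) w - of_real x * bloch G \<theta> f w"
    unfolding floquet_op_sym[OF w] using w finite_W by simp
  finally show ?thesis .
qed

text \<open>The residual bound holds in every fibre with the same \<open>\<delta>\<close>; averaging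
  it over the multiples of a generic frequency turns fibre norms into \<open>l2\<close>
  norms.\<close>

lemma op_bounded_below:
  assumes \<delta>: "0 \<le> \<delta>" "\<And>\<theta> i. i < \<nu> \<Longrightarrow> \<delta> \<le> \<bar>ev Q \<theta> i - x\<bar>" and f: "ker.fin_supp f"
  shows "\<delta> * l2_norm V f \<le> l2_norm V (ker.op f)"
proof -
  obtain G where G: "finite G" "G \<subseteq> V" "supported_on G f" "supported_on G (ker.op f)"
    by (rule ker.fin_supp_common[OF f ker.fin_supp_op[OF f]])
  let ?I = "\<lambda>w. {u. u \<in> G \<and> fpart u = w}"
  \<comment> \<open>All nonzero differences of integer parts on \<open>G\<close>: the frequencies
    whose characters have to average to 0.\<close>
  let ?M = "(\<lambda>(u, u'). ipart u - ipart u') ` (G \<times> G) - {0}"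
  obtain \<psi> where \<psi>: "\<And>m. m \<in> ?M \<Longrightarrow> chi m \<psi> \<noteq> 1"
    by (rule generic_frequency[of ?M]) (use G in auto)
  have mean: "(\<lambda>K. \<Sum>w\<in>W. (\<Sum>k<K. (cmod (bloch G (real k *\<^sub>R \<psi>) h w))\<^sup>2) / real K) \<longlonglongrightarrow> (l2_norm V h)\<^sup>2"
    if h: "supported_on G h" for h
  proof -
    have "(\<lambda>K. \<Sum>w\<in>W. (\<Sum>k<K. (cmod (bloch G (real k *\<^sub>R \<psi>) h w))\<^sup>2) / real K)
        \<longlonglongrightarrow> (\<Sum>w\<in>W. \<Sum>u\<in>?I w. (cmod (h u))\<^sup>2)"
      unfolding bloch_def
    proof (intro tendsto_sum bohr_mean_tendsto)
      fix w u u' assume u: "u \<in> ?I w" "u' \<in> ?I w" "u \<noteq> u'"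
      \<comment> \<open>Distinct vertices above the same fundamental vertex differ in their integer
        parts.\<close>
      have "ipart u \<noteq> ipart u'"
        using u frac_plus_int[of u] frac_plus_int[of u'] by auto
      then show "chi (ipart u - ipart u') \<psi> \<noteq> 1" using u by (intro \<psi>) auto
    qed (use G in auto)
    also have "(\<Sum>w\<in>W. \<Sum>u\<in>?I w. (cmod (h u))\<^sup>2) = (\<Sum>u\<in>G. (cmod (h u))\<^sup>2)"
      using G finite_W fpart_in_W by (intro sum.group) auto
    also have "\<dots> = (l2_norm V h)\<^sup>2"
      using l2_norm_finite_support(2)[OF G(1,2) h] by (simp add: L2_set_def sum_nonneg)
    finally show ?thesis .
  qed
  have "\<delta>\<^sup>2 * (\<Sum>w\<in>W. (\<Sum>k<K. (cmod (bloch G (real k *\<^sub>R \<psi>) f w))\<^sup>2) / real K) \<le>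
      (\<Sum>w\<in>W. (\<Sum>k<K. (cmod (bloch G (real k *\<^sub>R \<psi>) (ker.op f) w))\<^sup>2) / real K)" for K
  proof -
    have swap: "(\<Sum>w\<in>W. (\<Sum>k<K. g k w) / real K) = (\<Sum>k<K. \<Sum>w\<in>W. g k w) / real K" for g :: "nat \<Rightarrow> real ^ 'd \<Rightarrow> real"
      by (subst sum.swap) (simp add: sum_divide_distrib)
    have "\<delta>\<^sup>2 * (\<Sum>w\<in>W. (cmod (bloch G \<theta> f w))\<^sup>2) \<le> (\<Sum>w\<in>W. (cmod (bloch G \<theta> (ker.op f) w))\<^sup>2)" for \<theta>
    proof -
      have "(\<Sum>w\<in>W. (cmod (bloch G \<theta> (ker.op f) w))\<^sup>2) =
          (\<Sum>w\<in>W. (cmod (floquet_op Q \<theta> (bloch G \<theta> f) w - of_real x * bloch G \<theta> f w))\<^sup>2)"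
        by (intro sum.cong refl) (simp add: bloch_op[OF G])
      then show ?thesis using floquet_residual_ge[OF \<delta>] by simp
    qed
    then show ?thesis
      unfolding swap times_divide_eq_right sum_distrib_left[of "\<delta>\<^sup>2" _ "{..<K}"]
      by (intro divide_right_mono sum_mono) auto
  qed
  then have "\<delta>\<^sup>2 * (l2_norm V f)\<^sup>2 \<le> (l2_norm V (ker.op f))\<^sup>2"
    by (intro LIMSEQ_le[OF tendsto_mult[OF tendsto_const mean[OF G(3)]] mean[OF G(4)]]) auto
  then have "(\<delta> * l2_norm V f)\<^sup>2 \<le> (l2_norm V (ker.op f))\<^sup>2" by (simp only: power_mult_distrib)
  then show ?thesis by (rule power2_le_imp_le[OF _ l2_norm_nonneg])
qed

lemma spec_iff:
  "x \<in> spec \<Gamma> Q \<longleftrightarrow> \<not> (bij_betw ker.op (l2 V) (l2 V) \<and>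
    (\<exists>B. \<forall>f\<in>l2 V. l2_norm V f \<le> B * l2_norm V (ker.op f)))"
proof -
  have eq: "(\<lambda>u. schroedinger \<Gamma> Q f u - of_real x * f u) = ker.op f" if "f \<in> l2 V" for f
    using op_eq[of f] l2_off[OF that] by (simp add: fun_eq_iff)
  then have "bij_betw (\<lambda>f u. schroedinger \<Gamma> Q f u - of_real x * f u) (l2 V) (l2 V) \<longleftrightarrow>
      bij_betw ker.op (l2 V) (l2 V)"
    by (intro bij_betw_cong) simp
  then show ?thesis unfolding spec_def l2_spectrum_def by (simp add: eq)
qed

lemma not_in_spec:
  assumes "0 < \<delta>" "\<And>\<theta> i. i < \<nu> \<Longrightarrow> \<delta> \<le> \<bar>ev Q \<theta> i - x\<bar>"
  shows "x \<notin> spec \<Gamma> Q"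
proof -
  have "\<delta> * l2_norm V f \<le> l2_norm V (ker.op f)" if "ker.fin_supp f" for f
    using assms that by (intro op_bounded_below) auto
  from ker.op_invertible[OF assms(1) this] show ?thesis by (simp add: spec_iff)
qed

definition vbox :: "nat \<Rightarrow> (real ^ 'd) set" where
  "vbox n = {u \<in> V. ipart u \<in> int_box n}"

lemma sum_vbox:
  fixes g :: "real ^ 'd \<Rightarrow> real"
  shows "finite (vbox n)" "(\<Sum>u\<in>vbox n. g (fpart u)) = real ((2 * n + 1) ^ CARD('d)) * (\<Sum>w\<in>W. g w)"
proof -
  have bij: "bij_betw (\<lambda>(w, m). w + lvec m) (W \<times> int_box n) (vbox n)"
  proof (rule bij_betw_byWitness[where f' = "\<lambda>u. (fpart u, ipart u)"])
    show "(\<lambda>(w, m). w + lvec m) ` (W \<times> int_box n) \<subseteq> vbox n"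
      by (auto simp: vbox_def ipart_shift ipart_W intro: vertex_shift W_subset_V)
  qed (auto simp: vbox_def frac_plus_int frac_shift_vertex ipart_shift ipart_W fpart_in_W)
  then show "finite (vbox n)"
    using bij_betw_finite finite_W int_box(1) by (metis finite_SigmaI)
  have "(\<Sum>u\<in>vbox n. g (fpart u)) = (\<Sum>p\<in>W \<times> int_box n. g (fpart (case p of (w, m) \<Rightarrow> w + lvec m)))"
    by (rule sum.reindex_bij_betw[OF bij, symmetric])
  also have "\<dots> = (\<Sum>(w, m)\<in>W \<times> (int_box n :: (int ^ 'd) set). g w)"
    by (rule sum.cong) (auto simp: frac_shift_vertex)
  also have "\<dots> = (\<Sum>w\<in>W. \<Sum>m\<in>(int_box n :: (int ^ 'd) set). g w)" by (rule sum.cartesian_product[symmetric])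
  finally show "(\<Sum>u\<in>vbox n. g (fpart u)) = real ((2 * n + 1) ^ CARD('d)) * (\<Sum>w\<in>W. g w)"
    by (simp only: sum_constant int_box(2) sum_distrib_left)
qed

lemma card_vbox: "real (card (vbox n)) = real ((2 * n + 1) ^ CARD('d)) * real \<nu>"
  using sum_vbox(2)[of "\<lambda>_. 1" n] by (simp add: num_verts_def)

text \<open>There are finitely many fundamental edges and the index is constant on orbits, so the
  hopping range is finite.\<close>

lemma edge_range_bounded:
  obtains r where "\<And>u w s. u \<in> V \<Longrightarrow> w \<in> nbhd u \<Longrightarrow> \<bar>ipart w $ s - ipart u $ s\<bar> \<le> int r"
proof -
  define r where "r = nat (\<Sum>X\<in>F. \<Sum>s\<in>UNIV. \<bar>idx X $ s\<bar>)"
  have "\<bar>ipart w $ s - ipart u $ s\<bar> \<le> int r" if "u \<in> V" "w \<in> nbhd u" for u w s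
  proof (cases "w = u")
    case False
    then obtain e where e: "e \<in> E" "src e = u" "tgt e = w"
      using \<open>w \<in> nbhd u\<close> by (auto simp: nbhd_def out_arcs_def)
    then have X: "orbit e \<in> F" by (simp add: F_eq)
    have "\<bar>ipart w $ s - ipart u $ s\<bar> = \<bar>idx (orbit e) $ s\<bar>"
      using e by (simp add: index_orbit edge_index_def)
    also have "\<dots> \<le> (\<Sum>s\<in>UNIV. \<bar>idx (orbit e) $ s\<bar>)"
      by (intro member_le_sum) auto
    also have "\<dots> \<le> (\<Sum>X\<in>F. \<Sum>s\<in>UNIV. \<bar>idx X $ s\<bar>)"
      using X finite_F by (intro member_le_sum[of _ _ "\<lambda>X. \<Sum>s\<in>UNIV. \<bar>idx X $ s\<bar>"]) (auto intro: sum_nonneg)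
    also have "\<dots> = int r" by (simp add: r_def sum_nonneg)
    finally show ?thesis .
  qed simp
  then show ?thesis by (rule that)
qed

text \<open>Weyl sequence: truncated Bloch waves, whose images live near the boundary of the box.\<close>

lemma ev_in_spec:
  assumes i: "i < \<nu>" and x: "x = ev Q \<theta> i"
  shows "x \<in> spec \<Gamma> Q"
proof (rule ccontr)
  assume "x \<notin> spec \<Gamma> Q"
  then obtain B where B: "\<And>f. f \<in> l2 V \<Longrightarrow> l2_norm V f \<le> B * l2_norm V (ker.op f)"
    unfolding spec_iff by blast
  obtain \<phi> where \<phi>: "wsq \<phi> = 1" "\<forall>w\<in>W. floquet_op Q \<theta> \<phi> w = of_real (ev Q \<theta> i) * \<phi> w"
    using eigenfunction_exists[OF i, where Q = Q and \<theta> = \<theta>] by blast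
  have \<phi>1: "cmod (\<phi> w) \<le> 1" if "w \<in> W" for w
  proof -
    have "(cmod (\<phi> w))\<^sup>2 \<le> 1"
      unfolding \<phi>(1)[symmetric] using that finite_W by (intro member_le_sum[of w W "\<lambda>w. (cmod (\<phi> w))\<^sup>2"]) auto
    then show ?thesis by (simp add: power_le_one_iff abs_square_le_1[symmetric])
  qed
  let ?\<Phi> = "plane_wave \<theta> \<phi>"
  have \<Phi>: "cmod (?\<Phi> u) = cmod (\<phi> (fpart u))" if "u \<in> V" for u
    using that by (simp add: plane_wave_def norm_mult cmod_chi)
  have op\<Phi>: "ker.op ?\<Phi> u = 0" if "u \<in> V" for u
  proof -
    have "floquet_op Q \<theta> \<phi> (fpart u) - of_real x * \<phi> (fpart u) = 0"
      using \<phi>(2) fpart_in_W[OF that] x by simp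
    then show ?thesis by (simp add: op_plane_wave[OF that] plane_wave_def)
  qed
  obtain r where r: "\<And>u w s. u \<in> V \<Longrightarrow> w \<in> nbhd u \<Longrightarrow> \<bar>ipart w $ s - ipart u $ s\<bar> \<le> int r"
    using edge_range_bounded by blast
  have near: "w \<in> vbox (n + r)" if "u \<in> vbox n" "w \<in> nbhd u" for u w n
  proof -
    have u: "u \<in> V" using that by (simp add: vbox_def)
    have "ipart w $ s \<in> {- int (n + r)..int (n + r)}" for s
    proof -
      have "ipart u $ s \<in> {- int n..int n}" using that unfolding vbox_def int_box_def by blast
      then show ?thesis using r[OF u that(2), of s] by auto
    qed
    then show ?thesis using ker.N_subset[OF u] that(2) by (auto simp: vbox_def int_box_def)
  qed
  have mono: "vbox n \<subseteq> vbox (n + 2 * r)" for n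
  proof
    fix u assume u: "u \<in> vbox n"
    have "ipart u $ s \<in> {- int (n + 2 * r)..int (n + 2 * r)}" for s
    proof -
      have "ipart u $ s \<in> {- int n..int n}" using u unfolding vbox_def int_box_def by blast
      then show ?thesis by auto
    qed
    then show "u \<in> vbox (n + 2 * r)" using u by (simp add: vbox_def int_box_def)
  qed
  \<comment> \<open>\<open>B\<close> comes from the bounded inverse, \<open>C\<close> bounds the
    values of the image pointwise, and each lattice cell holds \<open>\<nu>\<close>
    vertices.\<close>
  define D where "D = B\<^sup>2 * C\<^sup>2 * real \<nu>"
  let ?b = "\<lambda>n. real ((2 * n + 1) ^ CARD('d))"
  have "?b n \<le> D * (?b (n + 2 * r) - ?b n)" for n
  proof -
    \<comment> \<open>The cut is at \<open>n + r\<close>: rows in \<open>vbox n\<close> see only the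
      uncut wave, which is annihilated, and rows outside \<open>vbox (n + 2 * r)\<close> see only
      zeros.\<close>
    define f where "f = (\<lambda>u. if u \<in> vbox (n + r) then ?\<Phi> u else 0)"
    have G: "finite (vbox m)" "vbox m \<subseteq> V" for m by (auto simp: sum_vbox(1)) (auto simp: vbox_def)
    have fG: "supported_on (vbox (n + r)) f" by (simp add: f_def supported_on_def)
    have fl: "f \<in> l2 V" by (rule l2_norm_finite_support(1)[OF G fG])
    have "(l2_norm V f)\<^sup>2 = (\<Sum>u\<in>vbox (n + r). (cmod (f u))\<^sup>2)"
      using l2_norm_finite_support(2)[OF G fG] by (simp add: L2_set_def sum_nonneg)
    also have "\<dots> = (\<Sum>u\<in>vbox (n + r). (cmod (\<phi> (fpart u)))\<^sup>2)"
      by (intro sum.cong refl) (simp add: f_def vbox_def \<Phi>)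
    also have "\<dots> = ?b (n + r)" by (simp only: sum_vbox(2)[of "\<lambda>w. (cmod (\<phi> w))\<^sup>2"] \<phi>(1) mult_1_right)
    finally have fn: "(l2_norm V f)\<^sup>2 = ?b (n + r)" .
    let ?R = "vbox (n + 2 * r) - vbox n"
    have opR: "supported_on ?R (ker.op f)"
      unfolding supported_on_def
    proof (intro allI impI)
      fix u assume u: "u \<notin> ?R"
      show "ker.op f u = 0"
      proof (cases "u \<in> V")
        case True
        show ?thesis
        proof (cases "u \<in> vbox n")
          case in_box: True
          have "ker.op f u = ker.op ?\<Phi> u"
            unfolding ker.op_def using near[OF in_box] by (auto simp: f_def intro!: sum.cong)
          then show ?thesis using op\<Phi>[OF True] by simp
        next
          case False
          with u have "u \<notin> vbox (n + 2 * r)" by simp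
          moreover have "u \<in> vbox (n + 2 * r)" if "w \<in> nbhd u" "w \<in> vbox (n + r)" for w
            using near[OF that(2) ker.N_sym[OF True that(1)]] by (simp add: mult_2 add.assoc)
          ultimately have "f w = 0" if "w \<in> nbhd u" for w using that by (auto simp: f_def)
          then show ?thesis by (simp add: ker.op_def)
        qed
      qed (simp add: ker.op_def)
    qed
    have opC: "cmod (ker.op f u) \<le> C" if u: "u \<in> V" for u
    proof -
      have f1: "cmod (f w) \<le> 1" if "w \<in> V" for w
        using \<phi>1[OF fpart_in_W[OF that]] \<Phi>[OF that] by (simp add: f_def)
      have "cmod (ker.op f u) \<le> (\<Sum>w\<in>nbhd u. cmod (kernel Q x u w * f w))"
        using u by (simp add: ker.op_def norm_sum)
      also have "\<dots> \<le> (\<Sum>w\<in>nbhd u. cmod (kernel Q x u w))"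
        using ker.N_subset[OF u] f1 by (intro sum_mono) (auto simp: norm_mult intro!: mult_left_le)
      also have "\<dots> \<le> C" by (rule ker.K_bound[OF u])
      finally show ?thesis .
    qed
    have R: "finite ?R" "?R \<subseteq> V" using G by auto
    have "(l2_norm V (ker.op f))\<^sup>2 = (\<Sum>u\<in>?R. (cmod (ker.op f u))\<^sup>2)"
      using l2_norm_finite_support(2)[OF R opR] by (simp add: L2_set_def sum_nonneg)
    also have "\<dots> \<le> (\<Sum>u\<in>?R. C\<^sup>2)"
      using R(2) opC by (intro sum_mono power_mono) auto
    also have "\<dots> = C\<^sup>2 * (real (card (vbox (n + 2 * r))) - real (card (vbox n)))"
      using G mono card_mono[OF G(1) mono[of n]] by (simp add: card_Diff_subset of_nat_diff)
    also have "\<dots> = C\<^sup>2 * real \<nu> * (?b (n + 2 * r) - ?b n)"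
      unfolding card_vbox by (simp only: algebra_simps)
    finally have opn: "(l2_norm V (ker.op f))\<^sup>2 \<le> C\<^sup>2 * real \<nu> * (?b (n + 2 * r) - ?b n)" .
    have "?b n \<le> ?b (n + r)" by (simp only: of_nat_le_iff) (rule power_mono, auto)
    also have "\<dots> \<le> (B * l2_norm V (ker.op f))\<^sup>2"
      unfolding fn[symmetric] by (rule power_mono[OF B[OF fl] l2_norm_nonneg])
    also have "\<dots> \<le> B\<^sup>2 * (C\<^sup>2 * real \<nu> * (?b (n + 2 * r) - ?b n))"
      unfolding power_mult_distrib by (rule mult_left_mono[OF opn]) simp
    finally show ?thesis by (simp only: D_def mult.assoc)
  qed
  then show False by (rule no_linear_growth)
qed

end

context floquet
begin

text \<open>Finitely many closed bands have a closed union, so a point off the bands keeps a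
  positive distance from all eigenvalues, uniformly in \<open>\<theta>\<close>; this is the
  \<open>\<delta>\<close> of the lower bound.\<close>

theorem spec_eq_bands:
  assumes "periodic_potential \<Gamma> Q"
  shows "spec \<Gamma> Q = bands Q {1..\<nu>}"
proof -
  have eq: "bands Q {1..\<nu>} = (\<Union>n\<in>{1..\<nu>}. band \<Gamma> v Q n)"
    by (intro SUP_cong refl band_eq_Icc(1)[symmetric])
  have *: "x \<in> spec \<Gamma> Q \<longleftrightarrow> x \<in> bands Q {1..\<nu>}" for x
  proof -
    obtain C where "hermitian_kernel V (kernel Q x) nbhd C" by (rule hermitian_kernel_exists[OF assms])
    then interpret floquet_spectrum \<Gamma> v Q x C
      using assms floquet_axioms by (simp add: floquet_spectrum_def floquet_spectrum_axioms_def)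
    show ?thesis
    proof
      assume x: "x \<in> bands Q {1..\<nu>}"
      then obtain n \<theta> where n: "n \<in> {1..\<nu>}" "x = nth_eigenvalue (floquet_matrix \<Gamma> v Q \<theta>) n"
        unfolding eq by (auto simp: band_def)
      then show "x \<in> spec \<Gamma> Q" by (intro ev_in_spec[of "n - 1" \<theta>]) auto
    next
      assume spec: "x \<in> spec \<Gamma> Q"
      show "x \<in> bands Q {1..\<nu>}"
      proof (rule ccontr)
        assume x: "x \<notin> bands Q {1..\<nu>}" (is "x \<notin> ?U")
        have "closed ?U" by (intro closed_UN) auto
        then have "open (- ?U)" by (rule open_Compl)
        moreover have "x \<in> - ?U" unfolding Compl_iff by (rule x)
        ultimately obtain \<delta> where \<delta>: "0 < \<delta>" "ball x \<delta> \<subseteq> - ?U" by (rule openE)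
        have "\<delta> \<le> \<bar>ev Q \<theta> i - x\<bar>" if "i < \<nu>" for \<theta> i
        proof (rule ccontr)
          assume "\<not> \<delta> \<le> \<bar>ev Q \<theta> i - x\<bar>"
          then have "ev Q \<theta> i \<in> ball x \<delta>" by (simp add: dist_real_def)
          moreover have "ev Q \<theta> i \<in> {bmin Q (Suc i)..bmax Q (Suc i)}"
            using ev_in_band[OF that] by simp
          moreover have "Suc i \<in> {1..\<nu>}" using that by simp
          ultimately show False using \<delta>(2) by blast
        qed
        with not_in_spec[OF \<delta>(1)] spec show False by blast
      qed
    qed
  qed
  then show ?thesis by blast
qed

end

theorem theorem2p1:
  fixes \<Gamma> :: "('d::finite, 'e) lattice_graph"
    and Q :: "real ^ 'd \<Rightarrow> real"
    and v :: "nat \<Rightarrow> real ^ 'd"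
    and \<nu> \<beta> :: nat
  assumes "CARD('d) \<ge> 2"
    and "periodic_graph \<Gamma>"
    and "periodic_potential \<Gamma> Q"
    and "\<nu> = num_verts \<Gamma>"
    and "\<beta> = card (bridges \<Gamma>)"
    and "bij_betw v {1..\<nu>} (verts (fund_graph \<Gamma>))"
  shows
    "((\<exists>j\<in>{1..\<nu>}. \<exists>k\<in>{1..\<nu>}. \<not> (\<lambda>\<theta>. cmod (floquet_laplacian \<Gamma> v j k \<theta>)) constant_on UNIV)
        \<longrightarrow> band_min \<Gamma> v Q 1 < band_max \<Gamma> v Q 1) \<and>
     measure lborel (spec \<Gamma> Q) \<le> (\<Sum>n=1..\<nu>. measure lborel (band \<Gamma> v Q n)) \<and>
     (\<Sum>n=1..\<nu>. measure lborel (band \<Gamma> v Q n)) \<le> 2 * real \<beta> \<and>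
     (\<forall>(s::nat) \<gamma>. bij_betw \<gamma> {1..s} (all_gaps \<Gamma> v Q) \<or>
        (nondegenerate_ends \<Gamma> v Q \<and> bij_betw \<gamma> {1..s} (strict_gaps \<Gamma> v Q)) \<longrightarrow>
        (\<Sum>n=1..s. measure lborel (\<gamma> n))
          \<ge> band_max \<Gamma> v Q \<nu> - band_min \<Gamma> v Q 1 - 2 * real \<beta>) \<and>
     band_max \<Gamma> v Q \<nu> - band_min \<Gamma> v Q 1 - 2 * real \<beta> \<ge> C0 \<Gamma> v Q - 2 * real \<beta> \<and>
     (precise_loop_fund_graph \<Gamma> \<and>
      (\<exists>k\<in>{1..\<nu>}. \<forall>X\<in>bridges \<Gamma>. tail (fund_graph \<Gamma>) X = v k \<and> head (fund_graph \<Gamma>) X = v k) \<longrightarrow>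
        measure lborel (spec \<Gamma> Q) = (\<Sum>n=1..\<nu>. measure lborel (band \<Gamma> v Q n)) \<and>
        (\<Sum>n=1..\<nu>. measure lborel (band \<Gamma> v Q n)) = 2 * real \<beta> \<and>
        (\<forall>(s::nat) \<gamma>. bij_betw \<gamma> {1..s} (all_gaps \<Gamma> v Q) \<or>
           (nondegenerate_ends \<Gamma> v Q \<and> bij_betw \<gamma> {1..s} (strict_gaps \<Gamma> v Q)) \<longrightarrow>
           (\<Sum>n=1..s. measure lborel (\<gamma> n))
             = band_max \<Gamma> v Q \<nu> - band_min \<Gamma> v Q 1 - 2 * real \<beta>))"
proof -
  interpret floquet \<Gamma> v
    using assms(2,4,6) by (simp add: floquet_def floquet_axioms_def)
  have nu: "\<nu> = num_verts \<Gamma>" and beta: "\<beta> = card (bridges \<Gamma>)" using assms(4,5) by auto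
  let ?n = "num_verts \<Gamma>" and ?b = "2 * real (card Br)"
  have spec: "spec \<Gamma> Q = bands Q {1..?n}"
    by (rule spec_eq_bands[OF assms(3)])
  have lengths: "(\<Sum>n=1..?n. measure lborel (band \<Gamma> v Q n)) =
      (\<Sum>n=1..?n. bmax Q n - bmin Q n)"
    by (intro sum.cong refl measure_band)
  have spec_le: "measure lborel (spec \<Gamma> Q) \<le> (\<Sum>n=1..?n. bmax Q n - bmin Q n)"
    unfolding spec by (intro measure_UN_Icc_le band_eq_Icc(2)) auto
  have loop: "measure lborel (spec \<Gamma> Q) = ?b \<and>
      (\<Sum>n=1..?n. bmax Q n - bmin Q n) = ?b \<and>
      (\<forall>s \<gamma>. gap_enum \<gamma> s Q \<longrightarrow>
        (\<Sum>n=1..s. measure lborel (\<gamma> n)) = bmax Q (?n) - bmin Q 1 - ?b)"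
    if p: "precise_loop_fund_graph \<Gamma>" and k: "k \<in> {1..?n}"
      and loops: "\<forall>X\<in>Br. fsrc X = v k \<and> ftgt X = v k" for k
  proof -
    obtain \<theta>\<^sub>0 where precise: "\<And>X. X \<in> Br \<Longrightarrow> cos (phase (idx X) \<theta>\<^sub>0) = -1"
      using p by (auto simp: precise_loop_fund_graph_def)
    have vk: "v k \<in> W" using k enum by (auto simp: bij_betw_def)
    \<comment> \<open>With all bands as \<open>N\<close>, the measure formula for loop graphs
      becomes the measure of the spectrum.\<close>
    have nd: "nondegenerate \<Gamma> v Q \<subseteq> {1..?n}" by (auto simp: nondegenerate_def)
    note loop_facts = vk loops[rule_format] precise
    show ?thesis
      unfolding spec using loop_measure_UN[OF loop_facts nd order_refl]
        loop_sum_lengths[OF loop_facts] loop_gap_sum[OF loop_facts] by blast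
  qed
  show ?thesis
    unfolding nu beta lengths
    apply (intro conjI impI allI)
    subgoal using first_band_nondegenerate[of _ _ Q] by blast
    subgoal by (rule spec_le)
    subgoal by (rule sum_band_lengths_le)
    subgoal by (rule gap_sum_ge)
    subgoal using spectrum_width_ge_C0[of Q] by simp
    subgoal by (elim conjE bexE, drule (2) loop) simp
    subgoal by (elim conjE bexE, drule (2) loop) simp
    subgoal by (elim conjE[of "precise_loop_fund_graph \<Gamma>"] bexE, drule (2) loop) blast
    done
qed

end
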